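(* Let $G=(V,E,\pi)$ be a locally finite Borel graph and let $(A,B)$ be a Borel bipartition of $G$ that has combinatorial expansion. If $G$ is everywhere $2$-ended, then $G$ has a Borel matching covering $A$.
   Context: A Borel graph (multigraph) is a triple $G=(V,E,\pi)$ where the vertex set $V$ and the edge set $E$ are standard Borel spaces and $\pi\colon E\to[V]^2$ is a Borel map sending each edge to its pair of endpoints; $[V]^2$ is the set of unordered pairs of distinct elements of $V$. Thus graphs are undirected and loopless, and parallel edges are allowed. $G$ is locally finite if every vertex is incident to finitely many edges. $N_G(x)$ is the set of neighbors of $x$, and $N_G(S)=\bigcup_{x\in S}N_G(x)$. A bipartition of $G$ is a partition $V=A\sqcup B$ such that every edge has one endpoint in $A$ and the other in $B$; it is Borel if $A$ and $B$ are Borel sets. It has combinatorial expansion if there is $c>1$ such that $|N_G(S)|\ge c|S|$ for every finite set $S\subseteq A$. The number of ends of a connected locally finite graph is the supremum, over all finite sets $S$ of vertices, of the number of infinite connected components of the graph obtained by deleting $S$ and all edges incident to $S$. A locally finite graph is everywhere $2$-ended if each of its connected components has exactly $2$ ends. A matching is a set $M\subseteq E$ of edges whose endpoint sets are pairwise disjoint; it is Borel if it is a Borel subset of $E$. $M$ covers $A$ if every $x\in A$ is an endpoint of some edge in $M$. *)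

theory Defs
  imports "HOL-Analysis.Analysis" "HOL-Library.Extended_Nat" "HOL-Library.Disjoint_Sets"
begin

section \<open>Standard Borel spaces\<close>

text \<open>Values of type \<open>'a measure\<close> are used as measurable spaces only: the measure they carry is
  irrelevant.\<close>

definition standard_borel :: "'a measure \<Rightarrow> bool" where
  "standard_borel M \<longleftrightarrow>
     (\<exists>X. completely_metrizable_space X \<and> separable_space X \<and> topspace X = space M \<and>
          sets M = sigma_sets (space M) {U. openin X U})"

text \<open>The space $[V]^2$ of unordered pairs of distinct points carries the quotient of the Borel
  structure of $V \times V$ minus the diagonal under swapping coordinates.\<close>

definition unordered_pairs :: "'v measure \<Rightarrow> 'v set measure" where
  "unordered_pairs V =
     (let P = {{x, y} | x y. x \<in> space V \<and> y \<in> space V \<and> x \<noteq> y}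
      in sigma P {Q. Q \<subseteq> P \<and>
           {(x, y). x \<in> space V \<and> y \<in> space V \<and> x \<noteq> y \<and> {x, y} \<in> Q} \<in> sets (V \<Otimes>\<^sub>M V)})"

lemma space_unordered_pairs:
  "space (unordered_pairs V) = {{x, y} | x y. x \<in> space V \<and> y \<in> space V \<and> x \<noteq> y}"
  unfolding unordered_pairs_def Let_def by (rule space_measure_of) auto


text \<open>The family generating \<^const>\<open>unordered_pairs\<close> is already a sigma-algebra when the diagonal is
  measurable, as it is for a standard Borel space.\<close>

lemma sets_unordered_pairs:
  "Q \<in> sets (unordered_pairs V) \<longleftrightarrow>
     Q \<subseteq> space (unordered_pairs V) \<and>
     {(x, y). x \<in> space V \<and> y \<in> space V \<and> x \<noteq> y \<and> {x, y} \<in> Q} \<in> sets (V \<Otimes>\<^sub>M V)"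
  if diag: "{(x, y). x \<in> space V \<and> y \<in> space V \<and> x \<noteq> y} \<in> sets (V \<Otimes>\<^sub>M V)"
proof -
  let ?P = "{{x, y} | x y. x \<in> space V \<and> y \<in> space V \<and> x \<noteq> y}"
  let ?r = "\<lambda>Q. {(x, y). x \<in> space V \<and> y \<in> space V \<and> x \<noteq> y \<and> {x, y} \<in> Q}"
  let ?F = "{Q. Q \<subseteq> ?P \<and> ?r Q \<in> sets (V \<Otimes>\<^sub>M V)}"
  have "sigma_algebra ?P ?F"
    unfolding sigma_algebra_iff2
  proof (intro conjI ballI allI impI)
    show "?F \<subseteq> Pow ?P" by auto
    show "{} \<in> ?F" by simp
  next
    fix Q assume Q: "Q \<in> ?F"
    have "?r (?P - Q) = {(x, y). x \<in> space V \<and> y \<in> space V \<and> x \<noteq> y} - ?r Q" by auto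
    with Q diag show "?P - Q \<in> ?F" by auto
  next
    fix Q :: "nat \<Rightarrow> _" assume Q: "range Q \<subseteq> ?F"
    have "?r (\<Union>i. Q i) = (\<Union>i. ?r (Q i))" by auto
    moreover have "(\<Union>i. ?r (Q i)) \<in> sets (V \<Otimes>\<^sub>M V)"
      using Q by (intro sets.countable_UN) auto
    ultimately show "(\<Union>i. Q i) \<in> ?F" using Q by auto
  qed
  then have "sets (unordered_pairs V) = ?F"
    unfolding unordered_pairs_def Let_def
    by (subst sets_measure_of) (auto simp: sigma_algebra.sigma_sets_eq)
  then show ?thesis by (simp add: space_unordered_pairs)
qed


section \<open>Multigraphs\<close>

text \<open>A multigraph is given by its set of vertices, its set of edges, and the map sending an edge
  to its set of endpoints.\<close>

definition neighbors :: "'e set \<Rightarrow> ('e \<Rightarrow> 'v set) \<Rightarrow> 'v \<Rightarrow> 'v set" where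
  "neighbors E \<pi> x = {y. \<exists>e\<in>E. \<pi> e = {x, y}}"

definition locally_finite_graph :: "'v set \<Rightarrow> 'e set \<Rightarrow> ('e \<Rightarrow> 'v set) \<Rightarrow> bool" where
  "locally_finite_graph V E \<pi> \<longleftrightarrow> (\<forall>x\<in>V. finite {e \<in> E. x \<in> \<pi> e})"

definition graph_components :: "'v set \<Rightarrow> 'e set \<Rightarrow> ('e \<Rightarrow> 'v set) \<Rightarrow> 'v set set" where
  "graph_components V E \<pi> = V // ({(x, y). y \<in> neighbors E \<pi> x}\<^sup>* \<inter> V \<times> V)"

definition infinite_components :: "'v set \<Rightarrow> 'e set \<Rightarrow> ('e \<Rightarrow> 'v set) \<Rightarrow> 'v set set" where
  "infinite_components V E \<pi> = {C \<in> graph_components V E \<pi>. infinite C}"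

definition ecard :: "'a set \<Rightarrow> enat" where
  "ecard A = (if finite A then enat (card A) else \<infinity>)"

definition number_of_ends :: "'v set \<Rightarrow> 'e set \<Rightarrow> ('e \<Rightarrow> 'v set) \<Rightarrow> enat" where
  "number_of_ends V E \<pi> =
     (SUP S\<in>{S. finite S \<and> S \<subseteq> V}.
        ecard (infinite_components (V - S) {e \<in> E. \<pi> e \<inter> S = {}} \<pi>))"

definition everywhere_two_ended :: "'v set \<Rightarrow> 'e set \<Rightarrow> ('e \<Rightarrow> 'v set) \<Rightarrow> bool" where
  "everywhere_two_ended V E \<pi> \<longleftrightarrow>
     (\<forall>C \<in> graph_components V E \<pi>. number_of_ends C {e \<in> E. \<pi> e \<subseteq> C} \<pi> = 2)"

definition bipartition :: "'v set \<Rightarrow> 'e set \<Rightarrow> ('e \<Rightarrow> 'v set) \<Rightarrow> 'v set \<Rightarrow> 'v set \<Rightarrow> bool" where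
  "bipartition V E \<pi> A B \<longleftrightarrow>
     A \<union> B = V \<and> A \<inter> B = {} \<and> (\<forall>e\<in>E. \<exists>a\<in>A. \<exists>b\<in>B. \<pi> e = {a, b})"

text \<open>The condition is vacuous for sets \<open>S\<close> with infinitely many neighbors; this needs to be said
  since \<^const>\<open>card\<close> is 0 on infinite sets. There are none in a locally finite graph.\<close>

definition combinatorial_expansion :: "'e set \<Rightarrow> ('e \<Rightarrow> 'v set) \<Rightarrow> 'v set \<Rightarrow> bool" where
  "combinatorial_expansion E \<pi> A \<longleftrightarrow>
     (\<exists>c::real. c > 1 \<and>
        (\<forall>S. finite S \<and> S \<subseteq> A \<and> finite (\<Union>x\<in>S. neighbors E \<pi> x) \<longrightarrow>
           real (card (\<Union>x\<in>S. neighbors E \<pi> x)) \<ge> c * real (card S)))"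

definition matching :: "'e set \<Rightarrow> ('e \<Rightarrow> 'v set) \<Rightarrow> 'e set \<Rightarrow> bool" where
  "matching E \<pi> M \<longleftrightarrow> M \<subseteq> E \<and> disjoint_family_on \<pi> M"

definition covers :: "('e \<Rightarrow> 'v set) \<Rightarrow> 'e set \<Rightarrow> 'v set \<Rightarrow> bool" where
  "covers \<pi> M A \<longleftrightarrow> (\<forall>x\<in>A. \<exists>e\<in>M. x \<in> \<pi> e)"


section \<open>Borel graphs\<close>

definition borel_graph :: "'v measure \<Rightarrow> 'e measure \<Rightarrow> ('e \<Rightarrow> 'v set) \<Rightarrow> bool" where
  "borel_graph V E \<pi> \<longleftrightarrow>
     standard_borel V \<and> standard_borel E \<and> \<pi> \<in> measurable E (unordered_pairs V)"

end

theory Submission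
  imports Defs
begin

text \<open>
  Let \<open>T\<close> be a union of pairwise disjoint finite sets, called zones, such that removing \<open>T\<close> leaves
  only finite pieces. One can match the vertices of \<open>A\<close> in each zone first, and then the other
  vertices of \<open>A\<close> in each piece separately. The danger is that the partners used by the zones spoil
  Hall's condition for the rest. Choose the partners in each zone so that Hall's condition survives
  the removal of that zone alone. A minimal set \<open>X\<close> that violates the condition after the removal of
  all zones is connected, hence it is near two zones at least. If the zones are far apart, \<open>X\<close>
  contains many vertices near each zone that it meets, and the surplus \<open>(c - 1) |X|\<close> given by
  expansion is at least the number of neighbors of \<open>X\<close> lost to the zones
  (\<open>hall_remove_far_pieces\<close>). This needs zones whose sizes are bounded in each component, with
  distances large compared to the bound.

  Two-endedness provides the zones: they are finite connected sets that separate the two ends. Give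
  such a set \<open>K\<close> a code consisting of a bound on its size and diameter, and a set from a
  countable family of Borel sets whose trace on a large neighborhood of \<open>K\<close> is \<open>K\<close>. Two sets
  with the same code are equal or far apart (\<open>zones_far\<close>), so the sets that have the least code
  occurring in a component can serve as the zones of this component. If all the pieces that they
  leave are finite, the argument above applies. If some piece is infinite, then only finitely many
  vertices of zones are adjacent to infinite pieces, since otherwise removing a few zones
  would exhibit three ends (\<open>finite_boundary_of_infinite_pieces\<close>). Such a component contains a
  finite nonempty set chosen in a Borel way, and it is matched as a whole, starting from this set.

  In all three situations (inside a zone, inside a finite piece, in a component with a distinguished
  finite set) the vertices can be numbered in a Borel way, and they are matched in this order: each
  receives the first neighbor for which Hall's condition continues to hold (\<open>greedy_matching\<close>).
  Such a neighbor exists by \<open>hall_step\<close>, and Hall's condition is Borel as it quantifies over the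
  finite subsets of a component.

  Quantifiers over a component, or over its finite subsets, are countable because each vertex reaches
  its component along words in countably many Borel maps. These maps exist by the theorem of Lusin
  and Novikov for finite-to-one maps: a finite-to-one Borel map is injective on each of countably
  many Borel sets covering its domain (\<open>finite_to_one_cover\<close>), and it maps these to Borel sets
  (\<open>injective_image_measurable\<close>). Both facts come from the separation of Souslin sets, in the form
  of \<open>novikov_separation\<close>.
\<close>

section \<open>Coding standard Borel spaces by sequences of natural numbers\<close>

text \<open>The family is a map from \<open>Z\<close> to a countable power of the natural numbers, and completeness says
  that the image of this map is closed in the product topology. Working with sets of functions
  instead of one map makes it possible to merge families by taking unions.\<close>

definition complete_family :: "'a set \<Rightarrow> ('a \<Rightarrow> nat) set \<Rightarrow> bool" where
  "complete_family Z G \<longleftrightarrow> countable G \<and>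
     (\<forall>z. (\<forall>F. finite F \<and> F \<subseteq> G \<longrightarrow> (\<exists>x\<in>Z. \<forall>g\<in>F. g x = z g)) \<longrightarrow>
          (\<exists>x\<in>Z. \<forall>g\<in>G. g x = z g))"

definition separating_family :: "'a set \<Rightarrow> ('a \<Rightarrow> nat) set \<Rightarrow> bool" where
  "separating_family Z G \<longleftrightarrow> (\<forall>x\<in>Z. \<forall>y\<in>Z. (\<forall>g\<in>G. g x = g y) \<longrightarrow> x = y)"

text \<open>In the topology that the family induces on \<open>Z\<close>, such a set \<open>W\<close> is clopen, and finitely many
  coordinates suffice to describe it.\<close>

definition decides :: "'a set \<Rightarrow> ('a \<Rightarrow> nat) set \<Rightarrow> 'a set \<Rightarrow> bool" where
  "decides Z G W \<longleftrightarrow>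
     (\<exists>F. finite F \<and> F \<subseteq> G \<and> (\<forall>x\<in>Z. \<forall>y\<in>Z. (\<forall>g\<in>F. g x = g y) \<longrightarrow> (x \<in> W \<longleftrightarrow> y \<in> W)))"

lemma complete_familyD:
  assumes "complete_family Z G"
    and "\<And>F. finite F \<Longrightarrow> F \<subseteq> G \<Longrightarrow> \<exists>x\<in>Z. \<forall>g\<in>F. g x = z g"
  shows "\<exists>x\<in>Z. \<forall>g\<in>G. g x = z g"
proof -
  have "(\<forall>F. finite F \<and> F \<subseteq> G \<longrightarrow> (\<exists>x\<in>Z. \<forall>g\<in>F. g x = z g)) \<longrightarrow> (\<exists>x\<in>Z. \<forall>g\<in>G. g x = z g)"
    using assms(1) unfolding complete_family_def by blast
  with assms(2) show ?thesis by simp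
qed

lemma decides_mono: "decides Z G W \<Longrightarrow> G \<subseteq> H \<Longrightarrow> decides Z H W"
  unfolding decides_def by (meson subset_trans)

lemma separating_family_mono: "separating_family Z G \<Longrightarrow> G \<subseteq> H \<Longrightarrow> separating_family Z H"
  unfolding separating_family_def by (metis subsetD)

text \<open>Adding the function that tells which of the sets \<open>W k\<close> comes first at a point turns their union
  into a decided set. A value \<open>Suc k\<close> in the limit is correct because the sets up to \<open>W k\<close> are decided;
  the value 0 is correct because each single \<open>W k\<close> is decided.\<close>

lemma complete_family_insert_index:
  fixes W :: "nat \<Rightarrow> 'a set"
  assumes G: "complete_family Z G" and W: "\<And>k. decides Z G (W k)"
    and m: "\<And>x. m x = (if \<exists>k. x \<in> W k then Suc (LEAST k. x \<in> W k) else 0)"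
  shows "complete_family Z (insert m G)"
  unfolding complete_family_def
proof (intro conjI allI impI)
  show "countable (insert m G)" using G unfolding complete_family_def by simp
next
  fix z assume fin: "\<forall>F. finite F \<and> F \<subseteq> insert m G \<longrightarrow> (\<exists>x\<in>Z. \<forall>g\<in>F. g x = z g)"
  obtain D where D: "\<And>k. finite (D k)" "\<And>k. D k \<subseteq> G"
      "\<And>k x y. x \<in> Z \<Longrightarrow> y \<in> Z \<Longrightarrow> (\<forall>g\<in>D k. g x = g y) \<Longrightarrow> (x \<in> W k \<longleftrightarrow> y \<in> W k)"
    using W unfolding decides_def by metis
  obtain x where x: "x \<in> Z" "\<And>g. g \<in> G \<Longrightarrow> g x = z g"
    using complete_familyD[OF G, of z] fin by (metis subset_insertI2)
  have near: "\<exists>y\<in>Z. m y = z m \<and> (\<forall>j\<le>k. x \<in> W j \<longleftrightarrow> y \<in> W j)" for k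
  proof -
    let ?F = "insert m (\<Union>j\<le>k. D j)"
    have "finite ?F" "?F \<subseteq> insert m G" using D(1,2) by auto
    then obtain y where y: "y \<in> Z" "\<forall>g\<in>?F. g y = z g" using fin by meson
    have "x \<in> W j \<longleftrightarrow> y \<in> W j" if "j \<le> k" for j
      proof (rule D(3)[OF x(1) y(1)], rule ballI)
      fix g assume "g \<in> D j"
      then have "g \<in> ?F" "g \<in> G" using that D(2) by auto
      then show "g x = g y" using x(2) y(2) by metis
    qed
    with y show ?thesis by auto
  qed
  have "m x = z m"
  proof (cases "\<exists>k. x \<in> W k")
    case True
    define k where "k = (LEAST k. x \<in> W k)"
    have k: "x \<in> W k" "\<And>j. j < k \<Longrightarrow> x \<notin> W j"
      using True unfolding k_def by (auto intro: LeastI dest: not_less_Least)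
    obtain y where y: "m y = z m" "\<And>j. j \<le> k \<Longrightarrow> x \<in> W j \<longleftrightarrow> y \<in> W j" using near by blast
    have "(LEAST j. y \<in> W j) = k"
      using k y(2) by (intro Least_equality) (auto intro: leI)
    then have "m y = Suc k" using m y(2) k by auto
    with y(1) show ?thesis using m[of x] True k_def by simp
  next
    case False
    then have "m x = 0" using m by simp
    moreover have "z m = 0"
    proof (rule ccontr)
      assume "z m \<noteq> 0"
      obtain y where y: "m y = z m" "\<And>j. j \<le> z m \<Longrightarrow> x \<in> W j \<longleftrightarrow> y \<in> W j" using near by blast
      have ex: "\<exists>k. y \<in> W k" using y(1) \<open>z m \<noteq> 0\<close> m[of y] by (auto split: if_splits)
      then have "z m = Suc (LEAST k. y \<in> W k)" using m[of y] y(1) by simp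
      then have "y \<in> W (z m - 1)" using LeastI_ex[OF ex] by simp
      with y(2)[of "z m - 1"] False show False by auto
    qed
    ultimately show ?thesis by simp
  qed
  with x show "\<exists>x\<in>Z. \<forall>g\<in>insert m G. g x = z g" by auto
qed

text \<open>Each family of the union yields a point that realises its part of the data. These points coincide
  since all the families contain the same separating family.\<close>

lemma complete_family_UN:
  fixes G :: "nat \<Rightarrow> ('a \<Rightarrow> nat) set"
  assumes G: "\<And>k. complete_family Z (G k)" and G0: "separating_family Z G0" "\<And>k. G0 \<subseteq> G k"
  shows "complete_family Z (\<Union>k. G k)"
  unfolding complete_family_def
proof (intro conjI allI impI)
  show "countable (\<Union>k. G k)" using G unfolding complete_family_def by auto
next
  fix z assume fin: "\<forall>F. finite F \<and> F \<subseteq> (\<Union>k. G k) \<longrightarrow> (\<exists>x\<in>Z. \<forall>g\<in>F. g x = z g)"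
  have "\<exists>x\<in>Z. \<forall>g\<in>G k. g x = z g" for k
  proof -
    show ?thesis by (rule complete_familyD[OF G]) (rule fin[rule_format], auto)
  qed
  then obtain x where x: "\<And>k. x k \<in> Z" "\<And>k g. g \<in> G k \<Longrightarrow> g (x k) = z g" by metis
  have "x k = x 0" for k
  proof -
    have "\<forall>g\<in>G0. g (x k) = g (x 0)" using x(2) G0(2) by (metis subsetD)
    with G0(1) x(1) show ?thesis unfolding separating_family_def by blast
  qed
  with x show "\<exists>x\<in>Z. \<forall>g\<in>(\<Union>k. G k). g x = z g" by (metis UN_iff)
qed

text \<open>Sets that become clopen after refining the topology given by \<open>G0\<close> to one that again has a closed
  image. For a standard Borel space these turn out to be all Borel sets, which replaces the
  usual refinement of Polish topologies.\<close>

definition coded_sets :: "'a set \<Rightarrow> ('a \<Rightarrow> nat) set \<Rightarrow> 'a set set" where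
  "coded_sets Z G0 = {W. W \<subseteq> Z \<and> (\<exists>G. G0 \<subseteq> G \<and> complete_family Z G \<and> decides Z G W)}"

definition codable :: "'a measure \<Rightarrow> bool" where
  "codable M \<longleftrightarrow> (\<exists>G0. complete_family (space M) G0 \<and> separating_family (space M) G0 \<and>
     sets M \<subseteq> coded_sets (space M) G0)"

lemma sigma_algebra_coded_sets:
  assumes G0: "complete_family Z G0" "separating_family Z G0"
  shows "sigma_algebra Z (coded_sets Z G0)"
  unfolding sigma_algebra_iff2 coded_sets_def
proof (intro conjI ballI allI impI)
  let ?D = "{W. W \<subseteq> Z \<and> (\<exists>G. G0 \<subseteq> G \<and> complete_family Z G \<and> decides Z G W)}"
  show "?D \<subseteq> Pow Z" by auto
  have "decides Z G0 {}" unfolding decides_def by auto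
  then show "{} \<in> ?D" using G0 by auto
next
  let ?D = "{W. W \<subseteq> Z \<and> (\<exists>G. G0 \<subseteq> G \<and> complete_family Z G \<and> decides Z G W)}"
  fix W assume "W \<in> ?D"
  moreover have "decides Z G (Z - W)" if "decides Z G W" for G
    using that unfolding decides_def by (metis DiffD2 DiffI)
  ultimately show "Z - W \<in> ?D" by auto
next
  let ?D = "{W. W \<subseteq> Z \<and> (\<exists>G. G0 \<subseteq> G \<and> complete_family Z G \<and> decides Z G W)}"
  fix W :: "nat \<Rightarrow> 'a set" assume W: "range W \<subseteq> ?D"
  have "\<forall>k. \<exists>G. G0 \<subseteq> G \<and> complete_family Z G \<and> decides Z G (W k)" using W by blast
  then obtain G where G: "\<And>k. G0 \<subseteq> G k" "\<And>k. complete_family Z (G k)" "\<And>k. decides Z (G k) (W k)"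
    by metis
  let ?G = "\<Union>k. G k"
  define m where "m x = (if \<exists>k. x \<in> W k then Suc (LEAST k. x \<in> W k) else 0)" for x
  have "complete_family Z ?G" by (rule complete_family_UN[OF G(2) G0(2) G(1)])
  then have "complete_family Z (insert m ?G)"
    by (rule complete_family_insert_index[OF _ _ m_def]) (rule decides_mono[OF G(3)], auto)
  moreover have "decides Z (insert m ?G) (\<Union>k. W k)"
    unfolding decides_def by (rule exI[of _ "{m}"]) (auto simp: m_def split: if_splits)
  moreover have "G0 \<subseteq> insert m ?G" using G(1) by auto
  moreover have "(\<Union>k. W k) \<subseteq> Z" using W by auto
  ultimately show "(\<Union>k. W k) \<in> ?D" by blast
qed

lemma codableI:
  assumes "complete_family (space M) G0" "separating_family (space M) G0"
    and "sets M = sigma_sets (space M) A" and "A \<subseteq> coded_sets (space M) G0"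
  shows "codable M"
proof -
  interpret sigma_algebra "space M" "coded_sets (space M) G0"
    by (rule sigma_algebra_coded_sets[OF assms(1,2)])
  have "sets M \<subseteq> coded_sets (space M) G0"
    unfolding assms(3) by (rule sigma_sets_subset[OF assms(4)])
  with assms(1,2) show ?thesis unfolding codable_def by blast
qed

lemma codableE:
  assumes "codable M"
  obtains G0 where "complete_family (space M) G0" "separating_family (space M) G0"
    "\<And>W. W \<in> sets M \<Longrightarrow> \<exists>G. G0 \<subseteq> G \<and> complete_family (space M) G \<and> decides (space M) G W"
  using assms unfolding codable_def coded_sets_def by blast

lemma codable_countable_family:
  fixes W :: "nat \<Rightarrow> 'a set"
  assumes M: "codable M" and W: "\<And>k. W k \<in> sets M"
  obtains G where "complete_family (space M) G" "separating_family (space M) G"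
    "\<And>k. decides (space M) G (W k)"
proof -
  obtain G0 where G0: "complete_family (space M) G0" "separating_family (space M) G0"
    "\<And>W. W \<in> sets M \<Longrightarrow> \<exists>G. G0 \<subseteq> G \<and> complete_family (space M) G \<and> decides (space M) G W"
    by (rule codableE[OF M]) blast
  from G0(3)[OF W] obtain G where G: "\<And>k. G0 \<subseteq> G k" "\<And>k. complete_family (space M) (G k)"
     "\<And>k. decides (space M) (G k) (W k)" by metis
  show thesis
  proof
    show "complete_family (space M) (\<Union>k. G k)" by (rule complete_family_UN[OF G(2) G0(2) G(1)])
    show "separating_family (space M) (\<Union>k. G k)"
      by (rule separating_family_mono[OF G0(2)]) (use G(1)[of 0] in blast)
    show "decides (space M) (\<Union>k. G k) (W k)" for k by (rule decides_mono[OF G(3)]) auto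
  qed
qed

lemma codable_pair:
  assumes "codable M" "codable N"
  shows "codable (M \<Otimes>\<^sub>M N)"
proof -
  have comp: "complete_family (A \<times> B) ((\<lambda>g. g \<circ> fst) ` G \<union> (\<lambda>g. g \<circ> snd) ` H)"
    if G: "complete_family A G" and H: "complete_family B H"
    for A :: "'a set" and B :: "'b set" and G H
    unfolding complete_family_def
  proof (intro conjI allI impI)
    show "countable ((\<lambda>g. g \<circ> fst) ` G \<union> (\<lambda>g. g \<circ> snd) ` H)"
      using G H unfolding complete_family_def by auto
  next
    fix z assume fin: "\<forall>F. finite F \<and> F \<subseteq> (\<lambda>g. g \<circ> fst) ` G \<union> (\<lambda>g. g \<circ> snd) ` H \<longrightarrow>
        (\<exists>x\<in>A \<times> B. \<forall>g\<in>F. g x = z g)"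
    have "\<exists>x\<in>A. \<forall>g\<in>F. g x = z (g \<circ> fst)" if "finite F" "F \<subseteq> G" for F
    proof -
      have "finite ((\<lambda>g. g \<circ> fst) ` F)" "(\<lambda>g. g \<circ> fst) ` F \<subseteq> (\<lambda>g. g \<circ> fst) ` G \<union> (\<lambda>g. g \<circ> snd) ` H"
        using that by auto
      from fin[rule_format, OF conjI, OF this]
      obtain p where "p \<in> A \<times> B" "\<forall>g\<in>(\<lambda>g. g \<circ> fst) ` F. g p = z g" by blast
      then show ?thesis by (intro bexI[of _ "fst p"]) auto
    qed
    from complete_familyD[OF G this]
    obtain x where x: "x \<in> A" "\<And>g. g \<in> G \<Longrightarrow> g x = z (g \<circ> fst)" by blast
    have "\<exists>x\<in>B. \<forall>g\<in>F. g x = z (g \<circ> snd)" if "finite F" "F \<subseteq> H" for F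
    proof -
      have "finite ((\<lambda>g. g \<circ> snd) ` F)" "(\<lambda>g. g \<circ> snd) ` F \<subseteq> (\<lambda>g. g \<circ> fst) ` G \<union> (\<lambda>g. g \<circ> snd) ` H"
        using that by auto
      from fin[rule_format, OF conjI, OF this]
      obtain p where "p \<in> A \<times> B" "\<forall>g\<in>(\<lambda>g. g \<circ> snd) ` F. g p = z g" by blast
      then show ?thesis by (intro bexI[of _ "snd p"]) auto
    qed
    from complete_familyD[OF H this]
    obtain y where y: "y \<in> B" "\<And>g. g \<in> H \<Longrightarrow> g y = z (g \<circ> snd)" by blast
    show "\<exists>x\<in>A \<times> B. \<forall>g\<in>(\<lambda>g. g \<circ> fst) ` G \<union> (\<lambda>g. g \<circ> snd) ` H. g x = z g"
      using x y by (intro bexI[of _ "(x, y)"]) auto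
  qed
  have sep: "separating_family (A \<times> B) ((\<lambda>g. g \<circ> fst) ` G \<union> (\<lambda>g. g \<circ> snd) ` H)"
    if "separating_family A G" "separating_family B H"
    for A :: "'a set" and B :: "'b set" and G H
    unfolding separating_family_def
  proof (intro ballI impI)
    fix p q assume p: "p \<in> A \<times> B" and q: "q \<in> A \<times> B"
      and eq: "\<forall>g\<in>(\<lambda>g. g \<circ> fst) ` G \<union> (\<lambda>g. g \<circ> snd) ` H. g p = g q"
    have "fst p \<in> A" "fst q \<in> A" "snd p \<in> B" "snd q \<in> B" using p q by auto
    moreover have "\<forall>g\<in>G. g (fst p) = g (fst q)" "\<forall>h\<in>H. h (snd p) = h (snd q)"
      using eq by (auto simp: ball_Un)
    ultimately show "p = q" using that unfolding separating_family_def by (simp add: prod_eq_iff)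
  qed
  have dec: "decides (A \<times> B) ((\<lambda>g. g \<circ> fst) ` G \<union> (\<lambda>g. g \<circ> snd) ` H) (X \<times> Y)"
    if X: "decides A G X" and Y: "decides B H Y"
    for A :: "'a set" and B :: "'b set" and G H X Y
  proof -
    obtain F1 where F1: "finite F1" "F1 \<subseteq> G"
        "\<And>x y. x \<in> A \<Longrightarrow> y \<in> A \<Longrightarrow> \<forall>g\<in>F1. g x = g y \<Longrightarrow> x \<in> X \<longleftrightarrow> y \<in> X"
      using X unfolding decides_def by metis
    obtain F2 where F2: "finite F2" "F2 \<subseteq> H"
        "\<And>x y. x \<in> B \<Longrightarrow> y \<in> B \<Longrightarrow> \<forall>g\<in>F2. g x = g y \<Longrightarrow> x \<in> Y \<longleftrightarrow> y \<in> Y"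
      using Y unfolding decides_def by metis
    show ?thesis unfolding decides_def
    proof (intro exI[of _ "(\<lambda>g. g \<circ> fst) ` F1 \<union> (\<lambda>g. g \<circ> snd) ` F2"] conjI ballI impI)
      fix p q assume p: "p \<in> A \<times> B" and q: "q \<in> A \<times> B"
        and eq: "\<forall>g\<in>(\<lambda>g. g \<circ> fst) ` F1 \<union> (\<lambda>g. g \<circ> snd) ` F2. g p = g q"
      have "fst p \<in> X \<longleftrightarrow> fst q \<in> X" by (rule F1(3)) (use p q eq in \<open>auto simp: ball_Un\<close>)
      moreover have "snd p \<in> Y \<longleftrightarrow> snd q \<in> Y" by (rule F2(3)) (use p q eq in \<open>auto simp: ball_Un\<close>)
      ultimately show "p \<in> X \<times> Y \<longleftrightarrow> q \<in> X \<times> Y" by (auto simp: mem_Times_iff)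
    qed (use F1 F2 in auto)
  qed
  obtain G0 where G0: "complete_family (space M) G0" "separating_family (space M) G0"
    "\<And>W. W \<in> sets M \<Longrightarrow> \<exists>G. G0 \<subseteq> G \<and> complete_family (space M) G \<and> decides (space M) G W"
    by (rule codableE[OF assms(1)]) blast
  obtain H0 where H0: "complete_family (space N) H0" "separating_family (space N) H0"
    "\<And>W. W \<in> sets N \<Longrightarrow> \<exists>G. H0 \<subseteq> G \<and> complete_family (space N) G \<and> decides (space N) G W"
    by (rule codableE[OF assms(2)]) blast
  show ?thesis
  proof (rule codableI)
    show "complete_family (space (M \<Otimes>\<^sub>M N)) ((\<lambda>g. g \<circ> fst) ` G0 \<union> (\<lambda>g. g \<circ> snd) ` H0)"
      unfolding space_pair_measure by (rule comp[OF G0(1) H0(1)])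
    show "separating_family (space (M \<Otimes>\<^sub>M N)) ((\<lambda>g. g \<circ> fst) ` G0 \<union> (\<lambda>g. g \<circ> snd) ` H0)"
      unfolding space_pair_measure by (rule sep[OF G0(2) H0(2)])
    show "sets (M \<Otimes>\<^sub>M N) = sigma_sets (space (M \<Otimes>\<^sub>M N)) {a \<times> b |a b. a \<in> sets M \<and> b \<in> sets N}"
      unfolding space_pair_measure by (rule sets_pair_measure)
    show "{a \<times> b |a b. a \<in> sets M \<and> b \<in> sets N} \<subseteq>
        coded_sets (space (M \<Otimes>\<^sub>M N)) ((\<lambda>g. g \<circ> fst) ` G0 \<union> (\<lambda>g. g \<circ> snd) ` H0)"
    proof
      fix W assume "W \<in> {a \<times> b |a b. a \<in> sets M \<and> b \<in> sets N}"
      then obtain a b where W: "W = a \<times> b" and ab: "a \<in> sets M" "b \<in> sets N" by blast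
      obtain G where G: "G0 \<subseteq> G" "complete_family (space M) G" "decides (space M) G a"
        using G0(3)[OF ab(1)] by blast
      obtain H where H: "H0 \<subseteq> H" "complete_family (space N) H" "decides (space N) H b"
        using H0(3)[OF ab(2)] by blast
      have "W \<subseteq> space (M \<Otimes>\<^sub>M N)"
        using sets.sets_into_space[OF ab(1)] sets.sets_into_space[OF ab(2)] W
        by (auto simp: space_pair_measure)
      moreover have "(\<lambda>g. g \<circ> fst) ` G0 \<union> (\<lambda>g. g \<circ> snd) ` H0 \<subseteq> (\<lambda>g. g \<circ> fst) ` G \<union> (\<lambda>g. g \<circ> snd) ` H"
        using G(1) H(1) by blast
      ultimately show "W \<in> coded_sets (space (M \<Otimes>\<^sub>M N)) ((\<lambda>g. g \<circ> fst) ` G0 \<union> (\<lambda>g. g \<circ> snd) ` H0)"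
        using comp[OF G(2) H(2)] dec[OF G(3) H(3)]
        unfolding W space_pair_measure coded_sets_def mem_Collect_eq
        by (intro conjI exI[of _ "(\<lambda>g. g \<circ> fst) ` G \<union> (\<lambda>g. g \<circ> snd) ` H"])
    qed
  qed
qed

lemma standard_borelE_metric:
  assumes "standard_borel M"
  obtains d q where "Metric_space (space M) d" "Metric_space.mcomplete (space M) d"
    "sets M = sigma_sets (space M) {U. openin (Metric_space.mtopology (space M) d) U}"
    "\<And>x (i::nat). x \<in> space M \<Longrightarrow> q i \<in> space M"
    "\<And>x r. x \<in> space M \<Longrightarrow> r > 0 \<Longrightarrow> \<exists>i. d x (q i) < r"
proof -
  obtain X where X: "completely_metrizable_space X" "separable_space X" "topspace X = space M"
    "sets M = sigma_sets (space M) {U. openin X U}"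
    using assms unfolding standard_borel_def by blast
  obtain Z d where Zd: "Metric_space Z d" "Metric_space.mcomplete Z d" "X = Metric_space.mtopology Z d"
    using X(1) unfolding completely_metrizable_space_def by blast
  interpret Metric_space Z d by (rule Zd(1))
  have Z: "space M = Z" using X(3) Zd(3) by simp
  obtain C where C: "countable C" "C \<subseteq> Z" "mtopology closure_of C = Z"
    using X(2) Zd(3) unfolding separable_space_def by auto
  define q where "q = from_nat_into C"
  show thesis
  proof
    show "Metric_space (space M) d" "Metric_space.mcomplete (space M) d" using Zd Z by auto
    show "sets M = sigma_sets (space M) {U. openin (Metric_space.mtopology (space M) d) U}"
      using X(4) Zd Z by auto
    show "q i \<in> space M" if "x \<in> space M" for x and i :: nat
    proof -
      have "C \<noteq> {}" using C(3) that Z by auto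
      then show ?thesis using C(2) from_nat_into[of C i] Z unfolding q_def by auto
    qed
    show "\<exists>i. d x (q i) < r" if xr: "x \<in> space M" "r > 0" for x r
    proof -
      have "x \<in> mtopology closure_of C" using C(3) xr Z by simp
      then obtain y where y: "y \<in> C" "y \<in> mball x r" using xr(2) unfolding metric_closure_of by blast
      then obtain i where "q i = y" using from_nat_into_surj[OF C(1)] unfolding q_def by blast
      with y show ?thesis by auto
    qed
  qed
qed

lemma pow2_archimedean:
  fixes r :: real
  assumes "r > 0"
  obtains N where "1 / 2 ^ N < r / 2"
proof -
  obtain N where "2 / r < 2 ^ N" using real_arch_pow[of 2 "2 / r"] by auto
  then have "1 / 2 ^ N < r / 2" using assms by (simp add: field_simps)
  then show thesis by (rule that)
qed

text \<open>The coordinates of a point are the dyadic approximations of its distances to a dense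
  sequence, together with two kinds of auxiliary indices that make the image closed: \<open>c\<close> forces
  convergence in the space, and \<open>b\<close> prevents a distance from converging to the excluded right end of
  its half-open dyadic interval.\<close>

lemma standard_borel_codable:
  assumes "standard_borel M"
  shows "codable M"
proof -
  obtain d q where dq: "Metric_space (space M) d" "Metric_space.mcomplete (space M) d"
    "sets M = sigma_sets (space M) {U. openin (Metric_space.mtopology (space M) d) U}"
    "\<And>x (i::nat). x \<in> space M \<Longrightarrow> q i \<in> space M"
    "\<And>x r. x \<in> space M \<Longrightarrow> r > 0 \<Longrightarrow> \<exists>i. d x (q i) < r"
    by (rule standard_borelE_metric[OF assms]) blast
  define Z where Z: "Z = space M"
  note qZ = dq(4)[folded Z] and dense = dq(5)[folded Z]
  interpret Metric_space Z d using dq(1) Z by simp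
  define a where "a i n x = nat \<lfloor>2 ^ n * d x (q i)\<rfloor>" for i n x
  have a_iff: "a i n x = k \<longleftrightarrow> real k \<le> 2 ^ n * d x (q i) \<and> 2 ^ n * d x (q i) < real k + 1" for i n x k
  proof -
    have "0 \<le> 2 ^ n * d x (q i)" by simp
    then show ?thesis unfolding a_def by (simp add: nat_eq_iff floor_eq_iff)
  qed
  \<comment> \<open>The distance lies below the right end of its dyadic interval by more than \<open>2^-(n + b i n x)\<close>. As
    \<open>b\<close> is expressed through \<open>a\<close>, it is determined in the limit once \<open>a\<close> is.\<close>
  define b where "b i n x = (LEAST m. a i (n + m) x + 1 < 2 ^ m * (a i n x + 1))" for i n x
  have b: "a i (n + b i n x) x + 1 < 2 ^ b i n x * (a i n x + 1)" for i n x
  proof -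
    define u where "u = real (a i n x) + 1 - 2 ^ n * d x (q i)"
    have u: "u > 0" using a_iff[of i n x "a i n x"] unfolding u_def by simp
    obtain m where m: "1 / u < 2 ^ m" using real_arch_pow[of 2 "1/u"] by auto
    then have "1 < 2 ^ m * u" using u by (simp add: field_simps)
    moreover have "real (a i (n + m) x) \<le> 2 ^ (n + m) * d x (q i)" using a_iff by blast
    moreover have "2 ^ (n + m) * d x (q i) = 2 ^ m * (real (a i n x) + 1) - 2 ^ m * u"
      unfolding u_def by (simp add: algebra_simps power_add)
    ultimately have "real (a i (n + m) x) + 1 < 2 ^ m * (real (a i n x) + 1)" by linarith
    then have "real (a i (n + m) x + 1) < real (2 ^ m * (a i n x + 1))" by (simp add: algebra_simps)
    then have "a i (n + m) x + 1 < 2 ^ m * (a i n x + 1)" by (simp only: of_nat_less_iff)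
    then show ?thesis unfolding b_def by (rule LeastI)
  qed
  define c where "c n x = (LEAST i. a i n x = 0)" for n x
  have c: "a (c n x) n x = 0" if x: "x \<in> Z" for n x
  proof -
    obtain i where "d x (q i) < 1 / 2 ^ n" using dense[OF x, of "1 / 2 ^ n"] by auto
    then have "a i n x = 0" using a_iff[of i n x 0] by (simp add: field_simps)
    then show ?thesis unfolding c_def by (rule LeastI)
  qed
  have c': "d x (q (c n x)) < 1 / 2 ^ n" if "x \<in> Z" for n x
    using c[OF that, of n] a_iff[of "c n x" n x 0] by (simp add: field_simps)
  define G where "G = range (\<lambda>(i, n). a i n) \<union> range (\<lambda>(i, n). b i n) \<union> range c"
  have aG: "a i n \<in> G" and bG: "b i n \<in> G" and cG: "c n \<in> G" for i n
    unfolding G_def by (auto intro: rev_image_eqI[of "(i, n)"])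
  have complete: "complete_family Z G"
    unfolding complete_family_def
  proof (intro conjI allI impI)
    show "countable G" unfolding G_def by auto
  next
    fix z assume fin: "\<forall>F. finite F \<and> F \<subseteq> G \<longrightarrow> (\<exists>x\<in>Z. \<forall>g\<in>F. g x = z g)"
    define w where "w n = q (z (c n))" for n
    have yC: "d y (w n) < 1 / 2 ^ n" if "y \<in> Z" "c n y = z (c n)" for y n
      using c'[OF that(1), of n] that(2) unfolding w_def by simp
    obtain y0 where "y0 \<in> Z" using fin[rule_format, of "{}"] by auto
    then have wZ: "w n \<in> Z" for n unfolding w_def by (rule qZ)
    have ww: "d (w m) (w n) < 1 / 2 ^ m + 1 / 2 ^ n" for m n
    proof -
      have "finite {c m, c n}" "{c m, c n} \<subseteq> G" using cG by auto
      from fin[rule_format, OF conjI, OF this]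
      obtain y where y: "y \<in> Z" "c m y = z (c m)" "c n y = z (c n)" by auto
      show ?thesis using yC[OF y(1,2)] yC[OF y(1,3)] triangle''[OF wZ y(1) wZ, of m n] by linarith
    qed
    have "MCauchy w" unfolding MCauchy_def
    proof (intro conjI allI impI)
      show "range w \<subseteq> Z" using wZ by auto
      fix e :: real assume "e > 0"
      then obtain N where N': "1 / 2 ^ N < e / 2" by (rule pow2_archimedean)
      show "\<exists>N. \<forall>n n'. N \<le> n \<longrightarrow> N \<le> n' \<longrightarrow> d (w n) (w n') < e"
      proof (intro exI[of _ N] allI impI)
        fix n n' assume "N \<le> n" "N \<le> n'"
        then have "1 / 2 ^ n \<le> 1 / (2::real) ^ N" "1 / 2 ^ n' \<le> 1 / (2::real) ^ N"
          by (simp_all add: frac_le)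
        then show "d (w n) (w n') < e" using ww[of n n'] N' by linarith
      qed
    qed
    then obtain x where x: "limitin mtopology w x sequentially"
      using dq(2) unfolding Z[symmetric] mcomplete_def by blast
    then have xZ: "x \<in> Z" unfolding limitin_metric by simp
    \<comment> \<open>Points realising any finite part of \<open>z\<close> may be taken arbitrarily close to \<open>x\<close>.\<close>
    have near: "\<exists>y\<in>Z. (\<forall>g\<in>F. g y = z g) \<and> d y x < e" if "finite F" "F \<subseteq> G" "e > 0" for F e
    proof -
      obtain N where N': "1 / 2 ^ N < e / 2" using \<open>e > 0\<close> by (rule pow2_archimedean)
      have "\<forall>\<^sub>F n in sequentially. w n \<in> Z \<and> d (w n) x < e / 2"
        using x that(3) unfolding limitin_metric by (metis half_gt_zero)
      then obtain n where n: "n \<ge> N" "d (w n) x < e / 2"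
        unfolding eventually_sequentially by (metis nle_le)
      have "finite (insert (c n) F)" "insert (c n) F \<subseteq> G" using that cG by auto
      from fin[rule_format, OF conjI, OF this]
      obtain y where y: "y \<in> Z" "\<forall>g\<in>insert (c n) F. g y = z g" by blast
      have "1 / 2 ^ n \<le> 1 / (2::real) ^ N" using n(1) by (simp add: frac_le)
      moreover have "d y (w n) < 1 / 2 ^ n" using yC y by simp
      ultimately have "d y x < e" using n(2) N' triangle[OF y(1) wZ xZ, of n] by linarith
      with y show ?thesis by blast
    qed
    have ax: "a i n x = z (a i n)" for i n
      unfolding a_iff
    proof
      define A where "A = z (a i n)"
      define m where "m = z (b i n)"
      have both: "real A \<le> 2 ^ n * d x (q i) + 2 ^ n * e \<and>
          2 ^ n * d x (q i) \<le> real A + 1 - 1 / 2 ^ m + 2 ^ n * e" if "e > 0" for e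
      proof -
        have "finite {a i n, b i n}" "{a i n, b i n} \<subseteq> G" using aG bG by auto
        from near[OF this that]
        obtain y where y: "y \<in> Z" "a i n y = A" "b i n y = m" "d y x < e" unfolding A_def m_def by auto
        have "real (a i (n + m) y + 1) < real (2 ^ m * (A + 1))"
          using b[of i n y] y by (simp only: of_nat_less_iff)
        moreover have "a i (n + m) y + 1 + 1 \<le> 2 ^ m * (A + 1)"
          using b[of i n y] y by (simp only:)
        then have "real (a i (n + m) y + 1 + 1) \<le> real (2 ^ m * (A + 1))" by (simp only: of_nat_le_iff)
        moreover have "2 ^ (n + m) * d y (q i) < real (a i (n + m) y) + 1" using a_iff by blast
        ultimately have "2 ^ m * (2 ^ n * d y (q i)) < 2 ^ m * (real A + 1) - 1"
          by (simp add: power_add algebra_simps)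
        then have 1: "2 ^ n * d y (q i) < real A + 1 - 1 / 2 ^ m" by (simp add: field_simps)
        have 2: "real A \<le> 2 ^ n * d y (q i)" using a_iff y(2) by blast
        have qi: "q i \<in> Z" by (rule qZ[OF xZ])
        have "d x (q i) \<le> d y (q i) + e" "d y (q i) \<le> d x (q i) + e"
          using triangle''[OF xZ y(1) qi] triangle[OF y(1) xZ qi] y(4) by linarith+
        then have "2 ^ n * d x (q i) \<le> 2 ^ n * (d y (q i) + e)" "2 ^ n * d y (q i) \<le> 2 ^ n * (d x (q i) + e)"
          by (simp_all add: mult_left_mono)
        with 1 2 show ?thesis by (simp add: algebra_simps)
      qed
      have "real A \<le> 2 ^ n * d x (q i) + e \<and> 2 ^ n * d x (q i) \<le> real A + 1 - 1 / 2 ^ m + e" if "e > 0" for e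
        using both[of "e / 2 ^ n"] that by simp
      then have "real A \<le> 2 ^ n * d x (q i)" "2 ^ n * d x (q i) \<le> real A + 1 - 1 / 2 ^ m"
        by (meson field_le_epsilon)+
      moreover have "0 < 1 / (2::real) ^ m" by simp
      ultimately show "real (z (a i n)) \<le> 2 ^ n * d x (q i)" "2 ^ n * d x (q i) < real (z (a i n)) + 1"
        unfolding A_def by linarith+
    qed
    have bx: "b i n x = z (b i n)" for i n
    proof -
      define m where "m = z (b i n)"
      let ?F = "insert (b i n) (insert (a i n) ((\<lambda>j. a i (n + j)) ` {..m}))"
      have "finite ?F" "?F \<subseteq> G" using aG bG by auto
      from fin[rule_format, OF conjI, OF this]
      obtain y where y: "b i n y = m" "\<forall>g\<in>?F. g y = z g" unfolding m_def by auto
      have eq: "a i n y = a i n x" "\<And>j. j \<le> m \<Longrightarrow> a i (n + j) y = a i (n + j) x"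
        using y ax by auto
      show ?thesis unfolding m_def[symmetric] unfolding b_def
      proof (rule Least_equality)
        show "a i (n + m) x + 1 < 2 ^ m * (a i n x + 1)" using b[of i n y] y(1) eq by simp
        fix j assume j: "a i (n + j) x + 1 < 2 ^ j * (a i n x + 1)"
        show "m \<le> j"
        proof (rule ccontr)
          assume "\<not> m \<le> j"
          then have "a i (n + j) y + 1 < 2 ^ j * (a i n y + 1)" using j eq by simp
          then have "b i n y \<le> j" unfolding b_def by (rule Least_le)
          with y(1) \<open>\<not> m \<le> j\<close> show False by simp
        qed
      qed
    qed
    have cx: "c n x = z (c n)" for n
    proof -
      define m where "m = z (c n)"
      let ?F = "insert (c n) ((\<lambda>j. a j n) ` {..m})"
      have "finite ?F" "?F \<subseteq> G" using aG cG by auto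
      from fin[rule_format, OF conjI, OF this]
      obtain y where y: "y \<in> Z" "c n y = m" "\<forall>g\<in>?F. g y = z g" unfolding m_def by auto
      have eq: "\<And>j. j \<le> m \<Longrightarrow> a j n y = a j n x"
        using y ax by auto
      show ?thesis unfolding m_def[symmetric] unfolding c_def
      proof (rule Least_equality)
        show "a m n x = 0" using c[OF y(1), of n] y(2) eq by simp
        fix j assume j: "a j n x = 0"
        show "m \<le> j"
        proof (rule ccontr)
          assume "\<not> m \<le> j"
          then have "a j n y = 0" using j eq by simp
          then have "c n y \<le> j" unfolding c_def by (rule Least_le)
          with y(2) \<open>\<not> m \<le> j\<close> show False by simp
        qed
      qed
    qed
    show "\<exists>x\<in>Z. \<forall>g\<in>G. g x = z g"
      by (rule bexI[OF _ xZ]) (auto simp: G_def ax bx cx)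
  qed
  have sep: "separating_family Z G" unfolding separating_family_def
  proof (intro ballI impI, rule ccontr)
    fix x y assume xy: "x \<in> Z" "y \<in> Z" "\<forall>g\<in>G. g x = g y" "x \<noteq> y"
    then have pos: "d x y > 0" by simp
    then obtain N where N: "1 / 2 ^ N < d x y / 2" by (rule pow2_archimedean)
    have "c N x = c N y" using xy cG by blast
    then have "d x y < 1 / 2 ^ N + 1 / 2 ^ N"
      using c'[OF xy(1), of N] c'[OF xy(2), of N] triangle'[OF xy(1) qZ[OF xy(1)] xy(2), of "c N x"] by simp
    with N show False by linarith
  qed
  interpret dec: sigma_algebra Z "coded_sets Z G"
    by (rule sigma_algebra_coded_sets[OF complete sep])
  have ball: "{y \<in> Z. a i n y = 0} \<in> coded_sets Z G" for i n
  proof -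
    have "decides Z G {y \<in> Z. a i n y = 0}" unfolding decides_def
      by (rule exI[of _ "{a i n}"]) (use aG in auto)
    with complete show ?thesis unfolding coded_sets_def by auto
  qed
  have open_coded: "W \<in> coded_sets Z G" if open_W: "openin mtopology W" for W
  proof -
    have W: "W \<subseteq> Z" "\<And>x. x \<in> W \<Longrightarrow> \<exists>r>0. mball x r \<subseteq> W"
      using open_W openin_mtopology by auto
    let ?I = "{(i, n). {y \<in> Z. a i n y = 0} \<subseteq> W}"
    have "W = (\<Union>p\<in>?I. {y \<in> Z. a (fst p) (snd p) y = 0})"
    proof
      show "W \<subseteq> (\<Union>p\<in>?I. {y \<in> Z. a (fst p) (snd p) y = 0})"
      proof
        fix x assume x: "x \<in> W"
        then obtain r where r: "r > 0" "mball x r \<subseteq> W" using W(2) by blast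
        obtain N where N: "1 / 2 ^ N < r / 2" using r(1) by (rule pow2_archimedean)
        have xZ: "x \<in> Z" using x W by auto
        have "{y \<in> Z. a (c N x) N y = 0} \<subseteq> mball x r"
        proof
          fix y assume y: "y \<in> {y \<in> Z. a (c N x) N y = 0}"
          then have "d y (q (c N x)) < 1 / 2 ^ N" using a_iff[of "c N x" N y 0] by (simp add: field_simps)
          moreover have "d x y \<le> d x (q (c N x)) + d y (q (c N x))"
            using y by (intro triangle'[OF xZ qZ[OF xZ]]) auto
          ultimately show "y \<in> mball x r" using y xZ c'[OF xZ, of N] N by auto
        qed
        then have "(c N x, N) \<in> ?I" using r(2) by auto
        then show "x \<in> (\<Union>p\<in>?I. {y \<in> Z. a (fst p) (snd p) y = 0})" using xZ c by force
      qed
    qed auto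
    moreover have "(\<Union>p\<in>?I. {y \<in> Z. a (fst p) (snd p) y = 0}) \<in> coded_sets Z G"
      by (rule dec.countable_UN''[OF countableI_type ball])
    ultimately show ?thesis by simp
  qed
  show ?thesis
  proof (rule codableI)
    show "complete_family (space M) G" "separating_family (space M) G" using complete sep Z by auto
    show "sets M = sigma_sets (space M) {U. openin mtopology U}" using dq(3) Z by simp
    show "{U. openin mtopology U} \<subseteq> coded_sets (space M) G" using open_coded Z by blast
  qed
qed

text \<open>The finite unions of balls from a countable base have this property. It says more than
  that the family separates points: finite sets can be singled out within larger finite sets by an
  index from a countable set.\<close>

lemma standard_borel_finite_traces:
  assumes "standard_borel M"
  obtains U :: "nat \<Rightarrow> 'a set" where "\<And>k. U k \<in> sets (M :: 'a measure)"
    "\<And>F K. finite F \<Longrightarrow> F \<subseteq> space M \<Longrightarrow> K \<subseteq> F \<Longrightarrow> \<exists>k. U k \<inter> F = K"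
proof -
  obtain d q where dq: "Metric_space (space M) d" "Metric_space.mcomplete (space M) d"
    "sets M = sigma_sets (space M) {U. openin (Metric_space.mtopology (space M) d) U}"
    "\<And>x (i::nat). x \<in> space M \<Longrightarrow> q i \<in> space M"
    "\<And>x r. x \<in> space M \<Longrightarrow> r > 0 \<Longrightarrow> \<exists>i. d x (q i) < r"
    by (rule standard_borelE_metric[OF assms]) blast
  interpret Metric_space "space M" d by (rule dq(1))
  define BB where "BB = range (\<lambda>(i, n). mball (q i) (1 / 2 ^ n))"
  have BBo: "openin mtopology W" if "W \<in> BB" for W using that unfolding BB_def by auto
  let ?N = "Union ` {P. finite P \<and> P \<subseteq> BB}"
  define U where "U = from_nat_into ?N"
  have cN: "countable ?N"
    by (intro countable_image countable_Collect_finite_subset) (simp add: BB_def)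
  have ne: "?N \<noteq> {}" by auto
  show thesis
  proof
    fix k
    have "U k \<in> ?N" unfolding U_def by (rule from_nat_into[OF ne])
    then obtain P where P: "U k = \<Union>P" "P \<subseteq> BB" by auto
    have "openin mtopology (\<Union>P)" by (rule openin_Union) (use P(2) BBo in blast)
    then have "openin mtopology (U k)" using P(1) by simp
    then show "U k \<in> sets M" unfolding dq(3) by auto
  next
    fix F K assume F: "finite F" "F \<subseteq> space M" "K \<subseteq> F"
    have "\<exists>W\<in>BB. W \<inter> F = {x}" if "x \<in> K" for x
    proof -
      have x: "x \<in> space M" using that F by auto
      define r where "r = Min (insert 1 (d x ` (F - {x})))"
      have r: "r > 0" "\<And>y. y \<in> F \<Longrightarrow> y \<noteq> x \<Longrightarrow> r \<le> d x y"
        unfolding r_def using F x by (auto simp: subset_iff)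
      obtain N where N: "1 / 2 ^ N < r / 2" using r(1) by (rule pow2_archimedean)
      obtain i where i: "d x (q i) < 1 / 2 ^ N" using dq(5)[OF x, of "1 / 2 ^ N"] by auto
      have qi: "q i \<in> space M" by (rule dq(4)[OF x])
      have "mball (q i) (1 / 2 ^ N) \<inter> F = {x}"
      proof (intro set_eqI iffI)
        fix y assume y: "y \<in> mball (q i) (1 / 2 ^ N) \<inter> F"
        then have "d x y < r" using triangle[OF x qi, of y] i N by auto
        then show "y \<in> {x}" using r(2)[of y] y by force
      qed (use i x qi that F commute[of x "q i"] in auto)
      moreover have "mball (q i) (1 / 2 ^ N) \<in> BB" unfolding BB_def by auto
      ultimately show ?thesis by blast
    qed
    then obtain W where W: "\<And>x. x \<in> K \<Longrightarrow> W x \<in> BB \<and> W x \<inter> F = {x}" by metis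
    have "\<Union>(W ` K) \<in> ?N" using W F finite_subset[OF F(3,1)] by (intro imageI) auto
    then obtain k where "U k = \<Union>(W ` K)" using from_nat_into_surj[OF cN] unfolding U_def by metis
    then have "U k \<inter> F = (\<Union>x\<in>K. W x \<inter> F)" by auto
    also have "\<dots> = K" using W by simp
    finally have "U k \<inter> F = K" .
    then show "\<exists>k. U k \<inter> F = K" ..
  qed
qed

section \<open>Separation of Souslin sets\<close>

lemma decidesE:
  assumes "decides Z G W"
  obtains F where "finite F" "F \<subseteq> G"
    "\<And>x y. x \<in> Z \<Longrightarrow> y \<in> Z \<Longrightarrow> \<forall>g\<in>F. g x = g y \<Longrightarrow> x \<in> W \<longleftrightarrow> y \<in> W"
  using assms unfolding decides_def by metis

lemma decides_Diff:
  assumes "decides Z G A" "decides Z G B"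
  shows "decides Z G (A - B)"
proof -
  obtain F where F: "finite F" "F \<subseteq> G"
      "\<And>x y. x \<in> Z \<Longrightarrow> y \<in> Z \<Longrightarrow> \<forall>g\<in>F. g x = g y \<Longrightarrow> x \<in> A \<longleftrightarrow> y \<in> A"
    using assms(1) by (rule decidesE) blast
  obtain H where H: "finite H" "H \<subseteq> G"
      "\<And>x y. x \<in> Z \<Longrightarrow> y \<in> Z \<Longrightarrow> \<forall>g\<in>H. g x = g y \<Longrightarrow> x \<in> B \<longleftrightarrow> y \<in> B"
    using assms(2) by (rule decidesE) blast
  show ?thesis unfolding decides_def
  proof (intro exI[of _ "F \<union> H"] conjI ballI impI)
    fix x y assume xy: "x \<in> Z" "y \<in> Z" "\<forall>g\<in>F \<union> H. g x = g y"
    have "x \<in> A \<longleftrightarrow> y \<in> A" by (rule F(3)) (use xy in simp_all)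
    moreover have "x \<in> B \<longleftrightarrow> y \<in> B" by (rule H(3)) (use xy in simp_all)
    ultimately show "x \<in> A - B \<longleftrightarrow> y \<in> A - B" by simp
  qed (use F H in auto)
qed

text \<open>If the images cannot be separated in this sense, then the sets \<open>B n\<close> can be
  shrunk step by step, fixing the value of one coordinate on one of the sets in each step, so that the
  images remain inseparable. By completeness the fixed values determine a point of every \<open>B n\<close>. Since the
  images have no common point, two of these points have different images, a set \<open>W k\<close> separates these two
  images, and after finitely many steps it separates the shrunken images as well.\<close>

lemma novikov_separation:
  fixes f :: "'z \<Rightarrow> 'x" and B :: "nat \<Rightarrow> 'z set" and W :: "nat \<Rightarrow> 'x set"
  assumes G: "complete_family Z G" and B: "\<And>n. B n \<subseteq> Z" "\<And>n. decides Z G (B n)"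
    and fW: "\<And>k. decides Z G (f -` W k)"
    and W: "\<And>k. W k \<in> sets M" "\<And>x y. x \<in> space M \<Longrightarrow> y \<in> space M \<Longrightarrow> x \<noteq> y \<Longrightarrow> \<exists>k. x \<in> W k \<longleftrightarrow> y \<notin> W k"
    and f: "f ` Z \<subseteq> space M" and empty: "(\<Inter>n. f ` B n) = {}"
  shows "\<exists>S. (\<forall>n. S n \<in> sets M \<and> f ` B n \<subseteq> S n) \<and> (\<Inter>n. S n) = {}"
proof (rule ccontr)
  define separable where "separable D \<longleftrightarrow>
    (\<exists>S. (\<forall>n. S n \<in> sets M \<and> f ` D n \<subseteq> S n) \<and> (\<Inter>n. S n) = {})" for D :: "nat \<Rightarrow> 'z set"
  define g where "g = from_nat_into G"
  \<comment> \<open>Step \<open>u\<close> fixes the value \<open>z u\<close> of the coordinate number \<open>k\<close> on the set number \<open>n\<close>, where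
    \<open>(n, k)\<close> is coded by \<open>u\<close>.\<close>
  define C where "C t z n = {x \<in> B n. \<forall>u<t. fst (prod_decode u) = n \<longrightarrow> g (snd (prod_decode u)) x = z u}"
    for t n and z :: "nat \<Rightarrow> nat"
  assume "\<nexists>S. (\<forall>n. S n \<in> sets M \<and> f ` B n \<subseteq> S n) \<and> (\<Inter>n. S n) = {}"
  then have "\<not> separable B" unfolding separable_def .
  have step: "\<exists>i. \<not> separable (C (Suc t) (z(t := i)))" if "\<not> separable (C t z)" for t z
  proof (rule ccontr)
    assume "\<nexists>i. \<not> separable (C (Suc t) (z(t := i)))"
    then obtain S where S: "\<And>i n. S i n \<in> sets M" "\<And>i n. f ` C (Suc t) (z(t := i)) n \<subseteq> S i n"
        "\<And>i. (\<Inter>n. S i n) = {}"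
      unfolding separable_def by metis
    define n0 where "n0 = fst (prod_decode t)"
    define S' where "S' n = (if n = n0 then (\<Union>i. S i n) else (\<Inter>i. S i n))" for n
    have "separable (C t z)" unfolding separable_def
    proof (intro exI[of _ S'] conjI allI)
      show "S' n \<in> sets M" for n
        using S(1) unfolding S'_def by (auto intro: sets.countable_UN sets.countable_INT)
      show "f ` C t z n \<subseteq> S' n" for n
      proof
        fix v assume "v \<in> f ` C t z n"
        then obtain x where x: "x \<in> C t z n" "v = f x" by blast
        show "v \<in> S' n"
        proof (cases "n = n0")
          case True
          have "x \<in> C (Suc t) (z(t := g (snd (prod_decode t)) x)) n"
            using x(1) unfolding C_def by (auto simp: less_Suc_eq)
          then show ?thesis using S(2) x(2) True unfolding S'_def by (auto simp: image_subset_iff)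
        next
          case False
          have "x \<in> C (Suc t) (z(t := i)) n" for i
            using x(1) False unfolding C_def n0_def by (auto simp: less_Suc_eq)
          then show ?thesis using S(2) x(2) False unfolding S'_def by (auto simp: image_subset_iff)
        qed
      qed
      show "(\<Inter>n. S' n) = {}"
      proof (rule ccontr)
        assume "(\<Inter>n. S' n) \<noteq> {}"
        then obtain v where v: "\<And>n. v \<in> S' n" by blast
        then obtain i where "v \<in> S i n0" using v[of n0] unfolding S'_def by auto
        then have "v \<in> S i n" for n using v[of n] unfolding S'_def by (auto split: if_splits)
        with S(3)[of i] show False by auto
      qed
    qed
    with that show False by simp
  qed
  have "\<exists>F. \<forall>t. \<not> separable (C t (F t)) \<and> (\<forall>u<t. F (Suc t) u = F t u)"
  proof (rule dependent_nat_choice)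
    show "\<exists>z. \<not> separable (C 0 z)" using \<open>\<not> separable B\<close> unfolding C_def by simp
    fix z t assume "\<not> separable (C t z)"
    from step[OF this] obtain i where "\<not> separable (C (Suc t) (z(t := i)))" ..
    then show "\<exists>z'. \<not> separable (C (Suc t) z') \<and> (\<forall>u<t. z' u = z u)"
      by (intro exI[of _ "z(t := i)"]) auto
  qed
  then obtain F where F: "\<And>t. \<not> separable (C t (F t))" "\<And>t u. u < t \<Longrightarrow> F (Suc t) u = F t u" by blast
  define z where "z u = F (Suc u) u" for u
  have Fz: "F t u = z u" if "u < t" for t u
    using that
  proof (induction t)
    case (Suc t)
    then show ?case using F(2)[of u t] unfolding z_def by (cases "u = t") auto
  qed simp
  have "C t (F t) = C t z" for t
    using Fz unfolding C_def by (intro ext) auto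
  with F(1) have nonsep: "\<not> separable (C t z)" for t by metis
  have CB: "f ` C t z n \<subseteq> space M" for t n using B(1)[of n] f unfolding C_def by auto
  have Cne: "C t z n \<noteq> {}" for t n
  proof
    assume "C t z n = {}"
    then have "separable (C t z)" unfolding separable_def using CB
      by (intro exI[of _ "\<lambda>m. if m = n then {} else space M"]) (auto split: if_splits)
    with nonsep show False by blast
  qed
  have cG: "countable G" using G unfolding complete_family_def by blast
  define zz where "zz n h = z (prod_encode (n, to_nat_on G h))" for n h
  have late: "\<exists>T. \<forall>t\<ge>T. \<forall>y\<in>C t z n. \<forall>h\<in>H. h y = zz n h" if H: "finite H" "H \<subseteq> G" for n H
  proof -
    let ?T = "Suc (Max (insert 0 ((\<lambda>h. prod_encode (n, to_nat_on G h)) ` H)))"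
    have "h y = zz n h" if "t \<ge> ?T" "y \<in> C t z n" "h \<in> H" for t y h
    proof -
      have "prod_encode (n, to_nat_on G h) \<le> Max (insert 0 ((\<lambda>h. prod_encode (n, to_nat_on G h)) ` H))"
        using H(1) that(3) by (intro Max_ge) auto
      then have "prod_encode (n, to_nat_on G h) < t" using that(1) by simp
      with that(2) have "g (to_nat_on G h) y = zz n h" unfolding C_def zz_def by auto
      moreover have "g (to_nat_on G h) = h" unfolding g_def using that(3) H(2) cG by auto
      ultimately show ?thesis by simp
    qed
    then show ?thesis by blast
  qed
  have "\<exists>x\<in>Z. \<forall>h\<in>G. h x = zz n h" for n
  proof (rule complete_familyD[OF G])
    fix H assume "finite H" "H \<subseteq> G"
    from late[OF this, of n] obtain T where "\<forall>y\<in>C T z n. \<forall>h\<in>H. h y = zz n h" by blast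
    with Cne[of T n] B(1)[of n] show "\<exists>x\<in>Z. \<forall>h\<in>H. h x = zz n h" unfolding C_def by blast
  qed
  then obtain x where x: "\<And>n. x n \<in> Z" "\<And>n h. h \<in> G \<Longrightarrow> h (x n) = zz n h" by metis
  have decided: "\<exists>T. \<forall>t\<ge>T. \<forall>y\<in>C t z n. y \<in> A \<longleftrightarrow> x n \<in> A" if A: "decides Z G A" for A n
  proof -
    obtain H where H: "finite H" "H \<subseteq> G"
        "\<And>x y. x \<in> Z \<Longrightarrow> y \<in> Z \<Longrightarrow> \<forall>g\<in>H. g x = g y \<Longrightarrow> x \<in> A \<longleftrightarrow> y \<in> A"
      using A by (rule decidesE) blast
    obtain T where T: "\<forall>t\<ge>T. \<forall>y\<in>C t z n. \<forall>h\<in>H. h y = zz n h" using late[OF H(1,2)] by blast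
    have "y \<in> A \<longleftrightarrow> x n \<in> A" if "t \<ge> T" "y \<in> C t z n" for t y
    proof (rule H(3))
      show "y \<in> Z" using that(2) B(1)[of n] unfolding C_def by auto
      show "\<forall>g\<in>H. g y = g (x n)" using T that x(2) H(2) by (metis subsetD)
    qed (rule x(1))
    then show ?thesis by blast
  qed
  have xB: "x n \<in> B n" for n
    using decided[OF B(2), of n n] Cne[of _ n] unfolding C_def by blast
  have no: False if ij: "f (x i) \<in> W k" "f (x j) \<notin> W k" for i j k
  proof -
    obtain T1 where T1: "\<And>t y. t \<ge> T1 \<Longrightarrow> y \<in> C t z i \<Longrightarrow> y \<in> f -` W k \<longleftrightarrow> x i \<in> f -` W k"
      using decided[OF fW, of i k] by blast
    obtain T2 where T2: "\<And>t y. t \<ge> T2 \<Longrightarrow> y \<in> C t z j \<Longrightarrow> y \<in> f -` W k \<longleftrightarrow> x j \<in> f -` W k"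
      using decided[OF fW, of j k] by blast
    define t where "t = max T1 T2"
    have t: "f ` C t z i \<subseteq> W k" "f ` C t z j \<subseteq> space M - W k"
      using T1[of t] T2[of t] ij CB[of t j] unfolding t_def by (auto simp: image_subset_iff)
    have "separable (C t z)" unfolding separable_def
    proof (intro exI[of _ "\<lambda>n. if n = i then W k else if n = j then space M - W k else space M"] conjI allI)
      have "i \<noteq> j" using ij by auto
      then show "(\<Inter>n. if n = i then W k else if n = j then space M - W k else space M) = {}"
        by (intro equalityI subsetI) (auto dest: spec[of _ i] spec[of _ j] split: if_splits)
    qed (use W(1) t CB in auto)
    with nonsep show False by blast
  qed
  have "f (x i) = f (x 0)" for i
  proof (rule ccontr)
    assume "f (x i) \<noteq> f (x 0)"
    then obtain k where "f (x i) \<in> W k \<longleftrightarrow> f (x 0) \<notin> W k"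
      using W(2)[of "f (x i)" "f (x 0)"] x(1) f by blast
    with no show False by blast
  qed
  then have "f (x 0) \<in> (\<Inter>n. f ` B n)" using xB by (metis INT_I imageI)
  with empty show False by simp
qed

lemma lusin_separation:
  fixes f :: "'z \<Rightarrow> 'x" and W :: "nat \<Rightarrow> 'x set"
  assumes G: "complete_family Z G" and B: "B1 \<subseteq> Z" "decides Z G B1" "B2 \<subseteq> Z" "decides Z G B2"
    and fW: "\<And>k. decides Z G (f -` W k)"
    and W: "\<And>k. W k \<in> sets M" "\<And>x y. x \<in> space M \<Longrightarrow> y \<in> space M \<Longrightarrow> x \<noteq> y \<Longrightarrow> \<exists>k. x \<in> W k \<longleftrightarrow> y \<notin> W k"
    and f: "f ` Z \<subseteq> space M" and disj: "f ` B1 \<inter> f ` B2 = {}"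
  shows "\<exists>S\<in>sets M. f ` B1 \<subseteq> S \<and> f ` B2 \<inter> S = {}"
proof -
  let ?B = "\<lambda>n::nat. if n = 0 then B1 else B2"
  have "f ` ?B 0 \<inter> f ` ?B 1 = {}" using disj by simp
  then have "(\<Inter>n. f ` ?B n) = {}" by blast
  then have "\<exists>S. (\<forall>n. S n \<in> sets M \<and> f ` ?B n \<subseteq> S n) \<and> (\<Inter>n. S n) = {}"
    using B by (intro novikov_separation[OF G _ _ fW W f]) auto
  then obtain S where S: "\<And>n. S n \<in> sets M" "\<And>n. f ` ?B n \<subseteq> S n" "(\<Inter>n. S n) = {}" by blast
  have "f ` B2 \<inter> S 0 = {}"
  proof (rule ccontr)
    assume "f ` B2 \<inter> S 0 \<noteq> {}"
    then obtain v where v: "v \<in> f ` B2" "v \<in> S 0" by blast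
    have "v \<in> S n" for n using S(2)[of n] v by (cases "n = 0") auto
    with S(3) show False by blast
  qed
  moreover have "f ` B1 \<subseteq> S 0" using S(2)[of 0] by simp
  ultimately show ?thesis by (intro bexI[of _ "S 0"] conjI S(1))
qed

text \<open>Lusin and Souslin: for each coordinate \<open>k\<close> the images of the parts of \<open>B\<close> on which it has
  different values are disjoint, hence they lie in disjoint Borel sets \<open>Y k i\<close>. A point \<open>v\<close> of the
  image can therefore read off the coordinates of its preimage. Conversely, if the coordinates
  read off from \<open>v\<close> are finitely realised in \<open>B\<close>, then they belong to a point \<open>x\<close> of \<open>B\<close>, and
  \<open>f x = v\<close> provided that \<open>v\<close> lies on the same side of each \<open>W m\<close> as the pieces of \<open>B\<close> around \<open>x\<close>.\<close>

lemma injective_image_measurable: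
  fixes f :: "'z \<Rightarrow> 'x" and W :: "nat \<Rightarrow> 'x set"
  assumes N: "codable N" and f: "f \<in> N \<rightarrow>\<^sub>M M" and B: "B \<in> sets N" "inj_on f B"
    and W: "\<And>k. W k \<in> sets M" "\<And>x y. x \<in> space M \<Longrightarrow> y \<in> space M \<Longrightarrow> x \<noteq> y \<Longrightarrow> \<exists>k. x \<in> W k \<longleftrightarrow> y \<notin> W k"
  shows "f ` B \<in> sets M"
proof -
  define Z where "Z = space N"
  let ?A = "\<lambda>n. case n of 0 \<Rightarrow> B | Suc k \<Rightarrow> f -` W k \<inter> space N"
  have A: "?A n \<in> sets N" for n
    using B(1) measurable_sets[OF f W(1)] by (cases n) auto
  obtain G where G: "complete_family Z G" "\<And>n. decides Z G (?A n)"
    unfolding Z_def by (rule codable_countable_family[where W = ?A, OF N A]) blast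
  have BZ: "B \<subseteq> Z" using B(1) sets.sets_into_space unfolding Z_def by blast
  have GB: "decides Z G B" using G(2)[of 0] by simp
  have fW: "decides Z G (f -` W k)" for k
    using G(2)[of "Suc k"] unfolding decides_def Z_def by auto
  have fZ: "f ` Z \<subseteq> space M" using f unfolding Z_def by (auto dest: measurable_space)
  have cG: "countable G" using G(1) unfolding complete_family_def by blast
  define g where "g h = to_nat_on G h" for h
  \<comment> \<open>The coordinates listed as a sequence, with constant functions filling the gaps of the
    enumeration.\<close>
  define e where "e k x = (if \<exists>h\<in>G. g h = k then from_nat_into G k x else 0)" for k x
  have eg: "e (g h) = h" if "h \<in> G" for h
    using that cG unfolding e_def g_def by auto
  have e_dec: "decides Z G {x \<in> B. e k x = i}" for k i
  proof -
    obtain F where F: "finite F" "F \<subseteq> G" "\<And>x y. x \<in> Z \<Longrightarrow> y \<in> Z \<Longrightarrow> \<forall>g\<in>F. g x = g y \<Longrightarrow> x \<in> B \<longleftrightarrow> y \<in> B"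
      using GB by (rule decidesE) blast
    have "\<exists>F'. finite F' \<and> F' \<subseteq> G \<and> (\<forall>x y. (\<forall>h\<in>F'. h x = h y) \<longrightarrow> e k x = e k y)"
    proof (cases "\<exists>h\<in>G. g h = k")
      case True
      then obtain h where "h \<in> G" "g h = k" by blast
      then show ?thesis using eg by (intro exI[of _ "{h}"]) auto
    next
      case False
      then show ?thesis by (intro exI[of _ "{}"]) (simp add: e_def)
    qed
    then obtain F' where F': "finite F'" "F' \<subseteq> G" "\<And>x y. \<forall>h\<in>F'. h x = h y \<Longrightarrow> e k x = e k y" by blast
    show ?thesis unfolding decides_def
    proof (intro exI[of _ "F \<union> F'"] conjI ballI impI)
      fix x y assume "x \<in> Z" "y \<in> Z" "\<forall>h\<in>F \<union> F'. h x = h y"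
      then show "x \<in> {x \<in> B. e k x = i} \<longleftrightarrow> y \<in> {x \<in> B. e k x = i}"
        using F(3)[of x y] F'(3)[of x y] by simp
    qed (use F F' in auto)
  qed
  have e_dec': "decides Z G {x \<in> B. e k x \<noteq> i}" for k i
  proof -
    have "decides Z G (B - {x \<in> B. e k x = i})"
      by (rule decides_Diff[OF GB e_dec])
    moreover have "B - {x \<in> B. e k x = i} = {x \<in> B. e k x \<noteq> i}" by auto
    ultimately show ?thesis by simp
  qed
  define separates where "separates k i S \<longleftrightarrow>
    S \<in> sets M \<and> f ` {x \<in> B. e k x = i} \<subseteq> S \<and> f ` {x \<in> B. e k x \<noteq> i} \<inter> S = {}" for k i S
  have "\<exists>S. separates k i S" for k i
  proof -
    have "f ` {x \<in> B. e k x = i} \<inter> f ` {x \<in> B. e k x \<noteq> i} = {}"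
      using B(2) by (auto dest: inj_onD)
    then have "\<exists>S\<in>sets M. f ` {x \<in> B. e k x = i} \<subseteq> S \<and> f ` {x \<in> B. e k x \<noteq> i} \<inter> S = {}"
      using BZ by (intro lusin_separation[OF G(1) _ e_dec _ e_dec' fW W fZ]) auto
    then show ?thesis unfolding separates_def by blast
  qed
  then obtain S where "\<And>k i. separates k i (S k i)" by metis
  then have S: "S k i \<in> sets M" "f ` {x \<in> B. e k x = i} \<subseteq> S k i"
      "f ` {x \<in> B. e k x \<noteq> i} \<inter> S k i = {}" for k i
    unfolding separates_def by simp_all
  define Y where "Y k i = S k i - (\<Union>j\<in>-{i}. S k j)" for k i
  have Ysets: "Y k i \<in> sets M" for k i
    unfolding Y_def using S(1) by (intro sets.Diff sets.countable_UN'') auto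
  have Yin: "f x \<in> Y k (e k x)" if "x \<in> B" for x k
    unfolding Y_def using S(2)[of k "e k x"] S(3)[of k] that by (auto simp: disjoint_iff image_subset_iff)
  have Ydisj: "i = j" if "v \<in> Y k i" "v \<in> Y k j" for v k i j
    using that unfolding Y_def by auto
  define Bs where "Bs s = {x \<in> B. \<forall>k<length s. e k x = s ! k}" for s
  \<comment> \<open>The string \<open>s\<close> is a possible initial part of the coordinates of a preimage of \<open>v\<close>.\<close>
  define good where "good v n s \<longleftrightarrow> length s = n \<and> Bs s \<noteq> {} \<and> (\<forall>k\<in>{..<n}. v \<in> Y k (s ! k)) \<and>
      (\<forall>m. (f ` Bs s \<subseteq> W m \<longrightarrow> v \<in> W m) \<and> (f ` Bs s \<inter> W m = {} \<longrightarrow> v \<notin> W m))" for v n s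
  define R where "R = {v \<in> space M. \<forall>n. \<exists>s. good v n s}"
  have "R \<in> sets M" unfolding R_def good_def using W(1) Ysets by measurable
  moreover have "R = f ` B"
  proof
    show "f ` B \<subseteq> R"
    proof
      fix v assume "v \<in> f ` B"
      then obtain x where x: "x \<in> B" "v = f x" by blast
      have "good v n (map (\<lambda>k. e k x) [0..<n])" for n
        unfolding good_def
      proof (intro conjI)
        have x': "x \<in> Bs (map (\<lambda>k. e k x) [0..<n])" unfolding Bs_def using x by simp
        then show "Bs (map (\<lambda>k. e k x) [0..<n]) \<noteq> {}" by blast
        show "\<forall>m. (f ` Bs (map (\<lambda>k. e k x) [0..<n]) \<subseteq> W m \<longrightarrow> v \<in> W m) \<and>
            (f ` Bs (map (\<lambda>k. e k x) [0..<n]) \<inter> W m = {} \<longrightarrow> v \<notin> W m)"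
          using x x' by blast
        show "\<forall>k\<in>{..<n}. v \<in> Y k (map (\<lambda>k. e k x) [0..<n] ! k)" using Yin x by simp
      qed simp
      moreover have "v \<in> space M" using x BZ fZ by blast
      ultimately show "v \<in> R" unfolding R_def by blast
    qed
  next
    show "R \<subseteq> f ` B"
    proof
      fix v assume v: "v \<in> R"
      then have vM: "v \<in> space M" unfolding R_def by simp
      have "\<forall>n. \<exists>s. good v n s" using v unfolding R_def by simp
      then obtain s where "\<And>n. good v n (s n)" by metis
      then have s: "length (s n) = n" "Bs (s n) \<noteq> {}" "k < n \<Longrightarrow> v \<in> Y k (s n ! k)"
          "f ` Bs (s n) \<subseteq> W m \<Longrightarrow> v \<in> W m" "f ` Bs (s n) \<inter> W m = {} \<Longrightarrow> v \<notin> W m" for n k m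
        unfolding good_def by simp_all
      define z where "z k = s (Suc k) ! k" for k
      have sz: "s n ! k = z k" if "k < n" for n k
        unfolding z_def by (rule Ydisj[OF s(3)[OF that] s(3)]) simp
      have late: "\<exists>n. \<forall>y\<in>Bs (s n). \<forall>h\<in>H. h y = z (g h)" if H: "finite H" "H \<subseteq> G" for H
      proof (intro exI ballI)
        fix y h
        assume y: "y \<in> Bs (s (Suc (Max (insert 0 (g ` H)))))" and h: "h \<in> H"
        have lt: "g h < Suc (Max (insert 0 (g ` H)))" using H(1) h by (simp add: less_Suc_eq_le)
        then have "e (g h) y = s (Suc (Max (insert 0 (g ` H)))) ! g h" using y s(1) unfolding Bs_def by auto
        then show "h y = z (g h)" using sz[OF lt] eg h H(2) by auto
      qed
      have "\<exists>x\<in>Z. \<forall>h\<in>G. h x = z (g h)"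
      proof (rule complete_familyD[OF G(1)])
        fix H assume "finite H" "H \<subseteq> G"
        from late[OF this] s(2) BZ show "\<exists>x\<in>Z. \<forall>h\<in>H. h x = z (g h)" unfolding Bs_def by blast
      qed
      then obtain x where x: "x \<in> Z" "\<And>h. h \<in> G \<Longrightarrow> h x = z (g h)" by blast
      have decided: "\<exists>n. \<forall>y\<in>Bs (s n). y \<in> A \<longleftrightarrow> x \<in> A" if A: "decides Z G A" for A
      proof -
        obtain H where H: "finite H" "H \<subseteq> G"
            "\<And>x y. x \<in> Z \<Longrightarrow> y \<in> Z \<Longrightarrow> \<forall>g\<in>H. g x = g y \<Longrightarrow> x \<in> A \<longleftrightarrow> y \<in> A"
          using A by (rule decidesE) blast
        obtain n where n: "\<forall>y\<in>Bs (s n). \<forall>h\<in>H. h y = z (g h)" using late[OF H(1,2)] by blast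
        have "y \<in> A \<longleftrightarrow> x \<in> A" if "y \<in> Bs (s n)" for y
        proof (rule H(3))
          show "y \<in> Z" using that BZ unfolding Bs_def by auto
          show "\<forall>h\<in>H. h y = h x" using n that x(2) H(2) by (metis subsetD)
        qed (rule x(1))
        then show ?thesis by blast
      qed
      have xB: "x \<in> B" using decided[OF GB] s(2) unfolding Bs_def by blast
      have "f x = v"
      proof (rule ccontr)
        assume "f x \<noteq> v"
        then obtain m where m: "f x \<in> W m \<longleftrightarrow> v \<notin> W m" using W(2)[of "f x" v] vM fZ x(1) by blast
        obtain n where "\<forall>y\<in>Bs (s n). y \<in> f -` W m \<longleftrightarrow> x \<in> f -` W m" using decided[OF fW] by blast
        with s(4)[of n m] s(5)[of n m] m show False by auto
      qed
      with xB show "v \<in> f ` B" by blast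
    qed
  qed
  ultimately show ?thesis by simp
qed

text \<open>A point \<open>x\<close> of a finite fibre is alone in the trace of some \<open>U n\<close> on the fibre. The set
  of points that are alone in \<open>U n\<close> is only the complement of a Souslin set, but the separation
  theorem shrinks these complements to Borel sets that still cover the space.\<close>

lemma finite_to_one_cover:
  fixes f :: "'z \<Rightarrow> 'x" and W :: "nat \<Rightarrow> 'x set"
  assumes N: "standard_borel N" and f: "f \<in> N \<rightarrow>\<^sub>M M"
    and fin: "\<And>x. x \<in> space N \<Longrightarrow> finite {y \<in> space N. f y = f x}"
    and W: "\<And>k. W k \<in> sets M" "\<And>x y. x \<in> space M \<Longrightarrow> y \<in> space M \<Longrightarrow> x \<noteq> y \<Longrightarrow> \<exists>k. x \<in> W k \<longleftrightarrow> y \<notin> W k"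
  obtains P :: "nat \<Rightarrow> 'z set" where "\<And>n. P n \<in> sets N" "\<And>n. inj_on f (P n)"
    "(\<Union>n. P n) = space N"
proof -
  obtain U :: "nat \<Rightarrow> 'z set" where U: "\<And>k. U k \<in> sets N"
    "\<And>F K. finite F \<Longrightarrow> F \<subseteq> space N \<Longrightarrow> K \<subseteq> F \<Longrightarrow> \<exists>k. U k \<inter> F = K"
    using standard_borel_finite_traces[OF N] by metis
  have Usep: "\<exists>k. x \<in> U k \<longleftrightarrow> y \<notin> U k" if xy: "x \<in> space N" "y \<in> space N" "x \<noteq> y" for x y
  proof -
    obtain k where "U k \<inter> {x, y} = {x}" using U(2)[of "{x, y}" "{x}"] xy by auto
    with xy(3) show ?thesis by (intro exI[of _ k]) auto
  qed
  let ?N2 = "N \<Otimes>\<^sub>M N"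
  \<comment> \<open>The projection of \<open>B n\<close> is the set of the points that are not in \<open>U n\<close> or share their fibre
    with another point of \<open>U n\<close>. The countable quantifiers express equations between points.\<close>
  define B where "B n = {p \<in> space ?N2. fst p \<notin> U n \<or>
      (snd p \<in> U n \<and> (\<forall>k. f (fst p) \<in> W k \<longleftrightarrow> f (snd p) \<in> W k) \<and>
       \<not> (\<forall>k. fst p \<in> U k \<longleftrightarrow> snd p \<in> U k))}" for n
  have Bsets: "B n \<in> sets ?N2" for n
    unfolding B_def using U(1) W(1) f by measurable
  have in_B: "p \<in> B n \<longleftrightarrow> p \<in> space ?N2 \<and> (fst p \<notin> U n \<or>
      (snd p \<in> U n \<and> f (fst p) = f (snd p) \<and> fst p \<noteq> snd p))" for p n
  proof (cases "p \<in> space ?N2")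
    case True
    then have p: "fst p \<in> space N" "snd p \<in> space N" by (auto simp: space_pair_measure)
    then have "f (fst p) \<in> space M" "f (snd p) \<in> space M" using f by (auto dest: measurable_space)
    then have "(\<forall>k. f (fst p) \<in> W k \<longleftrightarrow> f (snd p) \<in> W k) \<longleftrightarrow> f (fst p) = f (snd p)"
      using W(2) by metis
    moreover have "(\<forall>k. fst p \<in> U k \<longleftrightarrow> snd p \<in> U k) \<longleftrightarrow> fst p = snd p"
      using Usep p by metis
    ultimately show ?thesis using True unfolding B_def by blast
  qed (simp add: B_def)
  have fstm: "fst \<in> ?N2 \<rightarrow>\<^sub>M N" by measurable
  let ?A = "\<lambda>n. if even n then B (n div 2) else fst -` U (n div 2) \<inter> space ?N2"
  have A: "?A n \<in> sets ?N2" for n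
    using Bsets measurable_sets[OF fstm U(1)] by simp
  obtain G where G: "complete_family (space ?N2) G" "\<And>n. decides (space ?N2) G (?A n)"
    by (rule codable_countable_family[where W = ?A,
          OF codable_pair[OF standard_borel_codable[OF N] standard_borel_codable[OF N]] A]) blast
  have GB: "decides (space ?N2) G (B n)" for n using G(2)[of "2 * n"] by simp
  have GU: "decides (space ?N2) G (fst -` U n)" for n
    using G(2)[of "Suc (2 * n)"] unfolding decides_def by simp
  have BZ: "B n \<subseteq> space ?N2" for n unfolding B_def by blast
  have fstsp: "fst ` space ?N2 \<subseteq> space N" by (auto simp: space_pair_measure)
  have "e \<notin> (\<Inter>n. fst ` B n)" for e
  proof
    assume e: "e \<in> (\<Inter>n. fst ` B n)"
    then have "e \<in> fst ` B 0" by blast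
    then have eN: "e \<in> space N" using BZ[of 0] fstsp by (meson image_mono subsetD)
    obtain n where n: "U n \<inter> {y \<in> space N. f y = f e} = {e}"
      using U(2)[OF fin[OF eN], of "{e}"] eN by auto
    have "e \<in> fst ` B n" using e by (rule INT_D) simp
    then obtain p where p: "p \<in> B n" "e = fst p" by (rule imageE)
    have "e \<in> U n" using n by blast
    with p have "snd p \<in> space N" "snd p \<in> U n" "f (snd p) = f e" "snd p \<noteq> e"
      unfolding in_B by (auto simp: space_pair_measure)
    then have "snd p \<in> U n \<inter> {y \<in> space N. f y = f e}" by simp
    with n \<open>snd p \<noteq> e\<close> show False by simp
  qed
  then have "(\<Inter>n. fst ` B n) = {}" by blast
  from novikov_separation[OF G(1) BZ GB GU U(1) Usep fstsp this]
  obtain S where S: "\<And>n. S n \<in> sets N" "\<And>n. fst ` B n \<subseteq> S n" "(\<Inter>n. S n) = {}" by blast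
  define Q where "Q n = space N - S n" for n
  have inj: "inj_on f (Q n)" for n
  proof (rule inj_onI, rule ccontr)
    fix x y assume xy: "x \<in> Q n" "y \<in> Q n" "f x = f y" "x \<noteq> y"
    then have sp: "(x, y) \<in> space ?N2" "(y, x) \<in> space ?N2" unfolding Q_def by (auto simp: space_pair_measure)
    have "(x, y) \<notin> B n" "(y, x) \<notin> B n" using S(2)[of n] xy unfolding Q_def by force+
    with sp xy show False unfolding in_B by auto
  qed
  show thesis
  proof
    show "Q n \<in> sets N" for n unfolding Q_def using S(1) by auto
    show "inj_on f (Q n)" for n by (rule inj)
    have "(\<Union>n. Q n) = space N - (\<Inter>n. S n)" unfolding Q_def by auto
    then show "(\<Union>n. Q n) = space N" using S(3) by simp
  qed
qed

section \<open>Locally finite graphs\<close>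

locale lf_graph =
  fixes N :: "'v \<Rightarrow> 'v set"
  assumes nbr_sym: "y \<in> N x \<Longrightarrow> x \<in> N y"
    and nbr_finite [simp]: "finite (N x)"
begin

definition nbs :: "'v set \<Rightarrow> 'v set" where
  "nbs S = (\<Union>x\<in>S. N x)"

text \<open>The component of \<open>x\<close> in the subgraph induced on \<open>W\<close>; it is the singleton of \<open>x\<close> if \<open>x\<close> is not
  in \<open>W\<close>.\<close>

definition conn :: "'v set \<Rightarrow> 'v \<Rightarrow> 'v set" where
  "conn W x = {y. (x, y) \<in> {(u, v). v \<in> N u \<and> u \<in> W \<and> v \<in> W}\<^sup>*}"

primrec nhood :: "nat \<Rightarrow> 'v set \<Rightarrow> 'v set" where
  "nhood 0 S = S"
| "nhood (Suc d) S = nhood d S \<union> nbs (nhood d S)"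

definition hall :: "'v set \<Rightarrow> 'v set \<Rightarrow> bool" where
  "hall P Q \<longleftrightarrow> (\<forall>X. finite X \<and> X \<subseteq> P \<longrightarrow> card X \<le> card (nbs X \<inter> Q))"

lemma nbs_Un: "nbs (X \<union> Y) = nbs X \<union> nbs Y"
  unfolding nbs_def by auto

lemma nbs_insert: "nbs (insert a X) = N a \<union> nbs X"
  unfolding nbs_def by auto

lemma nbs_mono: "X \<subseteq> Y \<Longrightarrow> nbs X \<subseteq> nbs Y"
  unfolding nbs_def by auto

lemma finite_nbs [simp]: "finite X \<Longrightarrow> finite (nbs X)"
  unfolding nbs_def by auto

lemma nbsI: "x \<in> X \<Longrightarrow> y \<in> N x \<Longrightarrow> y \<in> nbs X"
  unfolding nbs_def by auto

lemma hallD: "hall P Q \<Longrightarrow> finite X \<Longrightarrow> X \<subseteq> P \<Longrightarrow> card X \<le> card (nbs X \<inter> Q)"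
  unfolding hall_def by blast

lemma hall_mono: "hall P Q \<Longrightarrow> P' \<subseteq> P \<Longrightarrow> nbs P' \<inter> Q \<subseteq> Q' \<Longrightarrow> hall P' Q'"
  unfolding hall_def
proof (intro allI impI, elim conjE)
  fix X assume h: "\<forall>X. finite X \<and> X \<subseteq> P \<longrightarrow> card X \<le> card (nbs X \<inter> Q)" "P' \<subseteq> P" "nbs P' \<inter> Q \<subseteq> Q'"
    and X: "finite X" "X \<subseteq> P'"
  have "card X \<le> card (nbs X \<inter> Q)" using h X by blast
  also have "\<dots> \<le> card (nbs X \<inter> Q')" using h(3) nbs_mono[OF X(2)] X(1) by (intro card_mono) auto
  finally show "card X \<le> card (nbs X \<inter> Q')" .
qed

text \<open>If every choice of \<open>b\<close> destroys Hall's condition, then each candidate \<open>b\<close> is a neighbor of a tight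
  set, one with exactly as many neighbors in \<open>Q\<close> as elements. Tight sets are closed under unions by
  submodularity, so one tight set has all the candidates among its neighbors, and adding
  \<open>a\<close> to it contradicts Hall's condition. There are finitely many candidates, so \<open>P\<close> may be
  infinite.\<close>

lemma hall_step:
  assumes hall: "hall P Q" and a: "a \<in> P"
  shows "\<exists>b\<in>N a \<inter> Q. hall (P - {a}) (Q - {b})"
proof (rule ccontr)
  assume "\<not> (\<exists>b\<in>N a \<inter> Q. hall (P - {a}) (Q - {b}))"
  then have "\<forall>b\<in>N a \<inter> Q. \<exists>X. finite X \<and> X \<subseteq> P - {a} \<and> card (nbs X \<inter> (Q - {b})) < card X"
    unfolding hall_def by (meson not_le)
  then obtain X where X: "\<forall>b\<in>N a \<inter> Q. finite (X b) \<and> X b \<subseteq> P - {a} \<and> card (nbs (X b) \<inter> (Q - {b})) < card (X b)"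
    by (rule bchoice[THEN exE])
  define tight where "tight Y \<longleftrightarrow> finite Y \<and> Y \<subseteq> P - {a} \<and> card (nbs Y \<inter> Q) \<le> card Y" for Y
  have X_tight: "tight (X b) \<and> b \<in> nbs (X b)" if b: "b \<in> N a \<inter> Q" for b
  proof -
    have Xb: "finite (X b)" "X b \<subseteq> P - {a}" "card (nbs (X b) \<inter> (Q - {b})) < card (X b)"
      using X b by blast+
    have h: "card (X b) \<le> card (nbs (X b) \<inter> Q)" using hallD[OF hall Xb(1)] Xb(2) by blast
    have eq: "nbs (X b) \<inter> (Q - {b}) = nbs (X b) \<inter> Q - {b}" by blast
    have mem: "b \<in> nbs (X b) \<inter> Q"
    proof (rule ccontr)
      assume "b \<notin> nbs (X b) \<inter> Q"
      then have "nbs (X b) \<inter> (Q - {b}) = nbs (X b) \<inter> Q" by blast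
      with h Xb(3) show False by simp
    qed
    have "card (nbs (X b) \<inter> Q - {b}) = card (nbs (X b) \<inter> Q) - 1"
      using mem Xb(1) by (simp add: card_Diff_singleton)
    with Xb(3) have "card (nbs (X b) \<inter> Q) \<le> card (X b)" unfolding eq by linarith
    with Xb mem show ?thesis unfolding tight_def by blast
  qed
  have tight_Un: "tight (Y \<union> Y')" if Y: "tight Y" and Y': "tight Y'" for Y Y'
  proof -
    have fin: "finite Y" "finite Y'" using Y Y' unfolding tight_def by auto
    have 1: "nbs (Y \<union> Y') \<inter> Q = (nbs Y \<inter> Q) \<union> (nbs Y' \<inter> Q)" unfolding nbs_Un by blast
    have "card (nbs (Y \<inter> Y') \<inter> Q) \<le> card ((nbs Y \<inter> Q) \<inter> (nbs Y' \<inter> Q))"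
      using fin nbs_mono[of "Y \<inter> Y'" Y] nbs_mono[of "Y \<inter> Y'" Y'] by (intro card_mono) auto
    moreover have "card (Y \<inter> Y') \<le> card (nbs (Y \<inter> Y') \<inter> Q)"
      using Y fin unfolding tight_def by (intro hallD[OF hall]) auto
    moreover have "card (nbs Y \<inter> Q) + card (nbs Y' \<inter> Q) =
        card ((nbs Y \<inter> Q) \<union> (nbs Y' \<inter> Q)) + card ((nbs Y \<inter> Q) \<inter> (nbs Y' \<inter> Q))"
      using fin by (intro card_Un_Int) auto
    moreover have "card Y + card Y' = card (Y \<union> Y') + card (Y \<inter> Y')" using fin by (intro card_Un_Int) auto
    ultimately have "card (nbs (Y \<union> Y') \<inter> Q) \<le> card (Y \<union> Y')"
      using Y Y' unfolding 1 tight_def by linarith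
    with Y Y' show ?thesis unfolding tight_def by auto
  qed
  have "tight (\<Union>b\<in>J. X b)" if "finite J" "J \<subseteq> N a \<inter> Q" for J
    using that
  proof (induction J)
    case empty
    then show ?case unfolding tight_def by (simp add: nbs_def)
  next
    case (insert b J)
    then show ?case using X_tight[of b] tight_Un[of "X b" "\<Union>b\<in>J. X b"] by auto
  qed
  then have T: "tight (\<Union>b\<in>N a \<inter> Q. X b)" (is "tight ?T") by auto
  have sub: "N a \<inter> Q \<subseteq> nbs ?T"
  proof
    fix b assume b: "b \<in> N a \<inter> Q"
    then show "b \<in> nbs ?T" using X_tight[OF b] nbs_mono[of "X b" ?T] by blast
  qed
  have fT: "finite ?T" "?T \<subseteq> P - {a}" "card (nbs ?T \<inter> Q) \<le> card ?T" using T unfolding tight_def by blast+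
  have "nbs (insert a ?T) \<inter> Q = nbs ?T \<inter> Q" using sub unfolding nbs_insert by blast
  moreover have "card (insert a ?T) \<le> card (nbs (insert a ?T) \<inter> Q)"
    by (rule hallD[OF hall]) (use fT a in auto)
  moreover have "a \<notin> ?T" using fT(2) by blast
  ultimately show False using fT(1,3) by simp
qed

subsection \<open>Connectedness\<close>

lemma conn_refl [simp]: "x \<in> conn W x"
  unfolding conn_def by simp

lemma conn_trans: "y \<in> conn W x \<Longrightarrow> z \<in> conn W y \<Longrightarrow> z \<in> conn W x"
  unfolding conn_def by auto

lemma conn_sym: "y \<in> conn W x \<Longrightarrow> x \<in> conn W y"
proof -
  have "sym {(u, v). v \<in> N u \<and> u \<in> W \<and> v \<in> W}" by (auto simp: sym_def intro: nbr_sym)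
  then have "sym ({(u, v). v \<in> N u \<and> u \<in> W \<and> v \<in> W}\<^sup>*)" by (rule sym_rtrancl)
  then show "y \<in> conn W x \<Longrightarrow> x \<in> conn W y" unfolding conn_def by (auto dest: symD)
qed

lemma conn_eq: "y \<in> conn W x \<Longrightarrow> conn W y = conn W x"
  using conn_trans conn_sym by blast

lemma conn_eq_iff: "conn W x = conn W y \<longleftrightarrow> y \<in> conn W x"
  using conn_eq conn_refl by metis

lemma conn_step: "y \<in> conn W x \<Longrightarrow> z \<in> N y \<Longrightarrow> y \<in> W \<Longrightarrow> z \<in> W \<Longrightarrow> z \<in> conn W x"
  unfolding conn_def by (auto intro: rtrancl_into_rtrancl)

lemma conn_closed_subset:
  assumes "x \<in> S" and "\<And>u v. u \<in> S \<Longrightarrow> v \<in> N u \<Longrightarrow> u \<in> W \<Longrightarrow> v \<in> W \<Longrightarrow> v \<in> S"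
  shows "conn W x \<subseteq> S"
proof
  fix y assume "y \<in> conn W x"
  then have "(x, y) \<in> {(u, v). v \<in> N u \<and> u \<in> W \<and> v \<in> W}\<^sup>*" unfolding conn_def by simp
  then show "y \<in> S" by induction (use assms in auto)
qed

lemma conn_subset: "x \<in> W \<Longrightarrow> conn W x \<subseteq> W"
  by (rule conn_closed_subset)

lemma conn_mono: "W \<subseteq> W' \<Longrightarrow> conn W x \<subseteq> conn W' x"
  by (rule conn_closed_subset) (auto intro: conn_step)

lemma conn_restrict:
  assumes "conn W x \<subseteq> W'" "W' \<subseteq> W"
  shows "conn W' x = conn W x"
proof
  have "conn W x \<subseteq> conn W' x \<inter> conn W x"
  proof (rule conn_closed_subset)
    fix u v assume u: "u \<in> conn W' x \<inter> conn W x" and v: "v \<in> N u" "u \<in> W" "v \<in> W"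
    then have "v \<in> conn W x" using conn_step by blast
    moreover have "u \<in> W'" "v \<in> W'" using assms u \<open>v \<in> conn W x\<close> by auto
    ultimately show "v \<in> conn W' x \<inter> conn W x" using u v conn_step by blast
  qed simp
  then show "conn W x \<subseteq> conn W' x" by blast
qed (rule conn_mono[OF assms(2)])

lemma conn_exit:
  assumes "y \<in> conn UNIV x" "x \<notin> T" "y \<in> T"
  obtains u v where "u \<in> conn (-T) x" "v \<in> N u" "v \<in> T"
proof -
  have "\<exists>u v. u \<in> conn (-T) x \<and> v \<in> N u \<and> v \<in> T"
  proof (rule ccontr)
    assume none: "\<not> ?thesis"
    have sub: "conn (-T) x \<subseteq> -T" using assms(2) by (intro conn_subset) simp
    have "conn UNIV x \<subseteq> conn (-T) x"
    proof (rule conn_closed_subset)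
      fix u v assume u: "u \<in> conn (-T) x" and v: "v \<in> N u"
      then have "v \<in> -T" "u \<in> -T" using none sub by auto
      then show "v \<in> conn (-T) x" using conn_step[OF u v] by blast
    qed simp
    with sub assms show False by blast
  qed
  with that show thesis by blast
qed

lemma conn_UNIV_nbr: "y \<in> conn UNIV x \<Longrightarrow> z \<in> N y \<Longrightarrow> z \<in> conn UNIV x"
  by (rule conn_step) auto

subsection \<open>Neighborhoods\<close>

lemma nhood_Suc_shift: "nhood (Suc d) S = nhood d (S \<union> nbs S)"
  by (induction d) auto

lemma nhood_add: "nhood d (nhood e S) = nhood (d + e) S"
  by (induction d) auto

lemma nhood_increasing: "d \<le> e \<Longrightarrow> nhood d S \<subseteq> nhood e S"
  by (induction e) (auto simp: le_Suc_eq)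

lemma nhood_superset: "S \<subseteq> nhood d S"
  using nhood_increasing[of 0 d S] by simp

lemma finite_nhood [simp]: "finite S \<Longrightarrow> finite (nhood d S)"
  by (induction d) auto

lemma nhood_mono: "S \<subseteq> S' \<Longrightarrow> nhood d S \<subseteq> nhood d S'"
proof (induction d)
  case (Suc d)
  then have "nhood d S \<subseteq> nhood d S'" by simp
  with nbs_mono[OF this] show ?case by auto
qed simp

lemma nhood_eq_UN: "nhood d S = (\<Union>s\<in>S. nhood d {s})"
  by (induction d) (auto simp: nbs_def)

lemma nhood_sym: "x \<in> nhood d {y} \<longleftrightarrow> y \<in> nhood d {x}"
proof (induction d arbitrary: x y)
  case (Suc d)
  have "x \<in> nhood (Suc d) {y} \<longleftrightarrow> x \<in> nhood d {y} \<or> (\<exists>u\<in>N x. u \<in> nhood d {y})"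
    using nbr_sym by (auto simp: nbs_def)
  also have "\<dots> \<longleftrightarrow> (\<exists>u\<in>insert x (N x). u \<in> nhood d {y})" by blast
  also have "\<dots> \<longleftrightarrow> (\<exists>u\<in>insert x (N x). y \<in> nhood d {u})" using Suc.IH by blast
  also have "\<dots> \<longleftrightarrow> y \<in> nhood (Suc d) {x}"
    unfolding nhood_Suc_shift by (subst nhood_eq_UN) (auto simp: nbs_def)
  finally show ?case .
qed auto

lemma nhood_disjointI:
  assumes "nhood (2 * d) K \<inter> K' = {}"
  shows "nhood d K \<inter> nhood d K' = {}"
proof (rule ccontr)
  assume "nhood d K \<inter> nhood d K' \<noteq> {}"
  then obtain x k' where x: "x \<in> nhood d K" "x \<in> nhood d {k'}" "k' \<in> K'"
    using nhood_eq_UN[of d K'] by blast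
  then have "k' \<in> nhood d {x}" using nhood_sym by blast
  then have "k' \<in> nhood d (nhood d K)" using nhood_mono[of "{x}" "nhood d K" d] x(1) by blast
  then have "k' \<in> nhood (2 * d) K" unfolding nhood_add by (simp add: mult_2)
  with assms x(3) show False by blast
qed

lemma nhood_subset_conn: "S \<subseteq> conn UNIV x \<Longrightarrow> nhood d S \<subseteq> conn UNIV x"
  by (induction d) (auto simp: nbs_def intro: conn_UNIV_nbr)

lemma conn_imp_nhood: "y \<in> conn UNIV x \<Longrightarrow> \<exists>d. y \<in> nhood d {x}"
proof -
  have "conn UNIV x \<subseteq> (\<Union>d. nhood d {x})"
  proof (rule conn_closed_subset)
    show "x \<in> (\<Union>d. nhood d {x})" by (auto intro: exI[of _ 0])
    fix u v assume "u \<in> (\<Union>d. nhood d {x})" "v \<in> N u"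
    then obtain d where "u \<in> nhood d {x}" by blast
    then have "v \<in> nhood (Suc d) {x}" using \<open>v \<in> N u\<close> by (auto simp: nbs_def)
    then show "v \<in> (\<Union>d. nhood d {x})" by blast
  qed
  then show "y \<in> conn UNIV x \<Longrightarrow> \<exists>d. y \<in> nhood d {x}" by blast
qed

lemma finite_subset_nhood:
  assumes "finite S" "S \<subseteq> conn UNIV x"
  shows "\<exists>d. S \<subseteq> nhood d {x}"
  using assms
proof (induction S)
  case (insert y S)
  then obtain d where d: "S \<subseteq> nhood d {x}" by auto
  obtain e where e: "y \<in> nhood e {x}" using conn_imp_nhood insert by blast
  show ?case
    using d e nhood_increasing[of d "max d e" "{x}"] nhood_increasing[of e "max d e" "{x}"]
    by (intro exI[of _ "max d e"]) auto
qed auto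

subsection \<open>Removing matched pieces that are far apart\<close>

text \<open>A violating set \<open>X\<close> that is minimal cannot be split into parts without common neighbors. If it loses
  neighbors to one piece only, the assumption on that piece applies. Otherwise consider, for
  each of the \<open>m\<close> pieces concerned, the vertices of \<open>X\<close> at distance at most \<open>2 i\<close> from it: their number
  grows with \<open>i\<close>, since \<open>X\<close> also reaches another, distant piece. So \<open>|X| \<ge> m r\<close>, and
  the surplus \<open>(c - 1) |X| \<ge> m n\<close> makes up for the loss.\<close>

lemma hall_remove_far_pieces:
  fixes c :: real and \<K> :: "'v set set"
  assumes c: "c > 1" and expand: "\<And>X. finite X \<Longrightarrow> X \<subseteq> P \<Longrightarrow> c * card X \<le> card (nbs X)"
    and Q: "nbs P \<subseteq> Q"
    and F: "\<And>K. K \<in> \<K> \<Longrightarrow> finite (F K) \<and> card (F K) \<le> n \<and> F K \<subseteq> nbs K \<and> hall (P - K) (Q - F K)"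
    and r: "real n \<le> (c - 1) * r" "r \<ge> 1"
    and far: "\<And>K K'. K \<in> \<K> \<Longrightarrow> K' \<in> \<K> \<Longrightarrow> K \<noteq> K' \<Longrightarrow> nhood (2 * r) K \<inter> nhood (2 * r) K' = {}"
  shows "hall (P - \<Union>\<K>) (Q - (\<Union>K\<in>\<K>. F K))"
  unfolding hall_def
proof (intro allI impI, elim conjE)
  define FF where "FF = (\<Union>K\<in>\<K>. F K)"
  fix X assume "finite X" "X \<subseteq> P - \<Union>\<K>"
  then have "card X \<le> card (nbs X - FF)"
  proof (induction X rule: finite_psubset_induct)
    case (psubset X)
    have XP: "X \<subseteq> P" using psubset.prems by blast
    show ?case
    proof (cases "\<exists>Y. Y \<subset> X \<and> Y \<noteq> {} \<and> nbs Y \<inter> nbs (X - Y) = {}")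
      case True
      then obtain Y where Y: "Y \<subset> X" "Y \<noteq> {}" "nbs Y \<inter> nbs (X - Y) = {}" by blast
      have fin: "finite Y" "finite (X - Y)" using Y(1) psubset.hyps finite_subset by auto
      have XY: "X = Y \<union> (X - Y)" using Y(1) by blast
      have "nbs X = nbs Y \<union> nbs (X - Y)" by (subst XY) (rule nbs_Un)
      then have "nbs X - FF = (nbs Y - FF) \<union> (nbs (X - Y) - FF)" by blast
      moreover have "card ((nbs Y - FF) \<union> (nbs (X - Y) - FF)) = card (nbs Y - FF) + card (nbs (X - Y) - FF)"
        using fin Y(3) by (intro card_Un_disjoint) auto
      moreover have "card Y \<le> card (nbs Y - FF)" using psubset.IH[OF Y(1)] psubset.prems Y(1) by blast
      moreover have "card (X - Y) \<le> card (nbs (X - Y) - FF)"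
        by (rule psubset.IH) (use Y psubset.prems in blast)+
      moreover have "card X = card Y + card (X - Y)"
        using fin by (subst XY, intro card_Un_disjoint) auto
      ultimately show ?thesis by simp
    next
      case no_split: False
      define KX where "KX = {K \<in> \<K>. nbs X \<inter> F K \<noteq> {}}"
      have diff: "nbs X - FF = nbs X - (\<Union>K\<in>KX. F K)" unfolding FF_def KX_def by blast
      have big: "c * card X \<le> card (nbs X)" using expand[OF psubset.hyps XP] .
      consider "KX = {}" | K where "KX = {K}" | K K' where "K \<in> KX" "K' \<in> KX" "K \<noteq> K'" by blast
      then show ?thesis
      proof cases
        case 1
        have "real (card X) \<le> c * card X" using c by (simp add: mult_le_cancel_right1)
        with big have "card X \<le> card (nbs X)" by linarith
        then show ?thesis unfolding diff 1 by simp
      next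
        case (2 K)
        then have K: "K \<in> \<K>" unfolding KX_def by auto
        have "card X \<le> card (nbs X \<inter> (Q - F K))"
          by (rule hallD[of "P - K"]) (use F[OF K] psubset K in auto)
        moreover have "nbs X \<inter> (Q - F K) = nbs X - FF"
          unfolding diff 2 using Q nbs_mono[OF XP] by auto
        ultimately show ?thesis by simp
      next
        case (3 K1 K2)
        \<comment> \<open>A lost neighbor of \<open>X\<close> is adjacent to \<open>K\<close>, which accounts for the distance 2.\<close>
        have near: "X \<inter> nhood 2 K \<noteq> {}" if KX: "K \<in> KX" for K
        proof -
          have K: "K \<in> \<K>" "nbs X \<inter> F K \<noteq> {}" using KX unfolding KX_def by auto
          then obtain x b where xb: "x \<in> X" "b \<in> N x" "b \<in> nbs K" using F[OF K(1)] unfolding nbs_def by blast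
          then have "b \<in> nhood 1 K" by simp
          then have "x \<in> nbs (nhood 1 K)" using nbr_sym[OF xb(2)] by (rule nbsI)
          then have "x \<in> nhood 2 K" unfolding numeral_2_eq_2 by simp
          with xb show ?thesis by blast
        qed
        have not_all: "\<not> X \<subseteq> nhood (2 * r) K" if K: "K \<in> KX" for K
        proof
          assume sub: "X \<subseteq> nhood (2 * r) K"
          obtain K' where K': "K' \<in> KX" "K' \<noteq> K" using 3 by metis
          have "X \<inter> nhood (2 * r) K' \<noteq> {}"
            using near[OF K'(1)] nhood_increasing[of 2 "2 * r" K'] r(2) by auto
          with sub far[of K K'] K K' show False unfolding KX_def by blast
        qed
        have grow: "i \<le> card (X \<inter> nhood (2 * i) K)" if K: "K \<in> KX" and i: "1 \<le> i" "i \<le> r" for K i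
          using i
        proof (induction i rule: dec_induct)
          case base
          have "card (X \<inter> nhood 2 K) \<noteq> 0" using near[OF K] psubset.hyps by simp
          then show ?case by simp
        next
          case (step i)
          let ?Y = "X \<inter> nhood (2 * i) K"
          have "?Y \<subset> X"
            using not_all[OF K] step nhood_increasing[of "2 * i" "2 * r" K] by auto
          moreover have "?Y \<noteq> {}"
            using near[OF K] nhood_increasing[of 2 "2 * i" K] step by auto
          ultimately have "nbs ?Y \<inter> nbs (X - ?Y) \<noteq> {}" using no_split by blast
          then obtain u v b where uv: "u \<in> ?Y" "b \<in> N u" "v \<in> X - ?Y" "b \<in> N v" unfolding nbs_def by blast
          then have "b \<in> nhood (Suc (2 * i)) K" by (auto intro: nbsI)
          then have "v \<in> nbs (nhood (Suc (2 * i)) K)" using nbr_sym[OF uv(4)] by (rule nbsI)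
          then have v: "v \<in> nhood (2 * Suc i) K" by simp
          have "?Y \<subset> X \<inter> nhood (2 * Suc i) K"
            using v uv(3) nhood_increasing[of "2 * i" "2 * Suc i" K] by auto
          then have "card ?Y < card (X \<inter> nhood (2 * Suc i) K)"
            using psubset.hyps by (intro psubset_card_mono) auto
          with step show ?case by linarith
        qed
        have disj: "(X \<inter> nhood (2 * r) K) \<inter> (X \<inter> nhood (2 * r) K') = {}"
          if "K \<in> KX" "K' \<in> KX" "K \<noteq> K'" for K K'
          using far[of K K'] that unfolding KX_def by blast
        have nonempty: "X \<inter> nhood (2 * r) K \<noteq> {}" if "K \<in> KX" for K
          using near[OF that] nhood_increasing[of 2 "2 * r" K] r(2) by auto
        have "inj_on (\<lambda>K. X \<inter> nhood (2 * r) K) KX"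
        proof (rule inj_onI, rule ccontr)
          fix K K' assume "K \<in> KX" "K' \<in> KX" "X \<inter> nhood (2 * r) K = X \<inter> nhood (2 * r) K'" "K \<noteq> K'"
          with disj[of K K'] nonempty[of K] show False by simp
        qed
        moreover have "(\<lambda>K. X \<inter> nhood (2 * r) K) ` KX \<subseteq> Pow X" by blast
        ultimately have finKX: "finite KX"
          using psubset.hyps by (meson finite_Pow_iff finite_imageD finite_subset)
        have "card KX * r = (\<Sum>K\<in>KX. r)" by simp
        also have "\<dots> \<le> (\<Sum>K\<in>KX. card (X \<inter> nhood (2 * r) K))"
          using grow r(2) by (intro sum_mono) auto
        also have "\<dots> = card (\<Union>K\<in>KX. X \<inter> nhood (2 * r) K)"
          using finKX psubset.hyps disj by (intro card_UN_disjoint[symmetric]) auto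
        also have "\<dots> \<le> card X" using psubset.hyps by (intro card_mono) auto
        finally have "real (card KX * r) \<le> real (card X)" by (rule of_nat_mono)
        then have mr: "real (card KX) * real r \<le> real (card X)" by simp
        have "card (\<Union>K\<in>KX. F K) \<le> (\<Sum>K\<in>KX. card (F K))" using finKX by (rule card_UN_le)
        also have "\<dots> \<le> (\<Sum>K\<in>KX. n)" using F unfolding KX_def by (intro sum_mono) blast
        finally have "card (\<Union>K\<in>KX. F K) \<le> card KX * n" by simp
        then have "real (card (\<Union>K\<in>KX. F K)) \<le> real (card KX * n)" by (rule of_nat_mono)
        then have mn: "real (card (\<Union>K\<in>KX. F K)) \<le> real (card KX) * real n" by simp
        have "real (card KX) * real n \<le> real (card KX) * ((c - 1) * r)"
          using r(1) by (intro mult_left_mono) auto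
        also have "\<dots> = (c - 1) * (real (card KX) * real r)" by simp
        also have "\<dots> \<le> (c - 1) * card X" using mr c by (intro mult_left_mono) auto
        finally have "real (card (\<Union>K\<in>KX. F K)) \<le> (c - 1) * card X" using mn by linarith
        moreover have "real (card (nbs X)) - real (card (\<Union>K\<in>KX. F K)) \<le> real (card (nbs X - (\<Union>K\<in>KX. F K)))"
        proof -
          have "finite (\<Union>K\<in>KX. F K)" using finKX F unfolding KX_def by auto
          from diff_card_le_card_Diff[OF this, of "nbs X"] show ?thesis by linarith
        qed
        ultimately have "real (card X) \<le> real (card (nbs X - (\<Union>K\<in>KX. F K)))"
          using big by (simp add: algebra_simps)
        then show ?thesis unfolding diff by simp
      qed
    qed
  qed
  moreover have "nbs X \<inter> (Q - FF) = nbs X - FF"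
    using Q nbs_mono[of X P] \<open>X \<subseteq> P - \<Union>\<K>\<close> by blast
  ultimately show "card X \<le> card (nbs X \<inter> (Q - (\<Union>K\<in>\<K>. F K)))" unfolding FF_def by simp
qed

subsection \<open>Separating the two ends\<close>

definition separator :: "'v set \<Rightarrow> 'v set \<Rightarrow> bool" where
  "separator C K \<longleftrightarrow> (\<exists>y\<in>C - K. \<exists>z\<in>C - K. infinite (conn (-K) y) \<and> infinite (conn (-K) z) \<and> z \<notin> conn (-K) y)"

definition at_most_two_ends :: "'v set \<Rightarrow> bool" where
  "at_most_two_ends C \<longleftrightarrow> (\<forall>S x y z. finite S \<and> S \<subseteq> C \<and> x \<in> C - S \<and> y \<in> C - S \<and> z \<in> C - S \<and>
     infinite (conn (-S) x) \<and> infinite (conn (-S) y) \<and> infinite (conn (-S) z) \<longrightarrow>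
     y \<in> conn (-S) x \<or> z \<in> conn (-S) x \<or> z \<in> conn (-S) y)"

text \<open>Removing a larger finite set breaks the infinite component into pieces, each of which
  contains one of the finitely many neighbors of that set.\<close>

lemma infinite_conn_shrink:
  assumes inf: "infinite (conn (-S) y)" and y: "y \<in> C - S" and C: "C = conn UNIV x0"
    and K: "S \<subseteq> K" "finite K" "K \<noteq> {}" "K \<subseteq> C"
  obtains y' where "y' \<in> conn (-S) y" "y' \<in> C - K" "infinite (conn (-K) y')"
proof -
  have subC: "conn (-S) y \<subseteq> C"
    using conn_mono[of "-S" UNIV y] conn_eq[of y UNIV x0] y C by blast
  have "\<exists>y'\<in>conn (-S) y - K. infinite (conn (-K) y')"
  proof (rule ccontr)
    assume fin: "\<not> ?thesis"
    have "conn (-S) y \<subseteq> K \<union> (\<Union>v\<in>(nbs K \<inter> conn (-S) y) - K. conn (-K) v)"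
    proof
      fix w assume w: "w \<in> conn (-S) y"
      show "w \<in> K \<union> (\<Union>v\<in>(nbs K \<inter> conn (-S) y) - K. conn (-K) v)"
      proof (cases "w \<in> K")
        case False
        obtain k where k: "k \<in> K" using K(3) by blast
        then have "k \<in> conn UNIV w" using w subC K(4) C conn_eq[of w UNIV x0] by blast
        then obtain u v where uv: "u \<in> conn (-K) w" "v \<in> N u" "v \<in> K" using conn_exit False k by metis
        have "u \<in> conn (-S) w" using uv(1) conn_mono[of "-K" "-S" w] K(1) by blast
        then have "u \<in> conn (-S) y" using conn_trans w by blast
        moreover have "u \<in> nbs K" using uv nbr_sym nbsI by blast
        moreover have "u \<notin> K" using uv(1) conn_subset[of w "-K"] False by blast
        moreover have "w \<in> conn (-K) u" using conn_sym uv(1) by blast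
        ultimately show ?thesis by blast
      qed simp
    qed
    moreover have "finite (K \<union> (\<Union>v\<in>(nbs K \<inter> conn (-S) y) - K. conn (-K) v))"
      using fin K(2) by auto
    ultimately show False using inf finite_subset by blast
  qed
  then show thesis using that subC by blast
qed

lemma separator_mono:
  assumes S: "separator C S" and C: "C = conn UNIV x0" and K: "S \<subseteq> K" "finite K" "K \<noteq> {}" "K \<subseteq> C"
  shows "separator C K"
proof -
  obtain y z where yz: "y \<in> C - S" "z \<in> C - S" "infinite (conn (-S) y)" "infinite (conn (-S) z)"
      "z \<notin> conn (-S) y"
    using S unfolding separator_def by blast
  obtain y' where y': "y' \<in> conn (-S) y" "y' \<in> C - K" "infinite (conn (-K) y')"
    using infinite_conn_shrink[OF yz(3,1) C K] by blast
  obtain z' where z': "z' \<in> conn (-S) z" "z' \<in> C - K" "infinite (conn (-K) z')"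
    using infinite_conn_shrink[OF yz(4,2) C K] by blast
  have "z' \<notin> conn (-K) y'"
  proof
    assume "z' \<in> conn (-K) y'"
    then have "z' \<in> conn (-S) y'" using conn_mono[of "-K" "-S" y'] K(1) by blast
    then have "z' \<in> conn (-S) y" using y'(1) conn_trans by blast
    then have "z \<in> conn (-S) y" using conn_sym[OF z'(1)] conn_trans by blast
    with yz(5) show False by simp
  qed
  with y' z' show ?thesis unfolding separator_def by blast
qed

text \<open>The set \<open>K\<close> is a ball around a vertex, enlarged by the neighbors of its elements in \<open>B\<close>. It will play
  the role of a zone: containing the neighbors of its elements in \<open>B\<close>, it is
  separated from the rest by its vertices outside \<open>B\<close> alone.\<close>

lemma connected_closed_separator_exists:
  assumes S: "separator C S" "finite S" "S \<subseteq> C" and C: "C = conn UNIV x0"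
    and B: "\<And>b. b \<in> B \<Longrightarrow> N b \<inter> B = {}"
  obtains K where "finite K" "K \<noteq> {}" "K \<subseteq> C" "separator C K" "\<And>u. u \<in> K \<Longrightarrow> K \<subseteq> conn K u"
    "\<And>b. b \<in> K \<inter> B \<Longrightarrow> N b \<subseteq> K"
proof -
  obtain d where d: "S \<subseteq> nhood d {x0}" using finite_subset_nhood S C by blast
  define K where "K = nhood d {x0} \<union> nbs (nhood d {x0} \<inter> B)"
  have x0: "x0 \<in> K" unfolding K_def using nhood_superset by blast
  have K: "finite K" unfolding K_def by simp
  have ballC: "nhood e {x0} \<subseteq> C" for e unfolding C by (rule nhood_subset_conn) simp
  have "K \<subseteq> nhood (Suc d) {x0}" unfolding K_def using nbs_mono[of "nhood d {x0} \<inter> B" "nhood d {x0}"] by auto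
  then have KC: "K \<subseteq> C" using ballC by blast
  have in_conn: "nhood e {x0} \<subseteq> conn K x0" if "e \<le> d" for e
    using that
  proof (induction e)
    case (Suc e)
    show ?case
    proof
      fix y assume y: "y \<in> nhood (Suc e) {x0}"
      show "y \<in> conn K x0"
      proof (cases "y \<in> nhood e {x0}")
        case False
        then obtain u where u: "u \<in> nhood e {x0}" "y \<in> N u" using y by (auto simp: nbs_def)
        have "u \<in> K" "y \<in> K" using u(1) y Suc.prems nhood_increasing[of e d "{x0}"]
            nhood_increasing[of "Suc e" d "{x0}"] unfolding K_def by auto
        with u Suc show ?thesis by (auto intro: conn_step)
      qed (use Suc in auto)
    qed
  qed simp
  have all: "K \<subseteq> conn K x0"
  proof
    fix y assume y: "y \<in> K"
    show "y \<in> conn K x0"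
    proof (cases "y \<in> nhood d {x0}")
      case False
      then obtain u where u: "u \<in> nhood d {x0}" "y \<in> N u" using y by (auto simp: K_def nbs_def)
      then have "u \<in> K" unfolding K_def by blast
      with u y in_conn[of d] show ?thesis by (auto intro: conn_step)
    qed (use in_conn in blast)
  qed
  show thesis
  proof
    show "finite K" "K \<noteq> {}" "K \<subseteq> C" using K KC x0 by auto
    show "separator C K"
      by (rule separator_mono[OF S(1) C]) (use d K KC x0 in \<open>auto simp: K_def\<close>)
    show "K \<subseteq> conn K u" if "u \<in> K" for u
      using all that conn_eq by blast
    show "N b \<subseteq> K" if "b \<in> K \<inter> B" for b
    proof -
      have "b \<in> nhood d {x0}"
        using that B nbr_sym unfolding K_def nbs_def by blast
      then show ?thesis using that unfolding K_def nbs_def by blast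
    qed
  qed
qed

text \<open>Let \<open>T\<close> be the union of the separators. An infinite piece left by \<open>T\<close> touches only one separator
  \<open>K\<close>: if it touched \<open>K\<close> and \<open>K'\<close>, then removing \<open>K\<close> and \<open>K'\<close> would leave three infinite components,
  namely one containing the piece and the far sides of \<open>K\<close> and \<open>K'\<close>. Hence the piece is still a
  component after removing \<open>K\<close> and any other separators, and three separators touched by infinite
  pieces would again give three infinite components.\<close>

lemma finite_boundary_of_infinite_pieces:
  fixes \<K> :: "'v set set"
  assumes ends: "at_most_two_ends C" and C: "C = conn UNIV x0"
    and \<K>: "\<And>K. K \<in> \<K> \<Longrightarrow> finite K \<and> K \<noteq> {} \<and> K \<subseteq> C \<and> separator C K \<and> (\<forall>u\<in>K. K \<subseteq> conn K u)"
    and disj: "\<And>K K'. K \<in> \<K> \<Longrightarrow> K' \<in> \<K> \<Longrightarrow> K \<noteq> K' \<Longrightarrow> K \<inter> K' = {}"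
  shows "finite {x \<in> \<Union>\<K>. \<exists>y\<in>N x - \<Union>\<K>. infinite (conn (- \<Union>\<K>) y)}"
proof -
  define T where "T = \<Union>\<K>"
  define touches where "touches y K \<longleftrightarrow> (\<exists>u\<in>conn (-T) y. \<exists>v\<in>N u. v \<in> K)" for y K
  have conn_inside: "K' \<subseteq> conn (-K) v" if "K \<in> \<K>" "K' \<in> \<K>" "K \<noteq> K'" "v \<in> K'" for K K' v
    using \<K>[OF that(2)] conn_mono[of K' "-K" v] disj[OF that(1,2,3)] that(4) by blast
  have C_conn: "C = conn UNIV x" if "x \<in> C" for x using conn_eq that C by blast
  have touch: "y \<in> conn (-K) v" if y: "y \<notin> T" and K: "K \<in> \<K>" "K' \<in> \<K>" "K \<noteq> K'" and t: "touches y K'" and v: "v \<in> K'" for y K K' v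
  proof -
    obtain u w where uw: "u \<in> conn (-T) y" "w \<in> N u" "w \<in> K'" using t unfolding touches_def by blast
    have w: "w \<in> conn (-K) v" using conn_inside[OF K v] uw(3) by blast
    have "w \<in> -K" using uw(3) disj[OF K] by blast
    moreover have "u \<in> -T" using uw(1) conn_subset[of y "-T"] y by blast
    then have "u \<in> -K" using K unfolding T_def by blast
    ultimately have "u \<in> conn (-K) v" using conn_step[OF w] nbr_sym[OF uw(2)] by blast
    moreover have "y \<in> conn (-K) u"
      using conn_sym[OF uw(1)] conn_mono[of "-T" "-K" u] K unfolding T_def by blast
    ultimately show ?thesis by (rule conn_trans)
  qed
  have unique: "K = K'" if y: "y \<in> C - T" "infinite (conn (-T) y)" and K: "K \<in> \<K>" "touches y K"
      and K': "K' \<in> \<K>" "touches y K'" for y K K'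
  proof (rule ccontr)
    assume ne: "K \<noteq> K'"
    have other_side: "\<exists>p\<in>C - L. infinite (conn (-L) p) \<and> y \<notin> conn (-L) p" if L: "L \<in> \<K>" for L
    proof -
      obtain p q where pq: "p \<in> C - L" "q \<in> C - L" "infinite (conn (-L) p)" "infinite (conn (-L) q)"
          "q \<notin> conn (-L) p"
        using \<K>[OF L] unfolding separator_def by blast
      show ?thesis
      proof (cases "y \<in> conn (-L) p")
        case True
        then have "y \<notin> conn (-L) q" using pq(5) conn_sym conn_trans by blast
        with pq show ?thesis by blast
      qed (use pq in blast)
    qed
    obtain p where p: "p \<in> C - K" "infinite (conn (-K) p)" "y \<notin> conn (-K) p" using other_side[OF K(1)] by blast
    obtain p' where p': "p' \<in> C - K'" "infinite (conn (-K') p')" "y \<notin> conn (-K') p'" using other_side[OF K'(1)] by blast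
    have yT: "y \<notin> T" using y by blast
    have avoid: "conn (-K) p \<inter> K' = {}"
    proof (rule ccontr)
      assume "conn (-K) p \<inter> K' \<noteq> {}"
      then obtain w where w: "w \<in> conn (-K) p" "w \<in> K'" by blast
      have "y \<in> conn (-K) w" by (rule touch[OF yT K(1) K'(1) ne K'(2) w(2)])
      with w(1) p(3) conn_trans show False by blast
    qed
    have avoid': "conn (-K') p' \<inter> K = {}"
    proof (rule ccontr)
      assume "conn (-K') p' \<inter> K \<noteq> {}"
      then obtain w where w: "w \<in> conn (-K') p'" "w \<in> K" by blast
      have "y \<in> conn (-K') w" by (rule touch[OF yT K'(1) K(1) ne[symmetric] K(2) w(2)])
      with w(1) p'(3) conn_trans show False by blast
    qed
    define S where "S = K \<union> K'"
    have S: "finite S" "S \<subseteq> C" using \<K>[OF K(1)] \<K>[OF K'(1)] unfolding S_def by auto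
    have ps: "conn (-K) p \<subseteq> -K" "conn (-K') p' \<subseteq> -K'" using p p' by (intro conn_subset; blast)+
    have eq: "conn (-S) p = conn (-K) p"
      by (rule conn_restrict) (use avoid ps in \<open>auto simp: S_def\<close>)
    have eq': "conn (-S) p' = conn (-K') p'"
      by (rule conn_restrict) (use avoid' ps in \<open>auto simp: S_def\<close>)
    have ST: "S \<subseteq> T" using K K' unfolding S_def T_def by blast
    have yS: "infinite (conn (-S) y)" using conn_mono[of "-T" "-S" y] ST y(2) finite_subset by blast
    have "p \<in> C - S" using conn_refl[of p "-K"] avoid p(1) unfolding S_def by blast
    moreover have "p' \<in> C - S" using conn_refl[of p' "-K'"] avoid' p'(1) unfolding S_def by blast
    moreover have "y \<in> C - S" using y(1) ST by blast
    ultimately have "p' \<in> conn (-S) p \<or> y \<in> conn (-S) p \<or> y \<in> conn (-S) p'"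
      using ends S p(2) p'(2) yS eq eq' unfolding at_most_two_ends_def by metis
    then have "p' \<in> conn (-S) p" using p(3) p'(3) eq eq' by blast
    obtain k where k: "k \<in> K" using \<K>[OF K(1)] by blast
    then have "k \<in> conn UNIV p" using C_conn[of p] p(1) \<K>[OF K(1)] by blast
    then obtain u v where uv: "u \<in> conn (-K) p" "v \<in> N u" "v \<in> K" using conn_exit k p(1) by (metis DiffD2)
    have "conn (-S) p \<subseteq> conn (-K') p" by (rule conn_mono) (auto simp: S_def)
    moreover have "conn (-K') p = conn (-K') p'"
      using \<open>p' \<in> conn (-S) p\<close> calculation conn_eq by blast
    ultimately have "u \<in> conn (-K') p'" using uv(1) eq by blast
    moreover have "u \<in> -K'" using uv(1) avoid by blast
    moreover have "v \<in> -K'" using uv(3) disj[OF K(1) K'(1) ne] by blast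
    ultimately have "v \<in> conn (-K') p'" using conn_step[OF _ uv(2)] by blast
    with avoid' uv(3) show False by blast
  qed
  define Z where "Z = {x \<in> T. \<exists>y\<in>N x - T. infinite (conn (-T) y)}"
  define \<Z> where "\<Z> = {K \<in> \<K>. K \<inter> Z \<noteq> {}}"
  have witness: "\<exists>y\<in>C - T. infinite (conn (-T) y) \<and> touches y K" if KZ: "K \<in> \<Z>" for K
  proof -
    obtain x y where xy: "x \<in> K" "y \<in> N x - T" "infinite (conn (-T) y)" and K: "K \<in> \<K>"
      using KZ unfolding \<Z>_def Z_def by blast
    have "x \<in> conn UNIV x0" using xy(1) \<K>[OF K] C by blast
    then have "y \<in> C" using conn_UNIV_nbr xy(2) C by blast
    moreover have "touches y K" unfolding touches_def using xy nbr_sym conn_refl by blast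
    ultimately show ?thesis using xy by blast
  qed
  have no3: False if K: "K1 \<in> \<Z>" "K2 \<in> \<Z>" "K3 \<in> \<Z>" "K1 \<noteq> K2" "K1 \<noteq> K3" "K2 \<noteq> K3" for K1 K2 K3
  proof -
    define S where "S = K1 \<union> K2 \<union> K3"
    have in\<K>: "K1 \<in> \<K>" "K2 \<in> \<K>" "K3 \<in> \<K>" using K unfolding \<Z>_def by auto
    have S: "finite S" "S \<subseteq> C" "S \<subseteq> T"
      using \<K>[OF in\<K>(1)] \<K>[OF in\<K>(2)] \<K>[OF in\<K>(3)] in\<K> unfolding S_def T_def by auto
    obtain y1 where y1: "y1 \<in> C - T" "infinite (conn (-T) y1)" "touches y1 K1" using witness[OF K(1)] by blast
    obtain y2 where y2: "y2 \<in> C - T" "infinite (conn (-T) y2)" "touches y2 K2" using witness[OF K(2)] by blast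
    obtain y3 where y3: "y3 \<in> C - T" "infinite (conn (-T) y3)" "touches y3 K3" using witness[OF K(3)] by blast
    have same: "conn (-S) y = conn (-T) y" if y: "y \<in> C - T" "infinite (conn (-T) y)" "touches y L" "L \<in> \<K>" "L \<subseteq> S" for y L
    proof
      show "conn (-T) y \<subseteq> conn (-S) y" using S(3) by (intro conn_mono) blast
      show "conn (-S) y \<subseteq> conn (-T) y"
      proof (rule conn_closed_subset)
        fix u v assume uv: "u \<in> conn (-T) y" "v \<in> N u" "u \<in> -S" "v \<in> -S"
        have "v \<notin> T"
        proof
          assume "v \<in> T"
          then obtain K where "K \<in> \<K>" "v \<in> K" unfolding T_def by blast
          moreover from this have "touches y K" unfolding touches_def using uv by blast
          ultimately have "K = L" using unique[OF y(1,2)] y(3,4) by blast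
          with \<open>v \<in> K\<close> y(5) uv(4) show False by blast
        qed
        moreover have "u \<in> -T" using uv(1) conn_subset[of y "-T"] y(1) by blast
        ultimately show "v \<in> conn (-T) y" using conn_step[OF uv(1,2)] by blast
      qed simp
    qed
    have distinct: "z \<notin> conn (-T) y" if yz: "y \<in> C - T" "infinite (conn (-T) y)" "touches y L"
       "touches z L'" "L \<in> \<K>" "L' \<in> \<K>" "L \<noteq> L'" for y z L L'
    proof
      assume "z \<in> conn (-T) y"
      then have "touches y L'" using yz(4) conn_eq unfolding touches_def by metis
      with unique[OF yz(1,2,5,3,6)] yz(7) show False by blast
    qed
    have e: "conn (-S) y1 = conn (-T) y1" "conn (-S) y2 = conn (-T) y2" "conn (-S) y3 = conn (-T) y3"
      using same[OF y1 in\<K>(1)] same[OF y2 in\<K>(2)] same[OF y3 in\<K>(3)] unfolding S_def by auto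
    have "y1 \<in> C - S" "y2 \<in> C - S" "y3 \<in> C - S" using y1 y2 y3 S(3) by auto
    then have "y2 \<in> conn (-S) y1 \<or> y3 \<in> conn (-S) y1 \<or> y3 \<in> conn (-S) y2"
      using ends S y1(2) y2(2) y3(2) e unfolding at_most_two_ends_def by metis
    then show False
      using distinct[OF y1 y2(3) in\<K>(1,2) K(4)] distinct[OF y1 y3(3) in\<K>(1,3) K(5)]
        distinct[OF y2 y3(3) in\<K>(2,3) K(6)] e by auto
  qed
  have "finite \<Z>"
  proof (cases "\<exists>K1\<in>\<Z>. \<exists>K2\<in>\<Z>. K1 \<noteq> K2")
    case True
    then obtain K1 K2 where "K1 \<in> \<Z>" "K2 \<in> \<Z>" "K1 \<noteq> K2" by blast
    then have "\<Z> \<subseteq> {K1, K2}" using no3 by blast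
    then show ?thesis using finite_subset by blast
  next
    case False
    then have "\<Z> = {} \<or> (\<exists>K. \<Z> = {K})" by blast
    then show ?thesis by auto
  qed
  moreover have "finite K" if "K \<in> \<Z>" for K using \<K> that unfolding \<Z>_def by blast
  moreover have "Z \<subseteq> \<Union>\<Z>" unfolding Z_def \<Z>_def T_def by blast
  ultimately have "finite Z" by (meson finite_Union finite_subset)
  then show ?thesis unfolding Z_def T_def .
qed

end

section \<open>Borel families on the orbits of countably many Borel maps\<close>

text \<open>A graph whose edges are described by countably many Borel maps: a neighbor of \<open>x\<close> is an image of \<open>x\<close>
  different from \<open>x\<close>.\<close>

locale borel_moves =
  fixes V :: "'v measure" and \<phi> :: "nat \<Rightarrow> 'v \<Rightarrow> 'v" and U :: "nat \<Rightarrow> 'v set"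
  assumes move_measurable [measurable]: "\<phi> i \<in> V \<rightarrow>\<^sub>M V"
    and U_sets [measurable]: "U k \<in> sets V"
    and U_trace: "finite F \<Longrightarrow> F \<subseteq> space V \<Longrightarrow> K \<subseteq> F \<Longrightarrow> \<exists>k. U k \<inter> F = K"
    and move_back: "x \<in> space V \<Longrightarrow> \<exists>j. \<phi> j (\<phi> i x) = x"
    and finite_moves: "x \<in> space V \<Longrightarrow> finite (range (\<lambda>i. \<phi> i x))"
begin

definition nb :: "'v \<Rightarrow> 'v set" where
  "nb x = (if x \<in> space V then range (\<lambda>i. \<phi> i x) - {x} else {})"

lemma move_space: "x \<in> space V \<Longrightarrow> \<phi> i x \<in> space V"
  using move_measurable by (rule measurable_space)

sublocale lf_graph nb
proof
  show "x \<in> nb y" if y: "y \<in> nb x" for x y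
  proof -
    obtain i where i: "x \<in> space V" "y = \<phi> i x" "y \<noteq> x"
      using y unfolding nb_def by (auto split: if_splits)
    obtain j where "\<phi> j (\<phi> i x) = x" using move_back i(1) by blast
    then have "x \<in> range (\<lambda>j. \<phi> j y)" using i(2) by (metis rangeI)
    then show ?thesis using i move_space unfolding nb_def by auto
  qed
  show "finite (nb x)" for x unfolding nb_def using finite_moves by simp
qed

definition \<theta> :: "nat list \<Rightarrow> 'v \<Rightarrow> 'v" where
  "\<theta> l = fold \<phi> l"

lemma \<theta>_Nil [simp]: "\<theta> [] x = x"
  and \<theta>_Cons [simp]: "\<theta> (i # l) x = \<theta> l (\<phi> i x)"
  and \<theta>_append [simp]: "\<theta> (l @ m) x = \<theta> m (\<theta> l x)"
  unfolding \<theta>_def by simp_all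

lemma \<theta>_measurable [measurable]: "\<theta> l \<in> V \<rightarrow>\<^sub>M V"
proof (induction l)
  case Nil
  have "\<theta> [] = (\<lambda>x. x)" by (rule ext) simp
  then show ?case by simp
next
  case (Cons i l)
  have "\<theta> (i # l) = (\<lambda>x. \<theta> l (\<phi> i x))" by (rule ext) simp
  then show ?case using Cons by simp
qed

lemma \<theta>_space: "x \<in> space V \<Longrightarrow> \<theta> l x \<in> space V"
  using \<theta>_measurable by (rule measurable_space)

lemma conn_\<theta>: "x \<in> space V \<Longrightarrow> \<theta> l x \<in> conn UNIV x"
proof (induction l arbitrary: x)
  case (Cons i l)
  have "\<phi> i x \<in> conn UNIV x"
  proof (cases "\<phi> i x = x")
    case False
    then have "\<phi> i x \<in> nb x" using Cons.prems unfolding nb_def by auto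
    then show ?thesis by (rule conn_UNIV_nbr[OF conn_refl])
  qed simp
  moreover have "\<theta> l (\<phi> i x) \<in> conn UNIV (\<phi> i x)" using Cons move_space by blast
  ultimately show ?case by (simp add: conn_trans)
qed simp

lemma orbit_eq: "x \<in> space V \<Longrightarrow> conn UNIV x = range (\<lambda>l. \<theta> l x)"
proof
  assume x: "x \<in> space V"
  show "conn UNIV x \<subseteq> range (\<lambda>l. \<theta> l x)"
  proof (rule conn_closed_subset)
    show "x \<in> range (\<lambda>l. \<theta> l x)" by (rule range_eqI[of _ _ "[]"]) simp
    fix u v assume "u \<in> range (\<lambda>l. \<theta> l x)" "v \<in> nb u"
    then obtain l i where "u = \<theta> l x" "v = \<phi> i u" unfolding nb_def by (auto split: if_splits)
    then show "v \<in> range (\<lambda>l. \<theta> l x)" by (intro range_eqI[of _ _ "l @ [i]"]) simp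
  qed
  show "range (\<lambda>l. \<theta> l x) \<subseteq> conn UNIV x" using conn_\<theta>[OF x] by blast
qed

lemma conn_subset_orbit: "conn W x \<subseteq> conn UNIV x"
  by (rule conn_mono) simp

lemma orbit_space: "x \<in> space V \<Longrightarrow> conn W x \<subseteq> space V"
  using conn_subset_orbit[of W x] orbit_eq[of x] \<theta>_space[of x] by auto

lemma orbitE:
  assumes "x \<in> space V" "y \<in> conn W x"
  obtains l where "y = \<theta> l x"
  using assms(2) conn_subset_orbit[of W x] orbit_eq[OF assms(1)] by auto

lemma points_equal_iff:
  assumes "x \<in> space V" "y \<in> space V"
  shows "x = y \<longleftrightarrow> (\<forall>k. x \<in> U k \<longleftrightarrow> y \<in> U k)"
proof
  assume *: "\<forall>k. x \<in> U k \<longleftrightarrow> y \<in> U k"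
  obtain k where "U k \<inter> {x, y} = {x}" using U_trace[of "{x, y}" "{x}"] assms by auto
  then have "x \<in> U k" "y \<in> U k \<longrightarrow> y = x" by auto
  with * show "x = y" by blast
qed simp

lemma pred_eq [measurable (raw)]:
  assumes [measurable]: "f \<in> M \<rightarrow>\<^sub>M V" "g \<in> M \<rightarrow>\<^sub>M V"
  shows "Measurable.pred M (\<lambda>x. f x = g x)"
proof -
  have "Measurable.pred M (\<lambda>x. \<forall>k. f x \<in> U k \<longleftrightarrow> g x \<in> U k)" by measurable
  moreover have "f x = g x \<longleftrightarrow> (\<forall>k. f x \<in> U k \<longleftrightarrow> g x \<in> U k)" if "x \<in> space M" for x
    using measurable_space[OF assms(1) that] measurable_space[OF assms(2) that] by (rule points_equal_iff)
  ultimately show ?thesis by (simp cong: measurable_cong)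
qed

text \<open>Subsets of components that depend on a base point in a Borel way. As a component is
  enumerated by the words \<open>\<theta> l\<close>, it suffices to ask for each word whether it leads from the base point
  into the set.\<close>

definition bfam :: "('v \<Rightarrow> 'v set) \<Rightarrow> bool" where
  "bfam F \<longleftrightarrow> (\<forall>l. Measurable.pred V (\<lambda>x. \<theta> l x \<in> F x))"

definition orbital :: "('v \<Rightarrow> 'v set) \<Rightarrow> bool" where
  "orbital F \<longleftrightarrow> (\<forall>x\<in>space V. F x \<subseteq> conn UNIV x)"

lemma bfamD: "bfam F \<Longrightarrow> Measurable.pred V (\<lambda>x. \<theta> l x \<in> F x)"
  unfolding bfam_def by blast

lemma bfamD0: "bfam F \<Longrightarrow> Measurable.pred V (\<lambda>x. x \<in> F x)"
  using bfamD[of F "[]"] by simp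

lemma bfam_Int: "bfam F \<Longrightarrow> bfam G \<Longrightarrow> bfam (\<lambda>x. F x \<inter> G x)"
  unfolding bfam_def Int_iff Un_iff Diff_iff Compl_iff by (intro allI pred_intros_logic) auto

lemma bfam_Un: "bfam F \<Longrightarrow> bfam G \<Longrightarrow> bfam (\<lambda>x. F x \<union> G x)"
  unfolding bfam_def Int_iff Un_iff Diff_iff Compl_iff by (intro allI pred_intros_logic) auto

lemma bfam_Diff: "bfam F \<Longrightarrow> bfam G \<Longrightarrow> bfam (\<lambda>x. F x - G x)"
  unfolding bfam_def Int_iff Un_iff Diff_iff Compl_iff by (intro allI pred_intros_logic) auto

lemma bfam_Compl: "bfam F \<Longrightarrow> bfam (\<lambda>x. - F x)"
  unfolding bfam_def Int_iff Un_iff Diff_iff Compl_iff by (intro allI pred_intros_logic) auto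

lemma bfam_const: "S \<in> sets V \<Longrightarrow> bfam (\<lambda>_. S)"
  unfolding bfam_def by measurable

lemma bfam_UNIV: "bfam (\<lambda>_. UNIV)"
  unfolding bfam_def by simp

lemma bfam_base: "bfam (\<lambda>x. {\<theta> m x})"
  unfolding bfam_def by measurable

text \<open>The base point may be moved along a word, since the words translate between base points.\<close>

lemma bfam_shift_base:
  assumes F: "bfam F"
  shows "bfam (\<lambda>x. F (\<theta> m x))"
  unfolding bfam_def
proof
  fix l
  have [measurable]: "Measurable.pred V (\<lambda>x. \<theta> k (\<theta> m x) \<in> F (\<theta> m x))" for k
    by (rule measurable_compose[OF \<theta>_measurable bfamD[OF F]])
  have "Measurable.pred V (\<lambda>x. \<exists>k. \<theta> k (\<theta> m x) = \<theta> l x \<and> \<theta> k (\<theta> m x) \<in> F (\<theta> m x))"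
    by measurable
  moreover have "\<theta> l x \<in> F (\<theta> m x) \<longleftrightarrow> (\<exists>k. \<theta> k (\<theta> m x) = \<theta> l x \<and> \<theta> k (\<theta> m x) \<in> F (\<theta> m x))"
    if x: "x \<in> space V" for x
  proof -
    have "\<theta> l x \<in> conn UNIV (\<theta> m x)" using conn_\<theta>[OF x] conn_eq by blast
    then obtain k where "\<theta> l x = \<theta> k (\<theta> m x)" using orbit_eq[OF \<theta>_space[OF x]] by blast
    then show ?thesis by (intro iffI exI[of _ k]) auto
  qed
  ultimately show "Measurable.pred V (\<lambda>x. \<theta> l x \<in> F (\<theta> m x))" by (simp cong: measurable_cong)
qed

lemma bfamD2: "bfam F \<Longrightarrow> Measurable.pred V (\<lambda>x. \<theta> l x \<in> F (\<theta> m x))"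
  using bfam_shift_base bfamD by blast

lemma bfam_nb: "bfam nb"
  unfolding bfam_def
proof
  fix l
  have "Measurable.pred V (\<lambda>x. \<exists>i. \<phi> i x = \<theta> l x \<and> \<theta> l x \<noteq> x)" by measurable
  moreover have "\<theta> l x \<in> nb x \<longleftrightarrow> (\<exists>i. \<phi> i x = \<theta> l x \<and> \<theta> l x \<noteq> x)" if "x \<in> space V" for x
  proof -
    have "\<theta> l x \<in> range (\<lambda>i. \<phi> i x) \<longleftrightarrow> (\<exists>i. \<phi> i x = \<theta> l x)" by (metis rangeE rangeI)
    then show ?thesis using that unfolding nb_def by simp
  qed
  ultimately show "Measurable.pred V (\<lambda>x. \<theta> l x \<in> nb x)" by (simp cong: measurable_cong)
qed

lemma bfam_nbs:
  assumes F: "bfam F" and orb: "orbital F"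
  shows "bfam (\<lambda>x. nbs (F x))"
  unfolding bfam_def
proof
  fix l
  note [measurable] = bfamD[OF F] bfamD2[OF bfam_nb]
  have "Measurable.pred V (\<lambda>x. \<exists>m. \<theta> m x \<in> F x \<and> \<theta> l x \<in> nb (\<theta> m x))" by measurable
  moreover have "\<theta> l x \<in> nbs (F x) \<longleftrightarrow> (\<exists>m. \<theta> m x \<in> F x \<and> \<theta> l x \<in> nb (\<theta> m x))" if "x \<in> space V" for x
  proof -
    have "F x \<subseteq> range (\<lambda>l. \<theta> l x)" using orb orbit_eq[OF that] that unfolding orbital_def by blast
    then show ?thesis unfolding nbs_def by blast
  qed
  ultimately show "Measurable.pred V (\<lambda>x. \<theta> l x \<in> nbs (F x))" by (simp cong: measurable_cong)
qed

lemma orbital_nbs: "orbital F \<Longrightarrow> orbital (\<lambda>x. nbs (F x))"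
  unfolding orbital_def nbs_def using conn_UNIV_nbr by blast

lemma orbital_Int1: "orbital F \<Longrightarrow> orbital (\<lambda>x. F x \<inter> G x)"
  and orbital_Int2: "orbital G \<Longrightarrow> orbital (\<lambda>x. F x \<inter> G x)"
  and orbital_Diff: "orbital F \<Longrightarrow> orbital (\<lambda>x. F x - G x)"
  unfolding orbital_def by blast+

lemma orbital_conn: "orbital (\<lambda>x. conn (W x) (\<theta> m x))"
  unfolding orbital_def
proof
  fix x assume x: "x \<in> space V"
  have "conn (W x) (\<theta> m x) \<subseteq> conn UNIV (\<theta> m x)" by (rule conn_mono) simp
  then show "conn (W x) (\<theta> m x) \<subseteq> conn UNIV x" using conn_eq[OF conn_\<theta>[OF x]] by simp
qed

lemma orbital_conn0: "orbital (\<lambda>x. conn (W x) x)"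
  using orbital_conn[of W "[]"] by simp

lemma orbital_nhood: "orbital F \<Longrightarrow> orbital (\<lambda>x. nhood d (F x))"
  unfolding orbital_def by (simp add: nhood_subset_conn)

lemma bfam_nhood:
  assumes "bfam F" "orbital F"
  shows "bfam (\<lambda>x. nhood d (F x))"
proof (induction d)
  case (Suc d)
  then show ?case using bfam_Un[OF Suc bfam_nbs[OF Suc orbital_nhood[OF assms(2)]]] by simp
qed (simp add: assms)

text \<open>Connectedness inside \<open>W\<close> is a countable union over the words that do not leave \<open>W\<close>. A letter
  that does not move the vertex is admitted everywhere, since it corresponds to no edge.\<close>

primrec walk :: "'v set \<Rightarrow> 'v \<Rightarrow> nat list \<Rightarrow> bool" where
  "walk W x [] \<longleftrightarrow> True"
| "walk W x (i # l) \<longleftrightarrow> (\<phi> i x = x \<or> x \<in> W \<and> \<phi> i x \<in> W) \<and> walk W (\<phi> i x) l"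

lemma walk_append: "walk W x (l @ m) \<longleftrightarrow> walk W x l \<and> walk W (\<theta> l x) m"
  by (induction l arbitrary: x) auto

lemma conn_iff_walk:
  assumes "x \<in> space V"
  shows "y \<in> conn W x \<longleftrightarrow> (\<exists>l. walk W x l \<and> \<theta> l x = y)"
proof
  have "conn W x \<subseteq> {y. \<exists>l. walk W x l \<and> \<theta> l x = y}"
  proof (rule conn_closed_subset)
    show "x \<in> {y. \<exists>l. walk W x l \<and> \<theta> l x = y}" by (auto intro: exI[of _ "[]"])
    fix u v assume u: "u \<in> {y. \<exists>l. walk W x l \<and> \<theta> l x = y}" and v: "v \<in> nb u" "u \<in> W" "v \<in> W"
    obtain l where l: "walk W x l" "\<theta> l x = u" using u by blast
    obtain i where "v = \<phi> i u" using v(1) unfolding nb_def by (auto split: if_splits)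
    then have "walk W x (l @ [i]) \<and> \<theta> (l @ [i]) x = v" using l v by (simp add: walk_append)
    then show "v \<in> {y. \<exists>l. walk W x l \<and> \<theta> l x = y}" by blast
  qed
  then show "y \<in> conn W x \<Longrightarrow> \<exists>l. walk W x l \<and> \<theta> l x = y" by blast
  have "\<theta> l x \<in> conn W x" if "walk W x l" for l
    using that assms
  proof (induction l arbitrary: x)
    case (Cons i l)
    have "\<phi> i x \<in> conn W x"
    proof (cases "\<phi> i x = x")
      case False
      then have "\<phi> i x \<in> nb x" using Cons.prems unfolding nb_def by auto
      then show ?thesis using conn_step[OF conn_refl] False Cons.prems by auto
    qed simp
    then show ?case using Cons move_space conn_trans by (metis \<theta>_Cons walk.simps(2))
  qed simp
  then show "\<exists>l. walk W x l \<and> \<theta> l x = y \<Longrightarrow> y \<in> conn W x" by blast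
qed

lemma pred_walk:
  assumes W: "bfam W"
  shows "Measurable.pred V (\<lambda>x. walk (W x) (\<theta> m x) l)"
proof (induction l arbitrary: m)
  case (Cons i l)
  note [measurable] = bfamD[OF W]
  have [measurable]: "Measurable.pred V (\<lambda>x. walk (W x) (\<phi> i (\<theta> m x)) l)"
    using Cons[of "m @ [i]"] by simp
  have [measurable]: "Measurable.pred V (\<lambda>x. \<phi> i (\<theta> m x) \<in> W x)" using bfamD[OF W, of "m @ [i]"] by simp
  show ?case unfolding walk.simps by measurable
qed simp

lemma bfam_conn:
  assumes W: "bfam W"
  shows "bfam (\<lambda>x. conn (W x) (\<theta> m x))"
  unfolding bfam_def
proof
  fix l
  note [measurable] = pred_walk[OF W]
  have "Measurable.pred V (\<lambda>x. \<exists>k. walk (W x) (\<theta> m x) k \<and> \<theta> k (\<theta> m x) = \<theta> l x)" by measurable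
  then show "Measurable.pred V (\<lambda>x. \<theta> l x \<in> conn (W x) (\<theta> m x))"
    by (simp add: conn_iff_walk \<theta>_space cong: measurable_cong)
qed

lemma bfam_conn0: "bfam W \<Longrightarrow> bfam (\<lambda>x. conn (W x) x)"
  using bfam_conn[of W "[]"] by simp

abbreviation pts :: "nat list list \<Rightarrow> 'v \<Rightarrow> 'v set" where
  "pts L x \<equiv> (\<lambda>l. \<theta> l x) ` set L"

lemma bfam_pts: "bfam (pts L)"
proof -
  have "Measurable.pred V (\<lambda>x. \<exists>m\<in>set L. \<theta> m x = \<theta> l x)" for l by measurable
  moreover have "(\<exists>m\<in>set L. \<theta> m x = \<theta> l x) \<longleftrightarrow> \<theta> l x \<in> pts L x" for l x
    by (metis (no_types, lifting) image_iff)
  ultimately show ?thesis unfolding bfam_def by simp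
qed

lemma orbital_pts: "orbital (pts L)"
  unfolding orbital_def using conn_\<theta> by blast

lemma finite_subset_pts:
  assumes "x \<in> space V" "finite S" "S \<subseteq> conn UNIV x"
  obtains L where "pts L x = S"
proof -
  have "\<exists>L. pts L x = S" using assms(2,3)
  proof (induction S)
    case (insert y S)
    then obtain L l where "pts L x = S" "y = \<theta> l x" using orbit_eq[OF assms(1)] by auto
    then have "pts (l # L) x = insert y S" by simp
    then show ?case by blast
  qed (auto intro: exI[of _ "[]"])
  with that show thesis by blast
qed

lemma pred_subset:
  assumes F: "bfam F" and G: "bfam G" and orb: "orbital F"
  shows "Measurable.pred V (\<lambda>x. F x \<subseteq> G x)"
proof -
  note [measurable] = bfamD[OF F] bfamD[OF G]
  have "Measurable.pred V (\<lambda>x. \<forall>l. \<theta> l x \<in> F x \<longrightarrow> \<theta> l x \<in> G x)" by measurable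
  moreover have "F x \<subseteq> G x \<longleftrightarrow> (\<forall>l. \<theta> l x \<in> F x \<longrightarrow> \<theta> l x \<in> G x)" if "x \<in> space V" for x
  proof -
    have "F x \<subseteq> range (\<lambda>l. \<theta> l x)" using orb orbit_eq[OF that] that unfolding orbital_def by blast
    then show ?thesis by blast
  qed
  ultimately show ?thesis by (simp cong: measurable_cong)
qed

lemma pred_set_eq:
  assumes "bfam F" "bfam G" "orbital F" "orbital G"
  shows "Measurable.pred V (\<lambda>x. F x = G x)"
  using pred_subset[OF assms(1,2,3)] pred_subset[OF assms(2,1,4)] by (simp add: set_eq_subset)

lemma pred_finite:
  assumes F: "bfam F" and orb: "orbital F"
  shows "Measurable.pred V (\<lambda>x. finite (F x))"
proof -
  note [measurable] = pred_subset[OF F bfam_pts orb]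
  have "Measurable.pred V (\<lambda>x. \<exists>L. F x \<subseteq> pts L x)" by measurable
  moreover have "finite (F x) \<longleftrightarrow> (\<exists>L. F x \<subseteq> pts L x)" if x: "x \<in> space V" for x
  proof
    assume "finite (F x)"
    then obtain L where "pts L x = F x"
      using finite_subset_pts[OF x, of "F x"] orb x unfolding orbital_def by blast
    then show "\<exists>L. F x \<subseteq> pts L x" by blast
  next
    assume "\<exists>L. F x \<subseteq> pts L x"
    then show "finite (F x)" by (meson finite_imageI finite_set finite_subset)
  qed
  ultimately show ?thesis by (simp cong: measurable_cong)
qed

lemma pred_distinct_pts: "Measurable.pred V (\<lambda>x. distinct (map (\<lambda>l. \<theta> l x) L))"
proof (induction L)
  case (Cons m L)
  note [measurable] = Cons
  have "Measurable.pred V (\<lambda>x. \<not> (\<exists>l\<in>set L. \<theta> m x = \<theta> l x) \<and> distinct (map (\<lambda>l. \<theta> l x) L))"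
    by measurable
  moreover have "distinct (map (\<lambda>l. \<theta> l x) (m # L)) \<longleftrightarrow>
      \<not> (\<exists>l\<in>set L. \<theta> m x = \<theta> l x) \<and> distinct (map (\<lambda>l. \<theta> l x) L)" for x
    by (auto simp: image_iff)
  ultimately show ?case by (simp only:)
qed simp

lemma pred_card:
  assumes F: "bfam F" and orb: "orbital F" and fin: "\<And>x. x \<in> space V \<Longrightarrow> finite (F x)"
  shows "Measurable.pred V (\<lambda>x. card (F x) = n)"
proof -
  note [measurable] = pred_set_eq[OF F bfam_pts orb orbital_pts] pred_distinct_pts
  have "Measurable.pred V (\<lambda>x. \<exists>L. length L = n \<and> distinct (map (\<lambda>l. \<theta> l x) L) \<and> F x = pts L x)"
    by measurable
  moreover have "card (F x) = n \<longleftrightarrow>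
      (\<exists>L. length L = n \<and> distinct (map (\<lambda>l. \<theta> l x) L) \<and> F x = pts L x)" if x: "x \<in> space V" for x
  proof
    assume n: "card (F x) = n"
    obtain ys where ys: "set ys = F x" "distinct ys" using finite_distinct_list[OF fin[OF x]] by blast
    have sub: "set ys \<subseteq> range (\<lambda>l. \<theta> l x)"
      using ys(1) orb orbit_eq[OF x] x unfolding orbital_def by blast
    define g where "g y = (SOME l. \<theta> l x = y)" for y
    have g: "\<theta> (g y) x = y" if "y \<in> set ys" for y
    proof -
      have "\<exists>l. \<theta> l x = y" using sub that by blast
      then show ?thesis unfolding g_def by (rule someI_ex)
    qed
    have "map (\<lambda>l. \<theta> l x) (map g ys) = ys" using g by (simp add: map_idI)
    then have "distinct (map (\<lambda>l. \<theta> l x) (map g ys))" "set (map (\<lambda>l. \<theta> l x) (map g ys)) = F x"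
      using ys by simp_all
    moreover have "length (map g ys) = n" using n ys distinct_card by fastforce
    ultimately show "\<exists>L. length L = n \<and> distinct (map (\<lambda>l. \<theta> l x) L) \<and> F x = pts L x"
      by (intro exI[of _ "map g ys"]) (simp add: image_image)
  next
    assume "\<exists>L. length L = n \<and> distinct (map (\<lambda>l. \<theta> l x) L) \<and> F x = pts L x"
    then obtain L where L: "length L = n" "distinct (map (\<lambda>l. \<theta> l x) L)" "F x = pts L x" by blast
    then show "card (F x) = n" using distinct_card[OF L(2)] by simp
  qed
  ultimately show ?thesis by (simp cong: measurable_cong)
qed

lemma pred_card_le:
  assumes F: "bfam F" "orbital F" "\<And>x. x \<in> space V \<Longrightarrow> finite (F x)"
    and G: "bfam G" "orbital G" "\<And>x. x \<in> space V \<Longrightarrow> finite (G x)"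
  shows "Measurable.pred V (\<lambda>x. card (F x) \<le> card (G x))"
proof -
  note [measurable] = pred_card[OF F] pred_card[OF G]
  have "Measurable.pred V (\<lambda>x. \<exists>m n. card (F x) = m \<and> card (G x) = n \<and> m \<le> n)" by measurable
  then show ?thesis by simp
qed

text \<open>Only finite sets \<open>X\<close> occur in Hall's condition, and the finite subsets of a component are
  enumerated by finite lists of words.\<close>

lemma pred_hall:
  assumes P: "bfam P" "orbital P" and Q: "bfam Q"
  shows "Measurable.pred V (\<lambda>x. hall (P x) (Q x))"
proof -
  have [measurable]: "Measurable.pred V (\<lambda>x. card (pts L x) \<le> card (nbs (pts L x) \<inter> Q x))" for L
    using bfam_nbs[OF bfam_pts orbital_pts, of L] orbital_nbs[OF orbital_pts, of L]
    by (intro pred_card_le bfam_pts orbital_pts bfam_Int Q orbital_Int1) simp_all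
  note [measurable] = pred_subset[OF bfam_pts P(1) orbital_pts]
  have "Measurable.pred V (\<lambda>x. \<forall>L. pts L x \<subseteq> P x \<longrightarrow> card (pts L x) \<le> card (nbs (pts L x) \<inter> Q x))"
    by measurable
  moreover have "hall (P x) (Q x) \<longleftrightarrow>
      (\<forall>L. pts L x \<subseteq> P x \<longrightarrow> card (pts L x) \<le> card (nbs (pts L x) \<inter> Q x))" if x: "x \<in> space V" for x
  proof
    assume R: "\<forall>L. pts L x \<subseteq> P x \<longrightarrow> card (pts L x) \<le> card (nbs (pts L x) \<inter> Q x)"
    show "hall (P x) (Q x)" unfolding hall_def
    proof (intro allI impI, elim conjE)
      fix X assume X: "finite X" "X \<subseteq> P x"
      obtain L where "pts L x = X"
        using finite_subset_pts[OF x X(1)] X(2) P(2) x unfolding orbital_def by blast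
      with R X show "card X \<le> card (nbs X \<inter> Q x)" by blast
    qed
  qed (simp add: hall_def)
  ultimately show ?thesis by (simp cong: measurable_cong)
qed

lemma bfam_image:
  assumes F: "bfam F" "orbital F" and f [measurable]: "f \<in> V \<rightarrow>\<^sub>M V"
  shows "bfam (\<lambda>x. f ` F x)"
  unfolding bfam_def
proof
  fix l
  note [measurable] = bfamD[OF F(1)]
  have "Measurable.pred V (\<lambda>x. \<exists>m. \<theta> m x \<in> F x \<and> f (\<theta> m x) = \<theta> l x)" by measurable
  moreover have "\<theta> l x \<in> f ` F x \<longleftrightarrow> (\<exists>m. \<theta> m x \<in> F x \<and> f (\<theta> m x) = \<theta> l x)" if "x \<in> space V" for x
  proof -
    have "F x \<subseteq> range (\<lambda>l. \<theta> l x)" using F(2) orbit_eq[OF that] that unfolding orbital_def by blast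
    then show ?thesis by (force simp: image_iff)
  qed
  ultimately show "Measurable.pred V (\<lambda>x. \<theta> l x \<in> f ` F x)" by (simp cong: measurable_cong)
qed

end

section \<open>Greedy Borel matchings\<close>

context borel_moves begin

lemma pred_less_nat [measurable (raw)]:
  fixes f g :: "'a \<Rightarrow> nat"
  assumes [measurable]: "f \<in> M \<rightarrow>\<^sub>M count_space UNIV" "g \<in> M \<rightarrow>\<^sub>M count_space UNIV"
  shows "Measurable.pred M (\<lambda>x. f x < g x)"
proof -
  have "Measurable.pred M (\<lambda>x. \<exists>m n. f x = m \<and> g x = n \<and> m < n)" by measurable
  then show ?thesis by simp
qed

text \<open>The groups \<open>conn W a\<close> are treated independently of each other, and within a group the vertices are
  matched in the order given by a Borel numbering \<open>\<rho>\<close> that is injective on the group. For the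
  numbering, \<open>x\<close> is described by a radius \<open>d\<close> and a set \<open>U k\<close> such that \<open>x\<close> is the only vertex of the group
  in \<open>U k\<close> within distance \<open>d\<close> from the elements of \<open>Z\<close> in the group; this is possible since the group
  contains at least one and only finitely many of them.\<close>

lemma greedy_matching:
  assumes W: "W \<in> sets V" and Z: "Z \<in> sets V" and P: "P \<in> sets V" and Q: "Q \<in> sets V"
    and finite_meet: "\<And>x. x \<in> P \<inter> W \<Longrightarrow> finite (conn W x \<inter> Z) \<and> conn W x \<inter> Z \<noteq> {}"
    and hall: "\<And>x. x \<in> space V \<Longrightarrow> hall (P \<inter> conn UNIV x) Q"
  obtains f where "f \<in> V \<rightarrow>\<^sub>M V" "\<And>a. a \<in> P \<inter> W \<Longrightarrow> f a \<in> nb a \<inter> Q"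
    "\<And>a a'. a \<in> P \<inter> W \<Longrightarrow> a' \<in> P \<inter> conn W a \<Longrightarrow> f a = f a' \<Longrightarrow> a = a'"
    "\<And>a. a \<in> P \<inter> W \<Longrightarrow> finite (conn W a) \<Longrightarrow> hall (P \<inter> conn UNIV a - conn W a) (Q - f ` (P \<inter> conn W a))"
proof -
  note [measurable] = W Z P Q
  have PV: "P \<subseteq> space V" using P sets.sets_into_space by blast
  have bW: "bfam (conn W)" by (rule bfam_conn0[OF bfam_const[OF W]])
  have oW: "orbital (conn W)" by (rule orbital_conn0)
  define G where "G n x = conn W x \<inter> nhood (fst (prod_decode n)) (conn W x \<inter> Z) \<inter> U (snd (prod_decode n))" for n x
  have bZ: "bfam (\<lambda>x. conn W x \<inter> Z)" by (intro bfam_Int bW bfam_const Z)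
  have bG: "bfam (G n)" for n
    unfolding G_def by (intro bfam_Int bW bfam_nhood bZ orbital_Int1 oW bfam_const U_sets)
  have oG: "orbital (G n)" for n unfolding G_def by (intro orbital_Int1 oW)
  have bself: "bfam (\<lambda>x. {x})" using bfam_base[of "[]"] by simp
  have oself: "orbital (\<lambda>x. {x})" unfolding orbital_def by simp
  note [measurable] = pred_set_eq[OF bG bself oG oself]
  define \<rho> where "\<rho> x = (LEAST n. G n x = {x})" for x
  have [measurable]: "\<rho> \<in> V \<rightarrow>\<^sub>M count_space UNIV" unfolding \<rho>_def by measurable
  have \<rho>: "G (\<rho> x) x = {x}" if x: "x \<in> P \<inter> W" for x
  proof -
    have xV: "x \<in> space V" using x PV by blast
    obtain z where z: "z \<in> conn W x \<inter> Z" using finite_meet[OF x] by blast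
    then have "x \<in> conn UNIV z" using conn_sym conn_subset_orbit by blast
    then obtain d where d: "x \<in> nhood d {z}" using conn_imp_nhood by blast
    have "nhood d {z} \<subseteq> nhood d (conn W x \<inter> Z)" using z by (intro nhood_mono) auto
    then have xd: "x \<in> conn W x \<inter> nhood d (conn W x \<inter> Z)" using d by auto
    have "finite (nhood d (conn W x \<inter> Z))" using finite_meet[OF x] by simp
    then have "finite (conn W x \<inter> nhood d (conn W x \<inter> Z))" by simp
    moreover have "conn W x \<inter> nhood d (conn W x \<inter> Z) \<subseteq> space V" using orbit_space[OF xV] by blast
    ultimately obtain k where "U k \<inter> (conn W x \<inter> nhood d (conn W x \<inter> Z)) = {x}"
      using U_trace[of _ "{x}"] xd by blast
    then have "G (prod_encode (d, k)) x = {x}" unfolding G_def by (simp add: Int_commute)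
    then show ?thesis unfolding \<rho>_def by (rule LeastI)
  qed
  have \<rho>_inj: "a = a'" if "a \<in> P \<inter> W" "a' \<in> P \<inter> conn W a" "\<rho> a = \<rho> a'" for a a'
  proof -
    have "a' \<in> P \<inter> W" using that(1,2) conn_subset[of a W] by blast
    moreover have "G (\<rho> a) a = G (\<rho> a) a'"
      using that(2) conn_eq[of a' W a] unfolding G_def by simp
    ultimately show ?thesis using \<rho>[of a] \<rho>[of a'] that(1,3) by simp
  qed
  define below where "below a j = {a' \<in> conn W a \<inter> P. \<rho> a' < j}" for a j
  define pre where "pre a = {a' \<in> conn W a \<inter> P. \<rho> a' < \<rho> a}" for a
  have bpre: "bfam pre"
  proof -
    note [measurable] = bfamD[OF bW]
    show ?thesis unfolding bfam_def pre_def by (intro allI) (simp, measurable)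
  qed
  have opre: "orbital pre" using oW unfolding orbital_def pre_def by blast
  define ok where "ok f a b \<longleftrightarrow> b \<in> nb a \<inter> Q - f ` pre a \<and>
      hall (P \<inter> conn UNIV a - pre a - {a}) (Q - f ` pre a - {b})" for f :: "'v \<Rightarrow> 'v" and a b
  have ok_measurable: "Measurable.pred V (\<lambda>a. ok f a (\<phi> i a))" if f: "f \<in> V \<rightarrow>\<^sub>M V" for f i
  proof -
    have bimg: "bfam (\<lambda>a. f ` pre a)" by (rule bfam_image[OF bpre opre f])
    have bb: "bfam (\<lambda>a. {\<phi> i a})" using bfam_base[of "[i]"] by simp
    have ocomp: "bfam (\<lambda>a. conn UNIV a)" by (rule bfam_conn0[OF bfam_UNIV])
    have "Measurable.pred V (\<lambda>a. \<phi> i a \<in> nb a \<inter> Q - f ` pre a)"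
      using bfamD[OF bfam_Diff[OF bfam_Int[OF bfam_nb bfam_const[OF Q]] bimg], of "[i]"] by simp
    moreover have "Measurable.pred V (\<lambda>a. hall (P \<inter> conn UNIV a - pre a - {a}) (Q - f ` pre a - {\<phi> i a}))"
      by (intro pred_hall bfam_Diff bfam_Int bfam_const P Q bimg bb bself bpre ocomp
            orbital_Diff orbital_Int2 orbital_conn0)
    ultimately show ?thesis unfolding ok_def by (rule pred_intros_logic(3))
  qed
  \<comment> \<open>Round \<open>j\<close> matches the vertices with number \<open>j\<close> in all groups at once.\<close>
  define Fs where "Fs = rec_nat (\<lambda>a. a) (\<lambda>j f a. if \<rho> a = j then \<phi> (LEAST i. ok f a (\<phi> i a)) a else f a)"
  have Fs_Suc: "Fs (Suc j) a = (if \<rho> a = j then \<phi> (LEAST i. ok (Fs j) a (\<phi> i a)) a else Fs j a)" for j a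
    unfolding Fs_def by simp
  have Fs_measurable: "Fs j \<in> V \<rightarrow>\<^sub>M V" for j
  proof (induction j)
    case 0
    show ?case unfolding Fs_def by simp
  next
    case (Suc j)
    note [measurable] = Suc ok_measurable[OF Suc]
    have [measurable]: "(\<lambda>a. \<phi> (LEAST i. ok (Fs j) a (\<phi> i a)) a) \<in> V \<rightarrow>\<^sub>M V"
      by (rule measurable_compose_countable) measurable
    have "(\<lambda>a. if \<rho> a = j then \<phi> (LEAST i. ok (Fs j) a (\<phi> i a)) a else Fs j a) \<in> V \<rightarrow>\<^sub>M V"
      by measurable
    then show ?case unfolding Fs_Suc[abs_def] .
  qed
  define f where "f a = Fs (Suc (\<rho> a)) a" for a
  have f_measurable: "f \<in> V \<rightarrow>\<^sub>M V"
    unfolding f_def by (rule measurable_compose_countable[where g = "\<lambda>a. Suc (\<rho> a)"]) (simp_all add: Fs_measurable)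
  have stable: "Fs j a = f a" if "\<rho> a < j" for j a
    using that
  proof (induction j)
    case (Suc j)
    show ?case
    proof (cases "\<rho> a = j")
      case False
      then show ?thesis using Suc Fs_Suc[of j a] by simp
    qed (simp add: f_def)
  qed simp
  have ok_eq: "ok (Fs (\<rho> a)) a b \<longleftrightarrow> ok f a b" for a b
  proof -
    have "Fs (\<rho> a) ` pre a = f ` pre a" by (rule image_cong) (auto simp: pre_def stable)
    then show ?thesis unfolding ok_def by simp
  qed
  have f_eq: "f a = \<phi> (LEAST i. ok f a (\<phi> i a)) a" for a
  proof -
    have "f a = Fs (Suc (\<rho> a)) a" by (fact f_def)
    also have "\<dots> = \<phi> (LEAST i. ok (Fs (\<rho> a)) a (\<phi> i a)) a" by (simp add: Fs_Suc)
    finally show ?thesis by (simp only: ok_eq)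
  qed
  have okI: "ok f a (f a)" if a: "a \<in> P" and h: "hall (P \<inter> conn UNIV a - pre a) (Q - f ` pre a)" for a
  proof -
    have "a \<in> P \<inter> conn UNIV a - pre a" using a unfolding pre_def by simp
    from hall_step[OF h this] obtain b where b: "b \<in> nb a \<inter> (Q - f ` pre a)"
      "hall (P \<inter> conn UNIV a - pre a - {a}) (Q - f ` pre a - {b})" by blast
    then have "ok f a b" unfolding ok_def by blast
    moreover obtain i where "b = \<phi> i a" using b(1) unfolding nb_def by (auto split: if_splits)
    ultimately have "ok f a (\<phi> i a)" by simp
    then have "ok f a (\<phi> (LEAST i. ok f a (\<phi> i a)) a)" by (rule LeastI)
    then show ?thesis using f_eq[of a] by simp
  qed
  have stage: "hall (P \<inter> conn UNIV a - below a j) (Q - f ` below a j)"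
    if a: "a \<in> P \<inter> W" for a j
  proof (induction j)
    case 0
    have "a \<in> space V" using a PV by blast
    from hall[OF this] show ?case by (simp add: below_def)
  next
    case (Suc j)
    show ?case
    proof (cases "\<exists>a'\<in>conn W a \<inter> P. \<rho> a' = j")
      case False
      then have "below a (Suc j) = below a j"
        by (auto simp: below_def less_Suc_eq)
      with Suc show ?thesis by simp
    next
      case True
      then obtain a' where a': "a' \<in> conn W a" "a' \<in> P" "\<rho> a' = j" by blast
      have eq: "conn W a' = conn W a" using conn_eq[OF a'(1)] .
      have eqU: "conn UNIV a' = conn UNIV a" using conn_eq conn_subset_orbit a'(1) by blast
      have pre: "pre a' = below a j" unfolding pre_def below_def eq a'(3) ..
      have a'W: "a' \<in> P \<inter> W" using a' a conn_subset[of a W] by blast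
      have "below a (Suc j) = insert a' (pre a')"
      proof -
        have "b = a'" if "b \<in> conn W a" "b \<in> P" "\<rho> b = j" for b
          using \<rho>_inj[OF a'W, of b] that a'(3) eq by simp
        then have "b \<in> conn W a \<inter> P \<and> \<rho> b < Suc j \<longleftrightarrow> b = a' \<or> b \<in> conn W a \<inter> P \<and> \<rho> b < j" for b
          using a' less_Suc_eq[of "\<rho> b" j] by blast
        then show ?thesis unfolding pre below_def by auto
      qed
      then have ins: "below a (Suc j) = pre a' \<union> {a'}" by simp
      have "ok f a' (f a')" by (rule okI[OF a'(2)]) (use Suc in \<open>simp add: pre eqU\<close>)
      then have "hall (P \<inter> conn UNIV a - pre a' - {a'}) (Q - f ` pre a' - {f a'})"
        unfolding ok_def eqU by blast
      moreover have "P \<inter> conn UNIV a - (pre a' \<union> {a'}) = P \<inter> conn UNIV a - pre a' - {a'}"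
        "Q - f ` (pre a' \<union> {a'}) = Q - f ` pre a' - {f a'}" by auto
      ultimately show ?thesis unfolding ins by simp
    qed
  qed
  have ok: "ok f a (f a)" if a: "a \<in> P \<inter> W" for a
    by (rule okI) (use a stage[OF a, of "\<rho> a"] in \<open>auto simp: pre_def below_def\<close>)
  show thesis
  proof (rule that)
    show "f \<in> V \<rightarrow>\<^sub>M V" by (rule f_measurable)
    show "f a \<in> nb a \<inter> Q" if "a \<in> P \<inter> W" for a using ok[OF that] unfolding ok_def by blast
    show "a = a'" if a: "a \<in> P \<inter> W" and a': "a' \<in> P \<inter> conn W a" and eq: "f a = f a'" for a a'
    proof (rule ccontr)
      assume "a \<noteq> a'"
      then have "\<rho> a \<noteq> \<rho> a'" using \<rho>_inj[OF a a'] by blast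
      have a'W: "a' \<in> P \<inter> W" using a a' conn_subset[of a W] by blast
      have e: "conn W a' = conn W a" using conn_eq a' by blast
      consider "\<rho> a < \<rho> a'" | "\<rho> a' < \<rho> a" using \<open>\<rho> a \<noteq> \<rho> a'\<close> by linarith
      then show False
      proof cases
        case 1
        then have "a \<in> pre a'" unfolding pre_def e using a by simp
        then have "f a' \<in> f ` pre a'" using eq by (metis imageI)
        with ok[OF a'W] show False unfolding ok_def by blast
      next
        case 2
        then have "a' \<in> pre a" unfolding pre_def using a' by simp
        then have "f a \<in> f ` pre a" using eq by (metis imageI)
        with ok[OF a] show False unfolding ok_def by blast
      qed
    qed
    show "hall (P \<inter> conn UNIV a - conn W a) (Q - f ` (P \<inter> conn W a))"
      if a: "a \<in> P \<inter> W" and fin: "finite (conn W a)" for a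
    proof -
      define j where "j = Suc (Max (\<rho> ` conn W a))"
      have "\<rho> b < j" if "b \<in> conn W a" for b
        unfolding j_def using fin that by (simp add: le_imp_less_Suc)
      then have "below a j = P \<inter> conn W a" unfolding below_def by auto
      moreover have "P \<inter> conn UNIV a - P \<inter> conn W a = P \<inter> conn UNIV a - conn W a" by blast
      ultimately show ?thesis using stage[OF a, of j] by simp
    qed
  qed
qed

end

section \<open>Zones\<close>

locale two_ended_bipartite = borel_moves V \<phi> U
  for V :: "'v measure" and \<phi> :: "nat \<Rightarrow> 'v \<Rightarrow> 'v" and U :: "nat \<Rightarrow> 'v set" +
  fixes A B :: "'v set" and c :: real
  assumes A [measurable]: "A \<in> sets V" and B [measurable]: "B \<in> sets V"
    and bipartite: "y \<in> nb x \<Longrightarrow> x \<in> A \<longleftrightarrow> y \<in> B" "A \<inter> B = {}"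
    and c: "c > 1"
    and expand: "finite X \<Longrightarrow> X \<subseteq> A \<Longrightarrow> c * card X \<le> card (nbs X)"
    and ends: "x \<in> space V \<Longrightarrow> at_most_two_ends (conn UNIV x)"
    and separable: "x \<in> space V \<Longrightarrow> \<exists>S. finite S \<and> S \<subseteq> conn UNIV x \<and> separator (conn UNIV x) S"
begin

text \<open>The distance needed between zones with at most \<open>n\<close> elements: the value is chosen such that
  \<open>(c - 1) * rad n \<ge> n\<close>, as \<open>hall_remove_far_pieces\<close> requires.\<close>

definition rad :: "nat \<Rightarrow> nat" where
  "rad n = Suc (nat \<lceil>n / (c - 1)\<rceil>)"

lemma rad: "real n \<le> (c - 1) * rad n" "rad n \<ge> 1"
proof -
  have "n / (c - 1) \<le> rad n" unfolding rad_def by linarith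
  then show "real n \<le> (c - 1) * rad n" using c by (simp add: field_simps)
qed (simp add: rad_def)

definition size_of :: "nat \<Rightarrow> nat" where "size_of p = fst (prod_decode p)"
definition trace_of :: "nat \<Rightarrow> 'v set" where "trace_of p = U (snd (prod_decode p))"

text \<open>The number \<open>p\<close> codes a pair consisting of a bound, used both for the size and for the diameter of a zone,
  and of the index of a set whose trace around the zone is the zone. The radius for the trace
  is the diameter plus \<open>4 * rad\<close>; it makes distinct zones with the same code have disjoint
  neighborhoods of radius \<open>2 * rad\<close>. As a zone contains the neighbors of its elements in \<open>B\<close>,
  no vertex of \<open>A\<close> outside the zone is adjacent to one of its elements.\<close>

definition zone :: "nat \<Rightarrow> 'v \<Rightarrow> 'v set \<Rightarrow> bool" where
  "zone p x K \<longleftrightarrow> K \<noteq> {} \<and> finite K \<and> K \<subseteq> conn UNIV x \<and> card K \<le> size_of p \<and>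
     (\<forall>y\<in>K. K \<subseteq> nhood (size_of p) {y}) \<and> (\<forall>y\<in>K. K \<subseteq> conn K y) \<and>
     (\<forall>b\<in>K \<inter> B. nb b \<subseteq> K) \<and> separator (conn UNIV x) K \<and>
     trace_of p \<inter> nhood (size_of p + 4 * rad (size_of p)) K = K"

lemma zoneD:
  assumes "zone p x K"
  shows "K \<noteq> {}" "finite K" "K \<subseteq> conn UNIV x" "card K \<le> size_of p"
    "\<And>y. y \<in> K \<Longrightarrow> K \<subseteq> nhood (size_of p) {y}" "\<And>y. y \<in> K \<Longrightarrow> K \<subseteq> conn K y"
    "\<And>b. b \<in> K \<Longrightarrow> b \<in> B \<Longrightarrow> nb b \<subseteq> K" "separator (conn UNIV x) K"
    "trace_of p \<inter> nhood (size_of p + 4 * rad (size_of p)) K = K"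
  using assms unfolding zone_def by blast+

lemma zone_component: "y \<in> conn UNIV x \<Longrightarrow> zone p y = zone p x"
  using conn_eq[of y UNIV x] unfolding zone_def by (intro ext) simp

lemma zone_exists:
  assumes x: "x \<in> space V"
  shows "\<exists>p K. zone p x K"
proof -
  obtain S where S: "finite S" "S \<subseteq> conn UNIV x" "separator (conn UNIV x) S"
    using separable[OF x] by blast
  have Bind: "nb b \<inter> B = {}" if "b \<in> B" for b using bipartite that by blast
  obtain K where K: "finite K" "K \<noteq> {}" "K \<subseteq> conn UNIV x" "separator (conn UNIV x) K"
      "\<And>u. u \<in> K \<Longrightarrow> K \<subseteq> conn K u" "\<And>b. b \<in> K \<inter> B \<Longrightarrow> nb b \<subseteq> K"
    using connected_closed_separator_exists[OF S(3,1,2) refl Bind] by blast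
  have "\<exists>d. K \<subseteq> nhood d {y}" if "y \<in> K" for y
    by (rule finite_subset_nhood[OF K(1)]) (use K(3) that conn_eq in blast)
  then obtain d where d: "\<And>y. y \<in> K \<Longrightarrow> K \<subseteq> nhood (d y) {y}" by metis
  define n where "n = Max (insert (card K) (d ` K))"
  have n: "card K \<le> n" "\<And>y. y \<in> K \<Longrightarrow> d y \<le> n" unfolding n_def using K(1) by auto
  have diam: "K \<subseteq> nhood n {y}" if "y \<in> K" for y
    using d[OF that] nhood_increasing[OF n(2)[OF that], of "{y}"] by blast
  let ?F = "nhood (n + 4 * rad n) K"
  have "finite ?F" using K(1) by simp
  moreover have "?F \<subseteq> space V"
    using nhood_subset_conn[OF K(3)] orbit_space[OF x] by blast
  moreover have "K \<subseteq> ?F" by (rule nhood_superset)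
  ultimately obtain k where k: "U k \<inter> ?F = K" using U_trace by blast
  have p: "size_of (prod_encode (n, k)) = n" "trace_of (prod_encode (n, k)) = U k"
    unfolding size_of_def trace_of_def by simp_all
  have "zone (prod_encode (n, k)) x K"
    unfolding zone_def p
  proof (intro conjI ballI)
    show "K \<subseteq> conn K y" if "y \<in> K" for y using K(5)[OF that] .
    show "nb b \<subseteq> K" if "b \<in> K \<inter> B" for b using K(6)[OF that] .
  qed (fact K(2) K(1) K(3) n(1) diam K(4) k)+
  then show ?thesis by blast
qed

text \<open>If \<open>K'\<close> comes close to \<open>K\<close>, then it lies in the neighborhood of \<open>K\<close> on which the common trace set
  is \<open>K\<close>, because its diameter is bounded. So \<open>K'\<close> is a subset of \<open>K\<close>, and by symmetry they are equal.\<close>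

lemma zones_far:
  assumes K: "zone p x K" "zone p x K'" "K \<noteq> K'"
  shows "nhood (4 * rad (size_of p)) K \<inter> K' = {}"
proof -
  have absorb: "L' \<subseteq> L" if L: "zone p x L" "zone p x L'" and y: "y \<in> L'" "y \<in> nhood (4 * rad (size_of p)) L" for L L' y
  proof -
    have "L' \<subseteq> nhood (size_of p) {y}" by (rule zoneD(5)[OF L(2) y(1)])
    also have "\<dots> \<subseteq> nhood (size_of p) (nhood (4 * rad (size_of p)) L)" using y(2) by (intro nhood_mono) simp
    also have "\<dots> = nhood (size_of p + 4 * rad (size_of p)) L" by (rule nhood_add)
    finally have "L' \<subseteq> nhood (size_of p + 4 * rad (size_of p)) L" .
    moreover have "L' \<subseteq> trace_of p" using zoneD(9)[OF L(2)] by blast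
    ultimately show ?thesis using zoneD(9)[OF L(1)] by blast
  qed
  show ?thesis
  proof (rule ccontr)
    assume "\<not> ?thesis"
    then obtain y where "y \<in> K'" "y \<in> nhood (4 * rad (size_of p)) K" by blast
    from absorb[OF K(1,2) this] have sub: "K' \<subseteq> K" .
    obtain z where z: "z \<in> K'" using zoneD(1)[OF K(2)] by blast
    have "z \<in> nhood (4 * rad (size_of p)) K'" using nhood_superset z by blast
    with absorb[OF K(2,1), of z] sub z have "K \<subseteq> K'" by blast
    with sub K(3) show False by blast
  qed
qed

lemma zones_far_balls:
  assumes "zone p x K" "zone p x K'" "K \<noteq> K'"
  shows "nhood (2 * rad (size_of p)) K \<inter> nhood (2 * rad (size_of p)) K' = {}"
  using zones_far[OF assms] by (intro nhood_disjointI) (simp add: mult.assoc[symmetric])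

lemma zone_nbr_unique:
  assumes "zone p x K" "zone p x K'" "u \<in> K" "v \<in> insert u (nb u)" "v \<in> K'"
  shows "K = K'"
proof (rule ccontr)
  assume "K \<noteq> K'"
  have "v \<in> nhood 1 K" using assms(3,4) by (auto simp: nbs_def)
  then have "v \<in> nhood (4 * rad (size_of p)) K"
    using nhood_increasing[of 1 "4 * rad (size_of p)" K] rad(2)[of "size_of p"] by auto
  with zones_far[OF assms(1,2) \<open>K \<noteq> K'\<close>] assms(5) show False by blast
qed

lemma pred_separator: "Measurable.pred V (\<lambda>x. separator (conn UNIV x) (pts L x))"
proof -
  have bC: "bfam (\<lambda>x. - pts L x)" by (rule bfam_Compl[OF bfam_pts])
  note [measurable] = bfamD[OF bfam_pts[of L]]
  have [measurable]: "Measurable.pred V (\<lambda>x. finite (conn (- pts L x) (\<theta> l x)))" for l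
    by (intro pred_finite bfam_conn bC orbital_conn)
  have [measurable]: "Measurable.pred V (\<lambda>x. \<theta> m x \<in> conn (- pts L x) (\<theta> l x))" for l m
    by (rule bfamD[OF bfam_conn[OF bC]])
  have "Measurable.pred V (\<lambda>x. \<exists>l m. \<theta> l x \<notin> pts L x \<and> \<theta> m x \<notin> pts L x \<and>
     \<not> finite (conn (- pts L x) (\<theta> l x)) \<and> \<not> finite (conn (- pts L x) (\<theta> m x)) \<and>
     \<not> \<theta> m x \<in> conn (- pts L x) (\<theta> l x))"
    by measurable
  moreover have "separator (conn UNIV x) (pts L x) \<longleftrightarrow> (\<exists>l m. \<theta> l x \<notin> pts L x \<and> \<theta> m x \<notin> pts L x \<and>
     \<not> finite (conn (- pts L x) (\<theta> l x)) \<and> \<not> finite (conn (- pts L x) (\<theta> m x)) \<and>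
     \<not> \<theta> m x \<in> conn (- pts L x) (\<theta> l x))" if "x \<in> space V" for x
    unfolding separator_def orbit_eq[OF that] by blast
  ultimately show ?thesis by (simp cong: measurable_cong)
qed

lemma pred_zone: "Measurable.pred V (\<lambda>x. zone p x (pts L x))"
proof -
  have [measurable]: "Measurable.pred V (\<lambda>x. card (pts L x) \<le> size_of p)"
  proof -
    note [measurable] = pred_card[OF bfam_pts orbital_pts]
    have "Measurable.pred V (\<lambda>x. \<exists>m. card (pts L x) = m \<and> m \<le> size_of p)" by measurable
    then show ?thesis by simp
  qed
  have [measurable]: "Measurable.pred V (\<lambda>x. pts L x \<subseteq> conn UNIV x)"
    by (intro pred_subset bfam_pts orbital_pts bfam_conn0[OF bfam_UNIV])
  have o1: "orbital (\<lambda>x. {\<theta> m x})" for m unfolding orbital_def using conn_\<theta> by blast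
  have [measurable]: "Measurable.pred V (\<lambda>x. pts L x \<subseteq> nhood (size_of p) {\<theta> m x})" for m
    by (intro pred_subset bfam_pts orbital_pts bfam_nhood bfam_base o1)
  have [measurable]: "Measurable.pred V (\<lambda>x. pts L x \<subseteq> conn (pts L x) (\<theta> m x))" for m
    by (intro pred_subset bfam_pts orbital_pts bfam_conn)
  have o2: "orbital (\<lambda>x. nb (\<theta> m x))" for m
    unfolding orbital_def using conn_\<theta> conn_UNIV_nbr by blast
  have [measurable]: "Measurable.pred V (\<lambda>x. nb (\<theta> m x) \<subseteq> pts L x)" for m
    by (intro pred_subset bfam_pts bfam_shift_base bfam_nb o2)
  have tr: "trace_of p \<in> sets V" unfolding trace_of_def by (rule U_sets)
  have [measurable]: "Measurable.pred V (\<lambda>x. trace_of p \<inter> nhood d (pts L x) = pts L x)" for d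
    by (intro pred_set_eq bfam_Int bfam_const tr bfam_nhood bfam_pts orbital_pts orbital_Int2 orbital_nhood)
  note [measurable] = pred_separator
  have "zone p x (pts L x) \<longleftrightarrow> L \<noteq> [] \<and> pts L x \<subseteq> conn UNIV x \<and> card (pts L x) \<le> size_of p \<and>
     (\<forall>m\<in>set L. pts L x \<subseteq> nhood (size_of p) {\<theta> m x}) \<and>
     (\<forall>m\<in>set L. pts L x \<subseteq> conn (pts L x) (\<theta> m x)) \<and>
     (\<forall>m\<in>set L. \<theta> m x \<in> B \<longrightarrow> nb (\<theta> m x) \<subseteq> pts L x) \<and> separator (conn UNIV x) (pts L x) \<and>
     trace_of p \<inter> nhood (size_of p + 4 * rad (size_of p)) (pts L x) = pts L x" for x
    unfolding zone_def by auto
  then show ?thesis by (simp only:) measurable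
qed

text \<open>The least code is the same for all vertices of a component.\<close>

definition code :: "'v \<Rightarrow> nat" where
  "code x = (LEAST p. \<exists>K. zone p x K)"

lemma pred_zone_exists: "Measurable.pred V (\<lambda>x. \<exists>K. zone p x K \<and> (x \<in> K \<or> b))"
proof -
  note [measurable] = pred_zone bfamD0[OF bfam_pts]
  have "Measurable.pred V (\<lambda>x. \<exists>L. zone p x (pts L x) \<and> (x \<in> pts L x \<or> b))" by measurable
  moreover have "(\<exists>K. zone p x K \<and> (x \<in> K \<or> b)) \<longleftrightarrow> (\<exists>L. zone p x (pts L x) \<and> (x \<in> pts L x \<or> b))"
    if x: "x \<in> space V" for x
  proof
    assume "\<exists>K. zone p x K \<and> (x \<in> K \<or> b)"
    then obtain K where K: "zone p x K" "x \<in> K \<or> b" by blast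
    obtain L where "pts L x = K" using finite_subset_pts[OF x zoneD(2,3)[OF K(1)]] by blast
    with K show "\<exists>L. zone p x (pts L x) \<and> (x \<in> pts L x \<or> b)" by blast
  qed blast
  ultimately show ?thesis by (simp cong: measurable_cong)
qed

lemma code_measurable [measurable]: "code \<in> V \<rightarrow>\<^sub>M count_space UNIV"
proof -
  have [measurable]: "Measurable.pred V (\<lambda>x. \<exists>K. zone p x K)" for p
    using pred_zone_exists[of p True] by simp
  show ?thesis unfolding code_def by measurable
qed

lemma code_component: "y \<in> conn UNIV x \<Longrightarrow> code y = code x"
  unfolding code_def using zone_component by simp

lemma zone_code_exists: "x \<in> space V \<Longrightarrow> \<exists>K. zone (code x) x K"
  unfolding code_def using zone_exists by (rule LeastI_ex)

definition zones :: "'v \<Rightarrow> 'v set set" where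
  "zones x = {K. zone (code x) x K}"

definition cut :: "'v set" where
  "cut = {x \<in> space V. x \<in> \<Union>(zones x)}"

lemma zones_component: "y \<in> conn UNIV x \<Longrightarrow> zones y = zones x"
  unfolding zones_def using zone_component code_component by simp

lemma cut_sets [measurable]: "cut \<in> sets V"
proof -
  have [measurable]: "Measurable.pred V (\<lambda>x. \<exists>K. zone p x K \<and> x \<in> K)" for p
    using pred_zone_exists[of p False] by simp
  have "Measurable.pred V (\<lambda>x. \<exists>p. code x = p \<and> (\<exists>K. zone p x K \<and> x \<in> K))" by measurable
  moreover have "x \<in> \<Union>(zones x) \<longleftrightarrow> (\<exists>p. code x = p \<and> (\<exists>K. zone p x K \<and> x \<in> K))" for x
    unfolding zones_def by auto
  ultimately show ?thesis unfolding cut_def by (simp add: pred_def)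
qed

lemma cut_component: "x \<in> space V \<Longrightarrow> cut \<inter> conn UNIV x = \<Union>(zones x)"
proof
  assume x: "x \<in> space V"
  show "cut \<inter> conn UNIV x \<subseteq> \<Union>(zones x)" using zones_component unfolding cut_def by blast
  show "\<Union>(zones x) \<subseteq> cut \<inter> conn UNIV x"
  proof
    fix y assume y: "y \<in> \<Union>(zones x)"
    then have "y \<in> conn UNIV x" unfolding zones_def using zoneD(3) by blast
    moreover from this have "y \<in> \<Union>(zones y)" "y \<in> space V"
      using y zones_component[of y x] orbit_space[OF x] by auto
    ultimately show "y \<in> cut \<inter> conn UNIV x" unfolding cut_def by blast
  qed
qed

lemma conn_cut:
  assumes K: "K \<in> zones x" and x: "x \<in> space V" and u: "u \<in> K"
  shows "conn cut u = K"
proof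
  have z: "zone (code x) x K" using K unfolding zones_def by simp
  have Kcut: "K \<subseteq> cut" using cut_component[OF x] K by blast
  show "K \<subseteq> conn cut u" using zoneD(6)[OF z u] conn_mono[OF Kcut, of u] by blast
  show "conn cut u \<subseteq> K"
  proof (rule conn_closed_subset)
    fix v w assume v: "v \<in> K" and w: "w \<in> nb v" "w \<in> cut"
    have "v \<in> conn UNIV x" using zoneD(3)[OF z] v by blast
    then have "w \<in> conn UNIV x" using w(1) by (rule conn_UNIV_nbr)
    then obtain K' where "K' \<in> zones x" "w \<in> K'" using cut_component[OF x] w(2) by blast
    moreover from this have "K = K'" using zone_nbr_unique[OF z _ v, of K' w] w(1) unfolding zones_def by blast
    ultimately show "w \<in> K" by simp
  qed (rule u)
qed

definition good :: "'v \<Rightarrow> bool" where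
  "good x \<longleftrightarrow> (\<forall>y\<in>conn UNIV x - cut. finite (conn (- cut) y))"

lemma good_component: "y \<in> conn UNIV x \<Longrightarrow> good y = good x"
  unfolding good_def using conn_eq[of y UNIV x] by simp

lemma pred_finite_piece: "Measurable.pred V (\<lambda>x. finite (conn (- cut) (\<theta> l x)))"
  by (intro pred_finite bfam_conn orbital_conn bfam_Compl bfam_const cut_sets)

lemma pred_good [measurable]: "Measurable.pred V good"
proof -
  note [measurable] = pred_finite_piece
  have "Measurable.pred V (\<lambda>x. \<forall>l. \<theta> l x \<notin> cut \<longrightarrow> finite (conn (- cut) (\<theta> l x)))" by measurable
  moreover have "good x \<longleftrightarrow> (\<forall>l. \<theta> l x \<notin> cut \<longrightarrow> finite (conn (- cut) (\<theta> l x)))" if "x \<in> space V" for x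
    unfolding good_def orbit_eq[OF that] by blast
  ultimately show ?thesis by (simp cong: measurable_cong)
qed

end

section \<open>A Borel matching for countably many Borel moves\<close>

context two_ended_bipartite begin

definition good_cut :: "'v set" where
  "good_cut = {x \<in> cut. good x}"

lemma good_cut_sets [measurable]: "good_cut \<in> sets V"
proof -
  have "good_cut = {x \<in> space V. x \<in> cut \<and> good x}" unfolding good_cut_def cut_def by blast
  moreover have "{x \<in> space V. x \<in> cut \<and> good x} \<in> sets V" by measurable
  ultimately show ?thesis by simp
qed

text \<open>The set from which the second round of the matching starts. It meets each piece of a good
  component, as well as each bad component as a whole, in a finite nonempty set: the pieces of good
  components are finite, so they may be taken entirely; in a bad component only the zone vertices
  next to an infinite piece are taken.\<close>

definition anchor :: "'v set" where
  "anchor = {x \<in> space V. if good x then x \<notin> good_cut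
     else x \<in> cut \<and> (\<exists>y\<in>nb x - cut. infinite (conn (- cut) y))}"

lemma anchor_sets: "anchor \<in> sets V"
proof -
  note [measurable] = pred_finite_piece bfamD[OF bfam_nb]
  have "Measurable.pred V (\<lambda>x. if good x then x \<notin> good_cut
     else x \<in> cut \<and> (\<exists>l. \<theta> l x \<in> nb x \<and> \<theta> l x \<notin> cut \<and> \<not> finite (conn (- cut) (\<theta> l x))))" by measurable
  moreover have "(\<exists>y\<in>nb x - cut. infinite (conn (- cut) y)) \<longleftrightarrow>
      (\<exists>l. \<theta> l x \<in> nb x \<and> \<theta> l x \<notin> cut \<and> \<not> finite (conn (- cut) (\<theta> l x)))" if x: "x \<in> space V" for x
  proof -
    have "nb x \<subseteq> range (\<lambda>l. \<theta> l x)" using conn_UNIV_nbr[OF conn_refl] orbit_eq[OF x] by blast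
    then show ?thesis by blast
  qed
  ultimately have "Measurable.pred V (\<lambda>x. if good x then x \<notin> good_cut
     else x \<in> cut \<and> (\<exists>y\<in>nb x - cut. infinite (conn (- cut) y)))" by (simp cong: measurable_cong)
  then show ?thesis unfolding anchor_def by (simp add: pred_def)
qed

lemma good_cut_good: "good x \<Longrightarrow> good_cut \<inter> conn UNIV x = cut \<inter> conn UNIV x"
  unfolding good_cut_def using good_component by blast

lemma good_cut_bad: "\<not> good x \<Longrightarrow> good_cut \<inter> conn UNIV x = {}"
  unfolding good_cut_def using good_component by blast

lemma A_space: "A \<subseteq> space V" using sets.sets_into_space[OF A] .

lemma nb_space: "nb x \<subseteq> space V"
  unfolding nb_def using move_space by auto

lemma conn_good_cut:
  assumes x: "x \<in> good_cut"
  shows "\<exists>K\<in>zones x. x \<in> K \<and> conn good_cut x = K"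
proof -
  have xg: "good x" "x \<in> cut" using x unfolding good_cut_def by auto
  then have xV: "x \<in> space V" unfolding cut_def by blast
  obtain K where K: "K \<in> zones x" "x \<in> K" using xg(2) unfolding cut_def by blast
  have eq: "conn cut x = K" by (rule conn_cut[OF K(1) xV K(2)])
  have "conn cut x \<subseteq> good_cut"
    using conn_subset[OF xg(2)] good_cut_good[OF xg(1)] conn_subset_orbit[of cut x] by blast
  then have "conn good_cut x = conn cut x" by (rule conn_restrict) (auto simp: good_cut_def)
  with eq K show ?thesis by blast
qed

lemma conn_outside_good:
  assumes x: "x \<in> space V" "x \<notin> cut" and g: "good x"
  shows "conn (space V - good_cut) x \<subseteq> conn (- cut) x"
proof (rule conn_closed_subset)
  fix u v assume u: "u \<in> conn (- cut) x" and v: "v \<in> nb u" "u \<in> space V - good_cut" "v \<in> space V - good_cut"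
  have uC: "u \<in> conn UNIV x" using u conn_subset_orbit by blast
  have vC: "v \<in> conn UNIV x" using conn_UNIV_nbr[OF uC v(1)] .
  have "u \<notin> cut" "v \<notin> cut" using uC vC v(2,3) good_cut_good[OF g] by blast+
  then show "v \<in> conn (- cut) x" using conn_step[OF u v(1)] by blast
qed simp

lemma conn_outside_bad:
  assumes x: "x \<in> space V" and g: "\<not> good x"
  shows "conn (space V - good_cut) x = conn UNIV x"
  by (rule conn_restrict) (use orbit_space[OF x, of UNIV] good_cut_bad[OF g] in blast)+

lemma bad_anchor_finite:
  assumes x: "x \<in> space V" and g: "\<not> good x"
  shows "finite (conn UNIV x \<inter> anchor)"
proof -
  have z: "\<And>K. K \<in> zones x \<Longrightarrow> zone (code x) x K" unfolding zones_def by simp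
  have T: "\<Union>(zones x) = cut \<inter> conn UNIV x" using cut_component[OF x] by simp
  have "finite {y \<in> \<Union>(zones x). \<exists>w\<in>nb y - \<Union>(zones x). infinite (conn (- \<Union>(zones x)) w)}"
  proof (rule finite_boundary_of_infinite_pieces[OF ends[OF x] refl])
    show "finite K \<and> K \<noteq> {} \<and> K \<subseteq> conn UNIV x \<and> separator (conn UNIV x) K \<and> (\<forall>u\<in>K. K \<subseteq> conn K u)"
      if "K \<in> zones x" for K using zoneD[OF z[OF that]] by blast
    show "K \<inter> K' = {}" if "K \<in> zones x" "K' \<in> zones x" "K \<noteq> K'" for K K'
      using zone_nbr_unique[OF z[OF that(1)] z[OF that(2)]] that(3) by blast
  qed
  moreover have "conn UNIV x \<inter> anchor \<subseteq>
      {y \<in> \<Union>(zones x). \<exists>w\<in>nb y - \<Union>(zones x). infinite (conn (- \<Union>(zones x)) w)}"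
  proof
    fix y assume y: "y \<in> conn UNIV x \<inter> anchor"
    then have "\<not> good y" using g good_component by blast
    then obtain w where w: "y \<in> cut" "w \<in> nb y - cut" "infinite (conn (- cut) w)"
      using y unfolding anchor_def by auto
    have "conn (- cut) w \<subseteq> conn (- \<Union>(zones x)) w" unfolding T by (rule conn_mono) blast
    then have "infinite (conn (- \<Union>(zones x)) w)" using w(3) finite_subset by blast
    moreover have "w \<notin> \<Union>(zones x)" unfolding T using w(2) by blast
    moreover have "y \<in> \<Union>(zones x)" unfolding T using w(1) y by blast
    ultimately show "y \<in> {y \<in> \<Union>(zones x). \<exists>w\<in>nb y - \<Union>(zones x). infinite (conn (- \<Union>(zones x)) w)}"
      using w(2) by blast
  qed
  ultimately show ?thesis by (rule finite_subset[rotated])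
qed

lemma bad_anchor_nonempty:
  assumes x: "x \<in> space V" and g: "\<not> good x"
  shows "conn UNIV x \<inter> anchor \<noteq> {}"
proof -
  obtain y where y: "y \<in> conn UNIV x - cut" "infinite (conn (- cut) y)" using g unfolding good_def by blast
  obtain K where K: "zone (code x) x K" using zone_code_exists[OF x] by blast
  obtain t where t: "t \<in> K" using zoneD(1)[OF K] by blast
  have "t \<in> \<Union>(zones x)" using K t unfolding zones_def by blast
  then have tc: "t \<in> cut" "t \<in> conn UNIV x" using cut_component[OF x] by blast+
  have "t \<in> conn UNIV y" using tc(2) y(1) conn_eq by blast
  then obtain u v where uv: "u \<in> conn (- cut) y" "v \<in> nb u" "v \<in> cut"
    using conn_exit[of t y cut] y(1) tc(1) by blast
  have uC: "u \<in> conn UNIV x" using uv(1) conn_subset_orbit y(1) conn_eq by blast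
  have vC: "v \<in> conn UNIV x" by (rule conn_UNIV_nbr[OF uC uv(2)])
  have "u \<notin> cut" using uv(1) conn_subset[of y "- cut"] y(1) by blast
  moreover have "infinite (conn (- cut) u)" using conn_eq[OF uv(1)] y(2) by simp
  moreover have "u \<in> nb v" using nbr_sym[OF uv(2)] .
  moreover have "\<not> good v" using good_component[OF vC] g by simp
  moreover have "v \<in> space V" using orbit_space[OF x] vC by blast
  ultimately have "v \<in> anchor" using uv(3) unfolding anchor_def by auto
  with vC show ?thesis by blast
qed

lemma hall_component: "hall (A \<inter> conn UNIV x) (space V)"
  unfolding hall_def
proof (intro allI impI, elim conjE)
  fix X assume X: "finite X" "X \<subseteq> A \<inter> conn UNIV x"
  have "real (card X) \<le> c * card X" using c by (simp add: mult_le_cancel_right1)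
  also have "\<dots> \<le> card (nbs X)" using expand[OF X(1)] X(2) by blast
  finally have "card X \<le> card (nbs X)" by simp
  moreover have "nbs X \<inter> space V = nbs X" unfolding nbs_def using nb_space by blast
  ultimately show "card X \<le> card (nbs X \<inter> space V)" by simp
qed

theorem borel_matching:
  obtains f where "f \<in> V \<rightarrow>\<^sub>M V" "\<And>a. a \<in> A \<Longrightarrow> f a \<in> nb a" "inj_on f A"
proof -
  \<comment> \<open>In the first round the groups are the zones of good components, and each of them is its own
    anchor.\<close>
  have meet1: "finite (conn good_cut x \<inter> good_cut) \<and> conn good_cut x \<inter> good_cut \<noteq> {}" if x: "x \<in> A \<inter> good_cut" for x
  proof -
    obtain K where K: "K \<in> zones x" "x \<in> K" "conn good_cut x = K" using conn_good_cut x by blast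
    have "finite K" using K(1) zoneD(2) unfolding zones_def by blast
    then show ?thesis using K x by auto
  qed
  obtain f1 where f1: "f1 \<in> V \<rightarrow>\<^sub>M V" "\<And>a. a \<in> A \<inter> good_cut \<Longrightarrow> f1 a \<in> nb a \<inter> space V"
    "\<And>a a'. a \<in> A \<inter> good_cut \<Longrightarrow> a' \<in> A \<inter> conn good_cut a \<Longrightarrow> f1 a = f1 a' \<Longrightarrow> a = a'"
    "\<And>a. a \<in> A \<inter> good_cut \<Longrightarrow> finite (conn good_cut a) \<Longrightarrow>
       hall (A \<inter> conn UNIV a - conn good_cut a) (space V - f1 ` (A \<inter> conn good_cut a))"
    using greedy_matching[OF good_cut_sets good_cut_sets A sets.top meet1 hall_component] by blast
  define used where "used = f1 ` (A \<inter> good_cut)"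
  have used_sets: "used \<in> sets V"
  proof -
    note [measurable] = f1(1)
    have "Measurable.pred V (\<lambda>y. \<exists>l. \<theta> l y \<in> A \<and> \<theta> l y \<in> good_cut \<and> f1 (\<theta> l y) = y)" by measurable
    then have "{y \<in> space V. \<exists>l. \<theta> l y \<in> A \<and> \<theta> l y \<in> good_cut \<and> f1 (\<theta> l y) = y} \<in> sets V"
      by (simp add: pred_def)
    moreover have "used = {y \<in> space V. \<exists>l. \<theta> l y \<in> A \<and> \<theta> l y \<in> good_cut \<and> f1 (\<theta> l y) = y}"
    proof (intro set_eqI iffI)
      fix y assume "y \<in> used"
      then obtain a where a: "a \<in> A \<inter> good_cut" "y = f1 a" unfolding used_def by blast
      then have y: "y \<in> nb a" "y \<in> space V" using f1(2) by blast+
      have "a \<in> conn UNIV y" using conn_UNIV_nbr[OF conn_refl nbr_sym[OF y(1)]] .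
      then obtain l where l: "a = \<theta> l y" using orbitE[OF y(2)] by metis
      have "\<theta> l y \<in> A \<and> \<theta> l y \<in> good_cut \<and> f1 (\<theta> l y) = y"
        using a(1) a(2)[symmetric] unfolding l[symmetric] by blast
      then show "y \<in> {y \<in> space V. \<exists>l. \<theta> l y \<in> A \<and> \<theta> l y \<in> good_cut \<and> f1 (\<theta> l y) = y}"
        using y(2) by blast
    next
      fix y assume "y \<in> {y \<in> space V. \<exists>l. \<theta> l y \<in> A \<and> \<theta> l y \<in> good_cut \<and> f1 (\<theta> l y) = y}"
      then obtain l where "\<theta> l y \<in> A \<inter> good_cut" "f1 (\<theta> l y) = y" by blast
      then show "y \<in> used" unfolding used_def by (metis imageI)
    qed
    ultimately show ?thesis by simp
  qed
  have used_component: "\<exists>a\<in>A \<inter> good_cut \<inter> conn UNIV x. y = f1 a" if y: "y \<in> used" "y \<in> conn UNIV x" for x y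
  proof -
    obtain a where a: "a \<in> A \<inter> good_cut" "y = f1 a" using y(1) unfolding used_def by blast
    then have "a \<in> nb y" using f1(2) nbr_sym by blast
    then have "a \<in> conn UNIV x" using conn_UNIV_nbr[OF y(2)] by blast
    with a show ?thesis by blast
  qed
  \<comment> \<open>On a bad component nothing has been matched so far, and on a good one the zones matched are far
    apart.\<close>
  have hall2: "hall ((A - good_cut) \<inter> conn UNIV x) (space V - used)" if x: "x \<in> space V" for x
  proof (cases "good x")
    case False
    have "nbs ((A - good_cut) \<inter> conn UNIV x) \<inter> used = {}"
    proof (rule ccontr)
      assume "\<not> ?thesis"
      then obtain y a where "y \<in> used" "a \<in> conn UNIV x" "y \<in> nb a" unfolding nbs_def by blast
      then have "y \<in> used" "y \<in> conn UNIV x" using conn_UNIV_nbr by blast+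
      from used_component[OF this] good_cut_bad[OF False] show False by blast
    qed
    then show ?thesis by (intro hall_mono[OF hall_component]) blast+
  next
    case True
    define n where "n = size_of (code x)"
    define F where "F K = f1 ` (A \<inter> K)" for K
    have z: "zone (code x) x K" if "K \<in> zones x" for K using that unfolding zones_def by simp
    have zone_sub: "K \<subseteq> good_cut" if "K \<in> zones x" for K
      using cut_component[OF x] good_cut_good[OF True] that by blast
    have "hall (A \<inter> conn UNIV x - \<Union>(zones x)) (space V - (\<Union>K\<in>zones x. F K))"
    proof (rule hall_remove_far_pieces[where c = c and n = n and r = "rad n"])
      show "c > 1" by (rule c)
      show "c * card X \<le> card (nbs X)" if "finite X" "X \<subseteq> A \<inter> conn UNIV x" for X
        using expand that by simp
      show "nbs (A \<inter> conn UNIV x) \<subseteq> space V" unfolding nbs_def using nb_space by blast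
      show "real n \<le> (c - 1) * rad n" "rad n \<ge> 1" using rad by auto
      show "nhood (2 * rad n) K \<inter> nhood (2 * rad n) K' = {}" if "K \<in> zones x" "K' \<in> zones x" "K \<noteq> K'" for K K'
        using zones_far_balls[OF z[OF that(1)] z[OF that(2)] that(3)] unfolding n_def .
      show "finite (F K) \<and> card (F K) \<le> n \<and> F K \<subseteq> nbs K \<and> hall (A \<inter> conn UNIV x - K) (space V - F K)"
        if K: "K \<in> zones x" for K
      proof (intro conjI)
        have fin: "finite K" by (rule zoneD(2)[OF z[OF K]])
        then show "finite (F K)" unfolding F_def by simp
        have "card (F K) \<le> card (A \<inter> K)" unfolding F_def using fin by (intro card_image_le) simp
        also have "\<dots> \<le> card K" using fin by (intro card_mono) auto
        also have "\<dots> \<le> n" unfolding n_def by (rule zoneD(4)[OF z[OF K]])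
        finally show "card (F K) \<le> n" .
        show "F K \<subseteq> nbs K"
        proof
          fix y assume "y \<in> F K"
          then obtain a where a: "a \<in> A" "a \<in> K" "y = f1 a" unfolding F_def by blast
          then have "y \<in> nb a" using f1(2)[of a] zone_sub[OF K] by blast
          then show "y \<in> nbs K" by (rule nbsI[OF a(2)])
        qed
        show "hall (A \<inter> conn UNIV x - K) (space V - F K)"
        proof (cases "A \<inter> K = {}")
          case True
          then show ?thesis unfolding F_def by (intro hall_mono[OF hall_component[of x]]) auto
        next
          case False
          then obtain a where a: "a \<in> A" "a \<in> K" by blast
          have ag: "a \<in> A \<inter> good_cut" using a zone_sub[OF K] by blast
          have aC: "a \<in> conn UNIV x" using zoneD(3)[OF z[OF K]] a by blast
          obtain K' where K': "K' \<in> zones a" "a \<in> K'" "conn good_cut a = K'" using conn_good_cut ag by blast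
          have "K' \<in> zones x" using K'(1) zones_component[OF aC] by simp
          then have "K' = K" using zone_nbr_unique[OF z z, of K' K a a] K K'(2) a(2) by blast
          then have "conn good_cut a = K" using K'(3) by simp
          moreover have "conn UNIV a = conn UNIV x" using conn_eq[OF aC] .
          ultimately show ?thesis using f1(4)[OF ag] fin unfolding F_def by simp
        qed
      qed
    qed
    moreover have "(A - good_cut) \<inter> conn UNIV x \<subseteq> A \<inter> conn UNIV x - \<Union>(zones x)"
      using cut_component[OF x] good_cut_good[OF True] by blast
    moreover have "nbs ((A - good_cut) \<inter> conn UNIV x) \<inter> (space V - (\<Union>K\<in>zones x. F K)) \<subseteq> space V - used"
    proof
      fix y assume y: "y \<in> nbs ((A - good_cut) \<inter> conn UNIV x) \<inter> (space V - (\<Union>K\<in>zones x. F K))"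
      then obtain a where "a \<in> conn UNIV x" "y \<in> nb a" unfolding nbs_def by blast
      then have yC: "y \<in> conn UNIV x" by (rule conn_UNIV_nbr)
      have "y \<notin> used"
      proof
        assume "y \<in> used"
        then obtain a where a: "a \<in> A \<inter> good_cut \<inter> conn UNIV x" "y = f1 a" using used_component yC by blast
        then have "a \<in> \<Union>(zones x)" using cut_component[OF x] unfolding good_cut_def by blast
        then have "y \<in> (\<Union>K\<in>zones x. F K)" using a unfolding F_def by blast
        with y show False by blast
      qed
      with y show "y \<in> space V - used" by blast
    qed
    ultimately show ?thesis by (rule hall_mono)
  qed
  \<comment> \<open>In the second round the groups are the finite pieces of good components and the whole bad
    components.\<close>
  define W where "W = space V - good_cut"
  have W: "W \<in> sets V" unfolding W_def by measurable
  have P: "A - good_cut \<in> sets V" by measurable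
  have meet2: "finite (conn W x \<inter> anchor) \<and> conn W x \<inter> anchor \<noteq> {}" if x: "x \<in> (A - good_cut) \<inter> W" for x
  proof (cases "good x")
    case True
    have xV: "x \<in> space V" using x unfolding W_def by blast
    have xc: "x \<notin> cut" using x True good_cut_def by blast
    have "finite (conn (- cut) x)" using True xc unfolding good_def by simp
    then have "finite (conn W x)" using conn_outside_good[OF xV xc True] finite_subset unfolding W_def by blast
    moreover have "x \<in> anchor" using True x xV unfolding anchor_def by simp
    ultimately show ?thesis using conn_refl[of x W] by blast
  next
    case False
    have xV: "x \<in> space V" using x unfolding W_def by blast
    show ?thesis
      using bad_anchor_finite[OF xV False] bad_anchor_nonempty[OF xV False] conn_outside_bad[OF xV False]
      unfolding W_def by simp
  qed
  have Q: "space V - used \<in> sets V" using used_sets by measurable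
  obtain f2 where f2: "f2 \<in> V \<rightarrow>\<^sub>M V"
    "\<And>a. a \<in> (A - good_cut) \<inter> W \<Longrightarrow> f2 a \<in> nb a \<inter> (space V - used)"
    "\<And>a a'. a \<in> (A - good_cut) \<inter> W \<Longrightarrow> a' \<in> (A - good_cut) \<inter> conn W a \<Longrightarrow> f2 a = f2 a' \<Longrightarrow> a = a'"
  proof (rule greedy_matching[OF W anchor_sets P Q meet2 hall2])
    fix g assume "g \<in> V \<rightarrow>\<^sub>M V"
      "\<And>a. a \<in> (A - good_cut) \<inter> W \<Longrightarrow> g a \<in> nb a \<inter> (space V - used)"
      "\<And>a a'. a \<in> (A - good_cut) \<inter> W \<Longrightarrow> a' \<in> (A - good_cut) \<inter> conn W a \<Longrightarrow> g a = g a' \<Longrightarrow> a = a'"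
    then show thesis by (rule that)
  qed
  have AW: "a \<in> (A - good_cut) \<inter> W" if "a \<in> A" "a \<notin> good_cut" for a
    using that A_space unfolding W_def by blast
  define f where "f a = (if a \<in> good_cut then f1 a else f2 a)" for a
  have disj: "f1 a \<noteq> f2 a'" if "a \<in> A" "a \<in> good_cut" "a' \<in> A" "a' \<notin> good_cut" for a a'
  proof
    assume "f1 a = f2 a'"
    then have "f2 a' \<in> used" using that(1,2) unfolding used_def by (metis IntI imageI)
    with f2(2)[OF AW[OF that(3,4)]] show False by blast
  qed
  have inj1: "a = a'" if aa: "a \<in> A" "a \<in> good_cut" "a' \<in> A" "a' \<in> good_cut" "f1 a = f1 a'" for a a'
  proof -
    have b: "f1 a \<in> nb a" "f1 a \<in> nb a'" using f1(2)[of a] f1(2)[of a'] aa by auto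
    have aV: "a \<in> space V" using aa A_space by blast
    have bC: "f1 a \<in> conn UNIV a" by (rule conn_UNIV_nbr[OF conn_refl b(1)])
    have a'C: "a' \<in> conn UNIV a" by (rule conn_UNIV_nbr[OF bC nbr_sym[OF b(2)]])
    obtain K where K: "K \<in> zones a" "a \<in> K" "conn good_cut a = K" using conn_good_cut aa(2) by blast
    obtain K' where K': "K' \<in> zones a'" "a' \<in> K'" using conn_good_cut aa(4) by blast
    have z: "zone (code a) a K" "zone (code a) a K'"
      using K K' zones_component[OF a'C] unfolding zones_def by auto
    have "K = K'"
    proof (rule ccontr)
      assume "K \<noteq> K'"
      let ?r = "rad (size_of (code a))"
      have "f1 a \<in> nhood 1 K" "f1 a \<in> nhood 1 K'" using b K(2) K'(2) by (auto simp: nbs_def)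
      moreover have "1 \<le> 2 * ?r" using rad(2)[of "size_of (code a)"] by simp
      ultimately have "f1 a \<in> nhood (2 * ?r) K \<inter> nhood (2 * ?r) K'"
        using nhood_increasing[of 1 "2 * ?r" K] nhood_increasing[of 1 "2 * ?r" K'] by blast
      with zones_far_balls[OF z \<open>K \<noteq> K'\<close>] show False by blast
    qed
    then have "a' \<in> A \<inter> conn good_cut a" using K(3) K'(2) aa(3) by blast
    then show ?thesis using f1(3)[of a a'] aa by blast
  qed
  \<comment> \<open>A common partner lies outside the zones, since zones contain the neighbors of their vertices in
    \<open>B\<close>. So it connects the two vertices, and they are in one group.\<close>
  have inj2: "a = a'" if aa: "a \<in> A" "a \<notin> good_cut" "a' \<in> A" "a' \<notin> good_cut" "f2 a = f2 a'" for a a'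
  proof -
    have b: "f2 a \<in> nb a" "f2 a \<in> nb a'" "f2 a \<in> space V"
      using f2(2)[OF AW[OF aa(1,2)]] f2(2)[OF AW[OF aa(3,4)]] aa(5) by auto
    have bW: "f2 a \<in> W"
    proof (rule ccontr)
      assume "f2 a \<notin> W"
      then have bg: "f2 a \<in> good_cut" using b(3) unfolding W_def by blast
      obtain K where K: "K \<in> zones (f2 a)" "f2 a \<in> K" "conn good_cut (f2 a) = K"
        using conn_good_cut[OF bg] by blast
      have "f2 a \<in> B" using bipartite(1)[OF b(1)] aa(1) by blast
      then have "nb (f2 a) \<subseteq> K" using zoneD(7)[of "code (f2 a)" "f2 a" K] K unfolding zones_def by blast
      then have "a \<in> K" using nbr_sym[OF b(1)] by blast
      moreover have "K \<subseteq> good_cut" using K(3) conn_subset[OF bg] by blast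
      ultimately show False using aa(2) by blast
    qed
    have "a \<in> W" "a' \<in> W" using AW aa by blast+
    then have "f2 a \<in> conn W a" using conn_step[OF conn_refl b(1)] bW by blast
    then have "a' \<in> conn W a" using conn_step[OF _ nbr_sym[OF b(2)]] bW \<open>a' \<in> W\<close> by blast
    then show ?thesis using f2(3)[OF AW[OF aa(1,2)], of a'] aa by blast
  qed
  show thesis
  proof (rule that)
    note [measurable] = f1(1) f2(1)
    show "f \<in> V \<rightarrow>\<^sub>M V" unfolding f_def by measurable
    show "f a \<in> nb a" if "a \<in> A" for a
      using f1(2)[of a] f2(2)[of a] AW[OF that] that unfolding f_def by auto
    show "inj_on f A"
    proof (rule inj_onI)
      fix a a' assume "a \<in> A" "a' \<in> A" "f a = f a'"
      then show "a = a'"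
        using inj1[of a a'] inj2[of a a'] disj[of a a'] disj[of a' a] unfolding f_def
        by (cases "a \<in> good_cut"; cases "a' \<in> good_cut") simp_all
    qed
  qed
qed

end

section \<open>From edges to Borel moves\<close>

context lf_graph begin

text \<open>Paths that start in a component of the graph stay there, so it does not matter whether the graph
  is first restricted to this component.\<close>

lemma infinite_components_eq:
  assumes N: "\<And>u. N u = neighbors E \<pi> u" and C: "C = conn UNIV x0"
  shows "infinite_components (C - S) {e \<in> {e \<in> E. \<pi> e \<subseteq> C}. \<pi> e \<inter> S = {}} \<pi> =
    {conn (-S) y |y. y \<in> C - S \<and> infinite (conn (-S) y)}"
proof -
  let ?E = "{e \<in> {e \<in> E. \<pi> e \<subseteq> C}. \<pi> e \<inter> S = {}}"
  have nE: "v \<in> neighbors ?E \<pi> u \<longleftrightarrow> v \<in> N u \<and> u \<in> C - S \<and> v \<in> C - S" for u v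
    unfolding N neighbors_def by auto
  have rel: "{(u, v). v \<in> neighbors ?E \<pi> u}\<^sup>* `` {y} = conn (C - S) y" for y
    unfolding nE conn_def by auto
  have restrict: "conn (C - S) y = conn (-S) y" if y: "y \<in> C - S" for y
  proof (rule conn_restrict)
    have "conn (-S) y \<subseteq> conn UNIV y" by (rule conn_mono) simp
    also have "conn UNIV y = C" using y C conn_eq by blast
    finally show "conn (-S) y \<subseteq> C - S" using conn_subset[of y "-S"] y by blast
  qed blast
  have cls: "({(u, v). v \<in> neighbors ?E \<pi> u}\<^sup>* \<inter> (C - S) \<times> (C - S)) `` {y} = conn (-S) y"
    if y: "y \<in> C - S" for y
  proof -
    have "({(u, v). v \<in> neighbors ?E \<pi> u}\<^sup>* \<inter> (C - S) \<times> (C - S)) `` {y} =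
        {(u, v). v \<in> neighbors ?E \<pi> u}\<^sup>* `` {y} \<inter> (C - S)" using y by auto
    also have "\<dots> = conn (C - S) y" unfolding rel using conn_subset[OF y] by blast
    finally show ?thesis using restrict[OF y] by simp
  qed
  show ?thesis
    unfolding infinite_components_def graph_components_def quotient_def using cls by auto
qed

text \<open>The supremum of the numbers of infinite components is 2. So no finite set leaves three of them, and
  some finite set leaves two, as a supremum of numbers up to 1 would be at most 1.\<close>

lemma two_ended_imp:
  assumes N: "\<And>u. N u = neighbors E \<pi> u" and C: "C = conn UNIV x0"
    and two: "number_of_ends C {e \<in> E. \<pi> e \<subseteq> C} \<pi> = 2"
  shows "at_most_two_ends C" and "\<exists>S. finite S \<and> S \<subseteq> C \<and> separator C S"
proof -
  define I where "I S = {conn (-S) y |y. y \<in> C - S \<and> infinite (conn (-S) y)}" for S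
  have SUP: "(SUP S\<in>{S. finite S \<and> S \<subseteq> C}. ecard (I S)) = 2"
    using two unfolding number_of_ends_def infinite_components_eq[OF N C] I_def .
  show "at_most_two_ends C" unfolding at_most_two_ends_def
  proof (intro allI impI, elim conjE, rule ccontr)
    fix S x y z assume S: "finite S" "S \<subseteq> C" and xyz: "x \<in> C - S" "y \<in> C - S" "z \<in> C - S"
      and inf: "infinite (conn (-S) x)" "infinite (conn (-S) y)" "infinite (conn (-S) z)"
      and no: "\<not> (y \<in> conn (-S) x \<or> z \<in> conn (-S) x \<or> z \<in> conn (-S) y)"
    have "ecard (I S) \<le> 2" unfolding SUP[symmetric] by (rule SUP_upper) (use S in simp)
    then have fin: "finite (I S)" and card: "card (I S) \<le> 2"
      unfolding ecard_def by (auto split: if_splits simp: numeral_eq_enat)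
    have "{conn (-S) x, conn (-S) y, conn (-S) z} \<subseteq> I S" unfolding I_def using xyz inf by blast
    from card_mono[OF fin this] card have "card {conn (-S) x, conn (-S) y, conn (-S) z} \<le> 2" by linarith
    moreover have "conn (-S) x \<noteq> conn (-S) y" "conn (-S) x \<noteq> conn (-S) z" "conn (-S) y \<noteq> conn (-S) z"
      using no unfolding conn_eq_iff by auto
    ultimately show False by simp
  qed
  show "\<exists>S. finite S \<and> S \<subseteq> C \<and> separator C S"
  proof (rule ccontr)
    assume no: "\<nexists>S. finite S \<and> S \<subseteq> C \<and> separator C S"
    have "ecard (I S) \<le> 1" if S: "finite S" "S \<subseteq> C" for S
    proof -
      have "\<not> separator C S" using no S by blast
      then have same: "P = Q" if "P \<in> I S" "Q \<in> I S" for P Q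
        using that conn_eq_iff unfolding I_def separator_def by blast
      have "I S = {} \<or> (\<exists>P. I S = {P})" using same by blast
      then show ?thesis unfolding ecard_def by (auto simp: one_enat_def)
    qed
    then have "(SUP S\<in>{S. finite S \<and> S \<subseteq> C}. ecard (I S)) \<le> 1" by (intro SUP_least) auto
    then show False unfolding SUP by (simp add: numeral_eq_enat one_enat_def)
  qed
qed

end

lemma measurable_transport:
  fixes f g :: "'z \<Rightarrow> 'x" and W :: "nat \<Rightarrow> 'x set"
  assumes N: "codable N" and f: "f \<in> N \<rightarrow>\<^sub>M M" and g: "g \<in> N \<rightarrow>\<^sub>M M" and P: "P \<in> sets N" "inj_on f P"
    and W: "\<And>k. W k \<in> sets M" "\<And>x y. x \<in> space M \<Longrightarrow> y \<in> space M \<Longrightarrow> x \<noteq> y \<Longrightarrow> \<exists>k. x \<in> W k \<longleftrightarrow> y \<notin> W k"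
  shows "(\<lambda>x. if x \<in> f ` P then g (the_inv_into P f x) else x) \<in> M \<rightarrow>\<^sub>M M" (is "?h \<in> _")
proof (rule measurableI)
  have PN: "P \<subseteq> space N" using P(1) sets.sets_into_space by blast
  have h: "?h (f e) = g e" if "e \<in> P" for e using that the_inv_into_f_f[OF P(2)] by simp
  have img: "f ` Q \<in> sets M" if "Q \<in> sets N" "Q \<subseteq> P" for Q
    by (rule injective_image_measurable[OF N f that(1) inj_on_subset[OF P(2) that(2)] W])
  show "?h x \<in> space M" if "x \<in> space M" for x
  proof (cases "x \<in> f ` P")
    case True
    then obtain e where e: "e \<in> P" "x = f e" by blast
    then show ?thesis using h[OF e(1)] measurable_space[OF g, of e] PN by auto
  qed (use that in simp)
  fix S assume S: "S \<in> sets M"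
  have "?h -` S \<inter> space M = f ` (P \<inter> (g -` S \<inter> space N)) \<union> (S - f ` P)"
  proof (intro set_eqI)
    fix x
    show "x \<in> ?h -` S \<inter> space M \<longleftrightarrow> x \<in> f ` (P \<inter> (g -` S \<inter> space N)) \<union> (S - f ` P)"
    proof (cases "x \<in> f ` P")
      case True
      then obtain e where e: "e \<in> P" "x = f e" by blast
      have "x \<in> space M" using e PN measurable_space[OF f] by blast
      moreover have "x \<in> f ` (P \<inter> (g -` S \<inter> space N)) \<longleftrightarrow> g e \<in> S"
        using e PN inj_onD[OF P(2)] by blast
      ultimately show ?thesis using True h[OF e(1)] e(2) by auto
    next
      case False
      then have "x \<notin> f ` (P \<inter> (g -` S \<inter> space N))" by blast
      then show ?thesis using False sets.sets_into_space[OF S] by auto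
    qed
  qed
  moreover have "f ` (P \<inter> (g -` S \<inter> space N)) \<in> sets M"
    by (rule img) (use P(1) measurable_sets[OF g S] in auto)
  moreover have "f ` P \<in> sets M" by (rule img[OF P(1)]) simp
  ultimately show "?h -` S \<inter> space M \<in> sets M" using S by auto
qed

text \<open>Pairs meeting a Borel set form a measurable set of unordered pairs, since the corresponding ordered pairs
  are described coordinatewise.\<close>

lemma meeting_edges_measurable:
  assumes W: "\<And>k. W k \<in> sets V" "\<And>x y. x \<in> space V \<Longrightarrow> y \<in> space V \<Longrightarrow> x \<noteq> y \<Longrightarrow> \<exists>k::nat. x \<in> W k \<longleftrightarrow> y \<notin> W k"
    and \<pi>: "\<pi> \<in> measurable E (unordered_pairs V)" and S: "S \<in> sets V"
  shows "{e \<in> space E. \<pi> e \<inter> S \<noteq> {}} \<in> sets E"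
proof -
  note [measurable] = W(1) S
  have diag: "{(x, y). x \<in> space V \<and> y \<in> space V \<and> x \<noteq> y} =
      {p \<in> space (V \<Otimes>\<^sub>M V). \<exists>k. fst p \<in> W k \<longleftrightarrow> snd p \<notin> W k}"
    using W(2) by (auto simp: space_pair_measure)
  have d: "{(x, y). x \<in> space V \<and> y \<in> space V \<and> x \<noteq> y} \<in> sets (V \<Otimes>\<^sub>M V)"
    unfolding diag by measurable
  let ?Q = "{q \<in> space (unordered_pairs V). q \<inter> S \<noteq> {}}"
  have "{(x, y). x \<in> space V \<and> y \<in> space V \<and> x \<noteq> y \<and> {x, y} \<in> ?Q} =
      {(x, y). x \<in> space V \<and> y \<in> space V \<and> x \<noteq> y} \<inter> {p \<in> space (V \<Otimes>\<^sub>M V). fst p \<in> S \<or> snd p \<in> S}"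
    unfolding space_unordered_pairs by (auto simp: space_pair_measure)
  also have "\<dots> \<in> sets (V \<Otimes>\<^sub>M V)" using d by (rule sets.Int) measurable
  finally have "?Q \<in> sets (unordered_pairs V)" unfolding sets_unordered_pairs[OF d] by blast
  from measurable_sets[OF \<pi> this] have "\<pi> -` ?Q \<inter> space E \<in> sets E" .
  moreover have "\<pi> -` ?Q \<inter> space E = {e \<in> space E. \<pi> e \<inter> S \<noteq> {}}"
    using measurable_space[OF \<pi>] by auto
  ultimately show ?thesis by simp
qed

text \<open>The maps \<open>h n\<close> follow the relation \<open>{(f e, g e)}\<close> from its first to its second coordinate; they are single
  valued because \<open>f\<close> is injective on \<open>P n\<close>.\<close>

lemma moves_along_fibres:
  fixes f g :: "'z \<Rightarrow> 'x" and W :: "nat \<Rightarrow> 'x set"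
  assumes N: "standard_borel N" and f: "f \<in> N \<rightarrow>\<^sub>M M" and g: "g \<in> N \<rightarrow>\<^sub>M M"
    and fin: "\<And>x. x \<in> space N \<Longrightarrow> finite {y \<in> space N. f y = f x}"
    and W: "\<And>k. W k \<in> sets M" "\<And>x y. x \<in> space M \<Longrightarrow> y \<in> space M \<Longrightarrow> x \<noteq> y \<Longrightarrow> \<exists>k. x \<in> W k \<longleftrightarrow> y \<notin> W k"
  obtains P h where "\<And>n::nat. P n \<in> sets N" "\<And>n. inj_on f (P n)" "(\<Union>n. P n) = space N"
    "\<And>n. h n \<in> M \<rightarrow>\<^sub>M M" "\<And>n e. e \<in> P n \<Longrightarrow> h n (f e) = g e"
    "\<And>n x. h n x = x \<or> (\<exists>e\<in>P n. x = f e \<and> h n x = g e)"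
proof (rule finite_to_one_cover[OF N f fin W])
  fix P :: "nat \<Rightarrow> 'z set"
  assume P: "\<And>n. P n \<in> sets N" "\<And>n. inj_on f (P n)" "(\<Union>n. P n) = space N"
  define h where "h n x = (if x \<in> f ` P n then g (the_inv_into (P n) f x) else x)" for n x
  have eq: "h n (f e) = g e" if "e \<in> P n" for n e
    unfolding h_def using that the_inv_into_f_f[OF P(2) that] by simp
  show thesis
  proof (rule that[OF P])
    show "h n \<in> M \<rightarrow>\<^sub>M M" for n
      unfolding h_def by (rule measurable_transport[OF standard_borel_codable[OF N] f g P(1,2) W])
    show "h n (f e) = g e" if "e \<in> P n" for n e by (rule eq[OF that])
    show "h n x = x \<or> (\<exists>e\<in>P n. x = f e \<and> h n x = g e)" for n x
      using eq unfolding h_def by auto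
  qed
qed

section \<open>Borel matchings in everywhere two-ended graphs\<close>

theorem theorem1p10:
  fixes V :: "'v measure" and E :: "'e measure" and \<pi> :: "'e \<Rightarrow> 'v set"
    and A B :: "'v set"
  assumes "borel_graph V E \<pi>"
    and "locally_finite_graph (space V) (space E) \<pi>"
    and "bipartition (space V) (space E) \<pi> A B"
    and "A \<in> sets V" and "B \<in> sets V"
    and "combinatorial_expansion (space E) \<pi> A"
    and "everywhere_two_ended (space V) (space E) \<pi>"
  shows "\<exists>M. M \<in> sets E \<and> matching (space E) \<pi> M \<and> covers \<pi> M A"
proof -
  have sV: "standard_borel V" and sE: "standard_borel E" and \<pi>: "\<pi> \<in> measurable E (unordered_pairs V)"
    using assms(1) unfolding borel_graph_def by auto
  have AB: "A \<union> B = space V" "A \<inter> B = {}" using assms(3) unfolding bipartition_def by auto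
  have ends0: "\<exists>a b. a \<in> A \<and> b \<in> B \<and> \<pi> e = {a, b}" if "e \<in> space E" for e
    using assms(3) that unfolding bipartition_def by blast
  then have "\<forall>e\<in>space E. \<exists>p. fst p \<in> A \<and> snd p \<in> B \<and> \<pi> e = {fst p, snd p}"
    by (metis fst_conv snd_conv)
  from bchoice[OF this] obtain p where p: "\<forall>e\<in>space E. fst (p e) \<in> A \<and> snd (p e) \<in> B \<and> \<pi> e = {fst (p e), snd (p e)}" ..
  define \<alpha> where "\<alpha> e = fst (p e)" for e
  define \<beta> where "\<beta> e = snd (p e)" for e
  have \<alpha>\<beta>: "\<alpha> e \<in> A" "\<beta> e \<in> B" "\<pi> e = {\<alpha> e, \<beta> e}" if "e \<in> space E" for e
    using p that unfolding \<alpha>_def \<beta>_def by auto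
  have space: "\<alpha> e \<in> space V" "\<beta> e \<in> space V" "\<alpha> e \<noteq> \<beta> e" if "e \<in> space E" for e
    using \<alpha>\<beta>[OF that] AB by auto
  obtain U :: "nat \<Rightarrow> 'v set" where U: "\<And>k. U k \<in> sets V"
    "\<And>F K. finite F \<Longrightarrow> F \<subseteq> space V \<Longrightarrow> K \<subseteq> F \<Longrightarrow> \<exists>k. U k \<inter> F = K"
    using standard_borel_finite_traces[OF sV] by metis
  have Usep: "\<exists>k. x \<in> U k \<longleftrightarrow> y \<notin> U k" if xy: "x \<in> space V" "y \<in> space V" "x \<noteq> y" for x y
  proof -
    obtain k where "U k \<inter> {x, y} = {x}" using U(2)[of "{x, y}" "{x}"] xy by auto
    with xy(3) show ?thesis by (intro exI[of _ k]) auto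
  qed
  have endpoint: "\<gamma> \<in> E \<rightarrow>\<^sub>M V" if X: "X \<in> sets V" and \<gamma>: "\<And>e. e \<in> space E \<Longrightarrow> \<pi> e \<inter> X = {\<gamma> e}" for \<gamma> X
  proof (rule measurableI)
    show "\<gamma> e \<in> space V" if "e \<in> space E" for e
      using \<gamma>[OF that] sets.sets_into_space[OF X] by blast
    fix S assume S: "S \<in> sets V"
    have "\<pi> e \<inter> (S \<inter> X) = {\<gamma> e} \<inter> S" if "e \<in> space E" for e using \<gamma>[OF that] by blast
    then have "e \<in> \<gamma> -` S \<inter> space E \<longleftrightarrow> e \<in> {e \<in> space E. \<pi> e \<inter> (S \<inter> X) \<noteq> {}}" for e
      by (cases "e \<in> space E") simp_all
    then have "\<gamma> -` S \<inter> space E = {e \<in> space E. \<pi> e \<inter> (S \<inter> X) \<noteq> {}}" by (rule set_eqI)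
    also have "\<dots> \<in> sets E" by (rule meeting_edges_measurable[OF U(1) Usep \<pi>]) (use S X in auto)
    finally show "\<gamma> -` S \<inter> space E \<in> sets E" .
  qed
  have sides: "\<pi> e \<inter> A = {\<alpha> e}" "\<pi> e \<inter> B = {\<beta> e}" if "e \<in> space E" for e
    using \<alpha>\<beta>[OF that] AB(2) by auto
  have \<alpha>_meas: "\<alpha> \<in> E \<rightarrow>\<^sub>M V" by (rule endpoint[OF assms(4) sides(1)])
  have \<beta>_meas: "\<beta> \<in> E \<rightarrow>\<^sub>M V" by (rule endpoint[OF assms(5) sides(2)])
  have lf: "finite {e \<in> space E. x \<in> \<pi> e}" if "x \<in> space V" for x
    using assms(2) that unfolding locally_finite_graph_def by blast
  have fin_\<alpha>: "finite {e' \<in> space E. \<alpha> e' = \<alpha> e}" if e: "e \<in> space E" for e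
    by (rule finite_subset[OF _ lf[OF space(1)[OF e]]]) (use \<alpha>\<beta> in auto)
  have fin_\<beta>: "finite {e' \<in> space E. \<beta> e' = \<beta> e}" if e: "e \<in> space E" for e
    by (rule finite_subset[OF _ lf[OF space(2)[OF e]]]) (use \<alpha>\<beta> in auto)
  obtain P toB where P: "\<And>n::nat. P n \<in> sets E" "\<And>n. inj_on \<alpha> (P n)" "(\<Union>n. P n) = space E"
    and toB: "\<And>n. toB n \<in> V \<rightarrow>\<^sub>M V" and toB_eq: "\<And>n e. e \<in> P n \<Longrightarrow> toB n (\<alpha> e) = \<beta> e"
    and toB_cases: "\<And>n x. toB n x = x \<or> (\<exists>e\<in>P n. x = \<alpha> e \<and> toB n x = \<beta> e)"
    by (rule moves_along_fibres[OF sE \<alpha>_meas \<beta>_meas fin_\<alpha> U(1) Usep]) (assumption | blast)+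
  obtain R toA where R: "(\<Union>n::nat. R n) = space E"
    and toA: "\<And>n. toA n \<in> V \<rightarrow>\<^sub>M V" and toA_eq: "\<And>n e. e \<in> R n \<Longrightarrow> toA n (\<beta> e) = \<alpha> e"
    and toA_cases: "\<And>n x. toA n x = x \<or> (\<exists>e\<in>R n. x = \<beta> e \<and> toA n x = \<alpha> e)"
    by (rule moves_along_fibres[OF sE \<beta>_meas \<alpha>_meas fin_\<beta> U(1) Usep]) (assumption | blast)+
  define \<phi> where "\<phi> i = (if even i then toB (i div 2) else toA (i div 2))" for i
  have PE: "e \<in> space E" if "e \<in> P n" for e n using that P(3) by blast
  have RE: "e \<in> space E" if "e \<in> R n" for e n using that R by blast
  have \<phi>_toB: "\<phi> (2 * n) = toB n" and \<phi>_toA: "\<phi> (Suc (2 * n)) = toA n" for n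
    unfolding \<phi>_def by simp_all
  have nbr: "range (\<lambda>i. \<phi> i x) - {x} = neighbors (space E) \<pi> x" for x
  proof (intro set_eqI iffI)
    fix y assume "y \<in> range (\<lambda>i. \<phi> i x) - {x}"
    then obtain i where i: "y = \<phi> i x" "y \<noteq> x" by blast
    have "\<exists>e\<in>space E. \<pi> e = {x, y}"
    proof (cases "even i")
      case True
      then have "y = toB (i div 2) x" using i unfolding \<phi>_def by simp
      then obtain e where "e \<in> P (i div 2)" "x = \<alpha> e" "y = \<beta> e" using toB_cases[of "i div 2" x] i(2) by auto
      then show ?thesis using PE \<alpha>\<beta>(3) by blast
    next
      case False
      then have "y = toA (i div 2) x" using i unfolding \<phi>_def by simp
      then obtain e where "e \<in> R (i div 2)" "x = \<beta> e" "y = \<alpha> e" using toA_cases[of "i div 2" x] i(2) by auto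
      then show ?thesis using RE \<alpha>\<beta>(3) by blast
    qed
    then show "y \<in> neighbors (space E) \<pi> x" unfolding neighbors_def by blast
  next
    fix y assume "y \<in> neighbors (space E) \<pi> x"
    then obtain e where e: "e \<in> space E" "\<pi> e = {x, y}" unfolding neighbors_def by blast
    have "x = \<alpha> e \<and> y = \<beta> e \<or> x = \<beta> e \<and> y = \<alpha> e"
      using \<alpha>\<beta>(3)[OF e(1)] e(2) by (simp add: doubleton_eq_iff)
    then show "y \<in> range (\<lambda>i. \<phi> i x) - {x}"
    proof (elim disjE conjE)
      assume xy: "x = \<alpha> e" "y = \<beta> e"
      obtain n where "e \<in> P n" using e(1) P(3) by blast
      then have "y = \<phi> (2 * n) x" unfolding \<phi>_toB using toB_eq xy by simp
      then have "y \<in> range (\<lambda>i. \<phi> i x)" by (rule range_eqI)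
      then show ?thesis using xy space(3)[OF e(1)] by auto
    next
      assume xy: "x = \<beta> e" "y = \<alpha> e"
      obtain n where "e \<in> R n" using e(1) R by blast
      then have "y = \<phi> (Suc (2 * n)) x" unfolding \<phi>_toA using toA_eq xy by simp
      then have "y \<in> range (\<lambda>i. \<phi> i x)" by (rule range_eqI)
      then show ?thesis using xy space(3)[OF e(1)] by auto
    qed
  qed
  have nbr_space: "x \<in> space V" "y \<in> space V" if y: "y \<in> neighbors (space E) \<pi> x" for x y
  proof -
    obtain e where e: "e \<in> space E" "\<pi> e = {x, y}" using y unfolding neighbors_def by blast
    have "{x, y} \<subseteq> space V" using \<alpha>\<beta>(3)[OF e(1)] space[OF e(1)] e(2) by auto
    then show "x \<in> space V" "y \<in> space V" by auto
  qed
  have nbr_fin: "finite (neighbors (space E) \<pi> x)" if x: "x \<in> space V" for x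
  proof (rule finite_subset)
    show "neighbors (space E) \<pi> x \<subseteq> (\<Union>e\<in>{e \<in> space E. x \<in> \<pi> e}. \<pi> e)"
      unfolding neighbors_def by auto
    show "finite (\<Union>e\<in>{e \<in> space E. x \<in> \<pi> e}. \<pi> e)" using lf[OF x] \<alpha>\<beta>(3) by auto
  qed
  interpret moves: borel_moves V \<phi> U
  proof
    show "\<phi> i \<in> V \<rightarrow>\<^sub>M V" for i unfolding \<phi>_def using toB toA by simp
    show "U k \<in> sets V" for k by (rule U(1))
    show "\<exists>k. U k \<inter> F = K" if "finite F" "F \<subseteq> space V" "K \<subseteq> F" for F K by (rule U(2)[OF that])
    show "\<exists>j. \<phi> j (\<phi> i x) = x" for x i
    proof (cases "\<phi> i x = x")
      case False
      then have "\<phi> i x \<in> neighbors (space E) \<pi> x" using nbr[of x] by blast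
      then have "x \<in> neighbors (space E) \<pi> (\<phi> i x)" unfolding neighbors_def by (simp add: insert_commute)
      then have "x \<in> range (\<lambda>j. \<phi> j (\<phi> i x))" unfolding nbr[symmetric] by simp
      then show ?thesis by (elim rangeE) (rule exI, rule sym)
    next
      case True
      then have "\<phi> i (\<phi> i x) = x" by simp
      then show ?thesis by (rule exI)
    qed
    show "finite (range (\<lambda>i. \<phi> i x))" if "x \<in> space V" for x
      using nbr[of x] nbr_fin[OF that] by (metis finite_Diff2 finite.emptyI finite.insertI)
  qed
  have nb: "moves.nb x = neighbors (space E) \<pi> x" for x
    unfolding moves.nb_def using nbr[of x] nbr_space[of _ x] by auto
  have component: "moves.conn UNIV x \<in> graph_components (space V) (space E) \<pi>" if x: "x \<in> space V" for x
  proof -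
    have "moves.conn UNIV x = ({(x, y). y \<in> neighbors (space E) \<pi> x}\<^sup>* \<inter> space V \<times> space V) `` {x}"
      using moves.orbit_space[OF x, of UNIV] x unfolding moves.conn_def nb by auto
    then show ?thesis unfolding graph_components_def using x by (auto intro: quotientI)
  qed
  have two: "number_of_ends (moves.conn UNIV x) {e \<in> space E. \<pi> e \<subseteq> moves.conn UNIV x} \<pi> = 2"
    if "x \<in> space V" for x
    using assms(7) component[OF that] unfolding everywhere_two_ended_def by blast
  obtain c :: real where c: "c > 1" "\<And>S. finite S \<Longrightarrow> S \<subseteq> A \<Longrightarrow> finite (\<Union>x\<in>S. neighbors (space E) \<pi> x) \<Longrightarrow>
      real (card (\<Union>x\<in>S. neighbors (space E) \<pi> x)) \<ge> c * real (card S)"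
    using assms(6) unfolding combinatorial_expansion_def by blast
  interpret graph: two_ended_bipartite V \<phi> U A B c
  proof
    show "A \<in> sets V" "B \<in> sets V" "A \<inter> B = {}" "c > 1" by (fact assms(4) assms(5) AB(2) c(1))+
    show "x \<in> A \<longleftrightarrow> y \<in> B" if y: "y \<in> moves.nb x" for x y
    proof -
      obtain e where e: "e \<in> space E" "\<pi> e = {x, y}" using y unfolding nb neighbors_def by blast
      have "x = \<alpha> e \<and> y = \<beta> e \<or> x = \<beta> e \<and> y = \<alpha> e"
        using \<alpha>\<beta>(3)[OF e(1)] e(2) by (simp add: doubleton_eq_iff)
      then show ?thesis using \<alpha>\<beta>[OF e(1)] AB(2) by auto
    qed
    show "c * card X \<le> card (moves.nbs X)" if "finite X" "X \<subseteq> A" for X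
      using c(2)[OF that] moves.finite_nbs[OF that(1)] unfolding moves.nbs_def nb by simp
    show "moves.at_most_two_ends (moves.conn UNIV x)" if "x \<in> space V" for x
      by (rule moves.two_ended_imp(1)[OF nb refl two[OF that]])
    show "\<exists>S. finite S \<and> S \<subseteq> moves.conn UNIV x \<and> moves.separator (moves.conn UNIV x) S"
      if "x \<in> space V" for x
      by (rule moves.two_ended_imp(2)[OF nb refl two[OF that]])
  qed
  obtain f where f: "f \<in> V \<rightarrow>\<^sub>M V" "\<And>a. a \<in> A \<Longrightarrow> f a \<in> moves.nb a" "inj_on f A"
    by (rule graph.borel_matching) blast
  \<comment> \<open>Several parallel edges may join a vertex to its partner. The edge is taken from the first set
    \<open>P n\<close> containing one of them; it is unique as \<open>\<alpha>\<close> is injective there.\<close>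
  define fits where "fits n e \<longleftrightarrow> toB n (\<alpha> e) = f (\<alpha> e)" for n e
  define M where "M = (\<Union>n. {e \<in> space E. e \<in> P n \<and> fits n e \<and> (\<forall>m<n. \<not> fits m e)})"
  have fits_meas: "Measurable.pred E (fits n)" for n
  proof -
    note [measurable] = toB \<alpha>_meas f(1)
    show ?thesis unfolding fits_def by measurable
  qed
  have "M \<in> sets E"
    unfolding M_def
  proof (rule sets.countable_UN', simp)
    note [measurable] = fits_meas P(1)
    show "(\<lambda>n. {e \<in> space E. e \<in> P n \<and> fits n e \<and> (\<forall>m<n. \<not> fits m e)}) ` UNIV \<subseteq> sets E"
      by (intro image_subsetI) measurable
  qed
  have ME: "e \<in> space E" "\<beta> e = f (\<alpha> e)" if "e \<in> M" for e
    using that toB_eq unfolding M_def fits_def by auto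
  have M_inj: "e = e'" if e: "e \<in> M" "e' \<in> M" and eq: "\<alpha> e = \<alpha> e'" for e e'
  proof -
    obtain n where n: "e \<in> P n" "fits n e" "\<forall>m<n. \<not> fits m e" using e(1) unfolding M_def by blast
    obtain n' where n': "e' \<in> P n'" "fits n' e'" "\<forall>m<n'. \<not> fits m e'" using e(2) unfolding M_def by blast
    have "fits m e = fits m e'" for m unfolding fits_def eq ..
    then have "n = n'" using n(2,3) n'(2,3) by (metis linorder_neqE_nat)
    then show ?thesis using n(1) n'(1) P(2) eq by (metis inj_onD)
  qed
  have "matching (space E) \<pi> M" unfolding matching_def disjoint_family_on_def
  proof (intro conjI ballI impI)
    show "M \<subseteq> space E" using ME by blast
    fix e e' assume e: "e \<in> M" "e' \<in> M" "e \<noteq> e'"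
    have a: "\<alpha> e \<noteq> \<alpha> e'" using M_inj e by blast
    then have b: "\<beta> e \<noteq> \<beta> e'"
      using ME[OF e(1)] ME[OF e(2)] \<alpha>\<beta>(1) f(3) by (metis inj_onD)
    show "\<pi> e \<inter> \<pi> e' = {}"
      using a b \<alpha>\<beta>[OF ME(1)[OF e(1)]] \<alpha>\<beta>[OF ME(1)[OF e(2)]] AB(2) by auto
  qed
  moreover have "covers \<pi> M A" unfolding covers_def
  proof
    fix a assume a: "a \<in> A"
    obtain e where e: "e \<in> space E" "\<pi> e = {a, f a}" using f(2)[OF a] unfolding nb neighbors_def by blast
    have ae: "\<alpha> e = a" "\<beta> e = f a"
      using \<alpha>\<beta>[OF e(1)] e(2) a AB(2) by (auto simp: doubleton_eq_iff)
    obtain m where "e \<in> P m" using e(1) P(3) by blast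
    then have ex: "\<exists>n. toB n a = f a" using toB_eq[of e m] ae by auto
    define n where "n = (LEAST n. toB n a = f a)"
    have n: "toB n a = f a" "\<And>m. m < n \<Longrightarrow> toB m a \<noteq> f a"
      unfolding n_def using LeastI_ex[OF ex] not_less_Least by auto
    have "f a \<noteq> a" using ae space(3)[OF e(1)] by auto
    then obtain e' where e': "e' \<in> P n" "a = \<alpha> e'" using toB_cases[of n a] n(1) by auto
    then have "e' \<in> M" unfolding M_def fits_def using n PE[OF e'(1)] by auto
    moreover have "a \<in> \<pi> e'" using \<alpha>\<beta>(3)[OF PE[OF e'(1)]] e'(2) by simp
    ultimately show "\<exists>e\<in>M. a \<in> \<pi> e" by blast
  qed
  ultimately show ?thesis using \<open>M \<in> sets E\<close> by blast
qed

end
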